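(* Consider the problem of minimizing $J(x(\cdot))=\int_{t_0}^{t_1}L(t,x(t),\dot x(t))\,dt$ over $x(\cdot)\in KC^1(I,\mathbb R^n)$ with $x(t_0)=x_0$, $x(t_1)=x_1$. Let the admissible function $\bar x(\cdot)$ be a weak local minimum in this problem. Then there exists $\delta>0$ for which the following statements are valid: (j) If $L$ and $L_{\dot x}$ are twice differentiable in the totality of variables, $\theta\in[t_0,t_1)$ (respectively $\theta\in(t_0,t_1]$), and $\bar x(\cdot)$ is twice differentiable in a semi-neighborhood $[\theta,\theta+\alpha)\subset I$ (respectively $(\theta-\alpha,\theta]\subset I$), $\alpha>0$, of $\theta$, then for every $\eta\in B_\delta(0)$ satisfying $$E(\bar L)(\theta+,\eta)=\eta^T\bar L_{\dot x\dot x}(\theta+)\eta=0\qquad\big(\text{respectively } E(\bar L)(\theta-,\eta)=\eta^T\bar L_{\dot x\dot x}(\theta-)\eta=0\big)$$ one has $$\eta^T\big(\bar L_x(\theta+,\eta)-\bar L_x(\theta+)-\bar L_{x\dot x}(\theta+)\eta\big)+\frac{d}{dt}E(\bar L)(\theta+,\eta)+\frac12\frac{d}{dt}\eta^T\bar L_{\dot x\dot x}(\theta+)\eta\ge0$$ $$\Big(\text{respectively } \eta^T\big(\bar L_x(\theta-,\eta)-\bar L_x(\theta-)-\bar L_{x\dot x}(\theta-)\eta\big)+\frac{d}{dt}E(\bar L)(\theta-,\eta)+\frac12\frac{d}{dt}\eta^T\bar L_{\dot x\dot x}(\theta-)\eta\le0\Big).$$ (jj) If $L$ and $L_{\dot x}$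 are twice continuously differentiable in the totality of variables, $\theta\in(t_0,t_1)$, and $\bar x(\cdot)$ is twice differentiable at $\theta$, then for every $\eta\in B_\delta(0)$ satisfying $$E(\bar L)(\theta,\eta)=\eta^T\bar L_{\dot x\dot x}(\theta)\eta=0$$ one has $$\eta^T\big[L_x(\theta,\bar x(\theta),\dot{\bar x}(\theta)+\eta)-\bar L_x(\theta)-\bar L_{x\dot x}(\theta)\eta\big]=0.$$
   Context: Setting. $(a,b)\subset\mathbb R$ is an interval, $I:=[t_0,t_1]\subset(a,b)$ with $t_0<t_1$, $x_0,x_1\in\mathbb R^n$, and $L=L(t,x,\dot x):(a,b)\times\mathbb R^n\times\mathbb R^n\to\mathbb R$ is continuously differentiable in the totality of variables; $L_x,L_{\dot x}$ are its partial gradients (column vectors) with respect to the second and third arguments, $L_{x\dot x},L_{\dot x\dot x}$ the matrices of second partial derivatives; $T$ denotes transposition; $B_\delta(0)$ is the closed ball of radius $\delta$ centered at $0\in\mathbb R^n$. $KC^1(I,\mathbb R^n)$ is the set of piecewise-smooth functions: continuous functions $x:I\to\mathbb R^n$ whose derivative is continuous on $I$ except at finitely many points of $(t_0,t_1)$ (angular points), where $\dot x$ has discontinuities of the first kind (finite one-sided limits); at $t_0$ and $t_1$ the right, respectively left, values of $\dot x$ are finite. A function $x(\cdot)\in KC^1(I,\mathbb R^n)$ with $x(t_0)=x_0$, $x(t_1)=x_1$ is called admissible. An admissible $\bar x(\cdot)$ is a weak local minimum if there is $\hat\delta>0$ such that $J(x(\cdot))\ge J(\bar x(\cdot))$ for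 all admissible $x(\cdot)$ with $\max\{\|x(\cdot)-\bar x(\cdot)\|_{C(I,\mathbb R^n)},\|\dot x(\cdot)-\dot{\bar x}(\cdot)\|_{L_\infty(I,\mathbb R^n)}\}\le\hat\delta$. Notation along $\bar x(\cdot)$, for $\xi\in\mathbb R^n$: a bar means evaluation along $\bar x(\cdot)$: $\bar L(t)=L(t,\bar x(t),\dot{\bar x}(t))$, and similarly $\bar L_x(t),\bar L_{\dot x}(t),\bar L_{x\dot x}(t),\bar L_{\dot x\dot x}(t)$; $\bar L_x(t,\xi)=L_x(t,\bar x(t),\dot{\bar x}(t)+\xi)$; $$E(\bar L)(t,\xi)=L(t,\bar x(t),\dot{\bar x}(t)+\xi)-\bar L(t)-\bar L_{\dot x}^T(t)\xi .$$ One-sided values: $F(\theta+)$ (resp. $F(\theta-)$) is the right-hand (left-hand) limit of $F$ at $\theta$; for the functions above it is obtained by using $\dot{\bar x}(\theta+)$ (resp. $\dot{\bar x}(\theta-)$) in place of $\dot{\bar x}(\theta)$. $\frac{d}{dt}F(\theta\pm)$ is the corresponding one-sided derivative at $\theta$ of $t\mapsto F(t)$ (other arguments fixed), where the value at $\theta$ is taken to be $F(\theta\pm)$. *)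

theory Defs
  imports "HOL-Analysis.Analysis" "HOL-Probability.Essential_Supremum"
begin

section \<open>Smoothness classes\<close>

definition C1_on :: "('a::real_normed_vector \<Rightarrow> 'b::real_normed_vector) \<Rightarrow> 'a set \<Rightarrow> bool" where
  "C1_on f S \<longleftrightarrow>
     (\<exists>f' :: 'a \<Rightarrow> 'a \<Rightarrow>\<^sub>L 'b.
        (\<forall>z\<in>S. (f has_derivative blinfun_apply (f' z)) (at z within S)) \<and> continuous_on S f')"

text \<open>The second derivative is the Frechet derivative of the first one and need not be
  continuous. On a half-open interval the derivatives at the endpoint are one-sided.\<close>

definition twice_differentiable_on ::
    "('a::real_normed_vector \<Rightarrow> 'b::real_normed_vector) \<Rightarrow> 'a set \<Rightarrow> bool" where
  "twice_differentiable_on f S \<longleftrightarrow>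
     (\<exists>f' :: 'a \<Rightarrow> 'a \<Rightarrow>\<^sub>L 'b.
        (\<forall>z\<in>S. (f has_derivative blinfun_apply (f' z)) (at z within S)) \<and> f' differentiable_on S)"

definition C2_on :: "('a::real_normed_vector \<Rightarrow> 'b::real_normed_vector) \<Rightarrow> 'a set \<Rightarrow> bool" where
  "C2_on f S \<longleftrightarrow>
     (\<exists>(f' :: 'a \<Rightarrow> 'a \<Rightarrow>\<^sub>L 'b) (f'' :: 'a \<Rightarrow> 'a \<Rightarrow>\<^sub>L ('a \<Rightarrow>\<^sub>L 'b)).
        (\<forall>z\<in>S. (f has_derivative blinfun_apply (f' z)) (at z within S)) \<and>
        (\<forall>z\<in>S. (f' has_derivative blinfun_apply (f'' z)) (at z within S)) \<and>
        continuous_on S f'')"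

definition twice_differentiable_at ::
    "('a::real_normed_vector \<Rightarrow> 'b::real_normed_vector) \<Rightarrow> 'a \<Rightarrow> bool" where
  "twice_differentiable_at f z \<longleftrightarrow>
     (\<exists>f' :: 'a \<Rightarrow> 'a \<Rightarrow>\<^sub>L 'b.
        (\<forall>\<^sub>F y in nhds z. (f has_derivative blinfun_apply (f' y)) (at y)) \<and>
        f' differentiable (at z))"

section \<open>Partial derivatives of the Lagrangian\<close>

text \<open>A Lagrangian is a function of the triple \<open>(t, x, v)\<close>, with \<open>v\<close> in the role of the velocity.\<close>

definition grad :: "('a::real_inner \<Rightarrow> real) \<Rightarrow> 'a \<Rightarrow> 'a" where
  "grad f y = (THE D. GDERIV f y :> D)"

definition grad_x :: "(real \<times> (real^'n) \<times> (real^'n) \<Rightarrow> real) \<Rightarrow> real \<times> (real^'n) \<times> (real^'n) \<Rightarrow> real^'n" where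
  "grad_x L = (\<lambda>(t, x, v). grad (\<lambda>y. L (t, y, v)) x)"

definition grad_v :: "(real \<times> (real^'n) \<times> (real^'n) \<Rightarrow> real) \<Rightarrow> real \<times> (real^'n) \<times> (real^'n) \<Rightarrow> real^'n" where
  "grad_v L = (\<lambda>(t, x, v). grad (\<lambda>w. L (t, x, w)) v)"

text \<open>The entry in row \<open>i\<close> and column \<open>j\<close> of \<open>hess_xv\<close> is the derivative of the \<open>i\<close>-th component
  of \<open>grad_x L\<close> with respect to \<open>v $ j\<close>.\<close>

definition hess_xv :: "(real \<times> (real^'n) \<times> (real^'n) \<Rightarrow> real) \<Rightarrow> real \<times> (real^'n) \<times> (real^'n) \<Rightarrow> real^'n^'n" where
  "hess_xv L = (\<lambda>(t, x, v). jacobian (\<lambda>w. grad_x L (t, x, w)) (at v))"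

definition hess_vv :: "(real \<times> (real^'n) \<times> (real^'n) \<Rightarrow> real) \<Rightarrow> real \<times> (real^'n) \<times> (real^'n) \<Rightarrow> real^'n^'n" where
  "hess_vv L = (\<lambda>(t, x, v). jacobian (\<lambda>w. grad_v L (t, x, w)) (at v))"

section \<open>The variational problem\<close>

text \<open>One-sided at the endpoints of the interval \<open>I\<close>; an unspecified value at angular points.\<close>

definition vel :: "real set \<Rightarrow> (real \<Rightarrow> real^'n) \<Rightarrow> real \<Rightarrow> real^'n" where
  "vel I x t = vector_derivative x (at t within I)"

text \<open>Only the values of \<open>x\<close> on \<open>{t0..t1}\<close> matter; \<open>S\<close> contains the angular points.\<close>

definition KC1 :: "real \<Rightarrow> real \<Rightarrow> (real \<Rightarrow> real^'n) \<Rightarrow> bool" where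
  "KC1 t0 t1 x \<longleftrightarrow>
     continuous_on {t0..t1} x \<and>
     (\<exists>S. finite S \<and> S \<subseteq> {t0<..<t1} \<and>
        (\<forall>t\<in>{t0..t1} - S. x differentiable (at t within {t0..t1})) \<and>
        continuous_on ({t0..t1} - S) (vel {t0..t1} x) \<and>
        (\<forall>s\<in>S. (\<exists>l. (vel {t0..t1} x \<longlongrightarrow> l) (at_left s)) \<and>
               (\<exists>r. (vel {t0..t1} x \<longlongrightarrow> r) (at_right s))))"

definition admissible :: "real \<Rightarrow> real \<Rightarrow> real^'n \<Rightarrow> real^'n \<Rightarrow> (real \<Rightarrow> real^'n) \<Rightarrow> bool" where
  "admissible t0 t1 x0 x1 x \<longleftrightarrow> KC1 t0 t1 x \<and> x t0 = x0 \<and> x t1 = x1"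

definition J :: "(real \<times> (real^'n) \<times> (real^'n) \<Rightarrow> real) \<Rightarrow> real \<Rightarrow> real \<Rightarrow> (real \<Rightarrow> real^'n) \<Rightarrow> real" where
  "J L t0 t1 x = integral {t0..t1} (\<lambda>t. L (t, x t, vel {t0..t1} x t))"

definition weak_local_min ::
    "(real \<times> (real^'n) \<times> (real^'n) \<Rightarrow> real) \<Rightarrow> real \<Rightarrow> real \<Rightarrow> real^'n \<Rightarrow> real^'n \<Rightarrow> (real \<Rightarrow> real^'n) \<Rightarrow> bool" where
  "weak_local_min L t0 t1 x0 x1 xb \<longleftrightarrow>
     admissible t0 t1 x0 x1 xb \<and>
     (\<exists>d>0. \<forall>x. admissible t0 t1 x0 x1 x \<and>
        max (SUP t\<in>{t0..t1}. ereal (norm (x t - xb t)))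
            (esssup (lebesgue_on {t0..t1})
               (\<lambda>t. ereal (norm (vel {t0..t1} x t - vel {t0..t1} xb t)))) \<le> ereal d
        \<longrightarrow> J L t0 t1 x \<ge> J L t0 t1 xb)"

section \<open>Evaluation along a trajectory\<close>

definition Lx_bar ::
    "(real \<times> (real^'n) \<times> (real^'n) \<Rightarrow> real) \<Rightarrow> real set \<Rightarrow> (real \<Rightarrow> real^'n) \<Rightarrow> real \<Rightarrow> real^'n \<Rightarrow> real^'n" where
  "Lx_bar L I xb t \<xi> = grad_x L (t, xb t, vel I xb t + \<xi>)"

definition Lxv_bar ::
    "(real \<times> (real^'n) \<times> (real^'n) \<Rightarrow> real) \<Rightarrow> real set \<Rightarrow> (real \<Rightarrow> real^'n) \<Rightarrow> real \<Rightarrow> real^'n^'n" where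
  "Lxv_bar L I xb t = hess_xv L (t, xb t, vel I xb t)"

definition Lvv_bar ::
    "(real \<times> (real^'n) \<times> (real^'n) \<Rightarrow> real) \<Rightarrow> real set \<Rightarrow> (real \<Rightarrow> real^'n) \<Rightarrow> real \<Rightarrow> real^'n^'n" where
  "Lvv_bar L I xb t = hess_vv L (t, xb t, vel I xb t)"

definition E_bar ::
    "(real \<times> (real^'n) \<times> (real^'n) \<Rightarrow> real) \<Rightarrow> real set \<Rightarrow> (real \<Rightarrow> real^'n) \<Rightarrow> real \<Rightarrow> real^'n \<Rightarrow> real" where
  "E_bar L I xb t \<xi> =
     L (t, xb t, vel I xb t + \<xi>) - L (t, xb t, vel I xb t) - grad_v L (t, xb t, vel I xb t) \<bullet> \<xi>"

section \<open>One-sided values and derivatives\<close>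

definition right_val :: "(real \<Rightarrow> 'a::t2_space) \<Rightarrow> real \<Rightarrow> 'a" where
  "right_val F \<theta> = Lim (at_right \<theta>) F"

definition left_val :: "(real \<Rightarrow> 'a::t2_space) \<Rightarrow> real \<Rightarrow> 'a" where
  "left_val F \<theta> = Lim (at_left \<theta>) F"

text \<open>The value of \<open>F\<close> at \<open>\<theta>\<close> itself is replaced by its one-sided limit before differentiating.\<close>

definition right_deriv :: "(real \<Rightarrow> real) \<Rightarrow> real \<Rightarrow> real" where
  "right_deriv F \<theta> = vector_derivative (F(\<theta> := right_val F \<theta>)) (at_right \<theta>)"

definition left_deriv :: "(real \<Rightarrow> real) \<Rightarrow> real \<Rightarrow> real" where
  "left_deriv F \<theta> = vector_derivative (F(\<theta> := left_val F \<theta>)) (at_left \<theta>)"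

end

(* Fix theta and test the minimality of xb with tents that start at theta with slope eta on a
   stretch of length m = kappa e^2 and return to zero with slope -mu eta, mu = m / (e - m), at
   distance e (mirrored for the left-hand version). Since the first variation vanishes, the increment
   of J is the integral of a remainder which is, divided by m^2 / 2 and as e -> 0, the
   expression in the theorem up to O(kappa): the first stretch contributes the derivative of the
   excess and the term with L_x, while the long stretch with small slope contributes
   the term with L_xv and, because eta is a null direction of L_vv, half the derivative of the Legendre form.
   The scale mu ~ kappa e makes mere differentiability (rather than continuity) of the second
   derivatives sufficient. For (jj), fixed proportions m / e give the Weierstrass condition, hence
   the Legendre condition, near theta; the excess and the Legendre form are then minimal at theta,
   their derivatives vanish, and the two one-sided inequalities become an equality. *)

theory Submission
  imports Defs
begin

section \<open>Differentiation along lines and curves\<close>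

text \<open>The main terms of the increment have size m^2 whenever m is much smaller than e; it is
  the errors that fix the scale. Differentiability of \<open>\<lambda>z. L' z u\<close> at the
  single point \<open>c 0\<close> leaves an error \<rho> e, with \<rho> > 0 arbitrary, at points
  whose distance is of order e. Integrated against a height of order m over a length e it gives
  \<rho> m e^2, which is negligible against m^2 only if m is not much smaller than e^2. On the other
  hand the velocity step \<mu> shifts the Legendre form by O(\<mu>), and this has to be small
  compared with e. With m = \<kappa> e^2 and \<rho> = \<kappa>^2 both relative errors are
  O(\<kappa>), so e tends to 0 first and \<kappa> afterwards. The estimates are made in an abstract
  phase space that contains time as a coordinate, along a curve that starts at parameter 0. Only the
  curve and the two directions know the orientation of time, so both one-sided statements, endpoints
  and angular points are a single case.\<close>

lemma has_real_derivative_along_curve: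
  fixes f :: "'b::real_normed_vector \<Rightarrow> real"
  assumes "(\<gamma> has_vector_derivative \<gamma>') (at t within S)" "(f has_derivative f') (at (\<gamma> t))"
  shows "((\<lambda>t. f (\<gamma> t)) has_real_derivative f' \<gamma>') (at t within S)"
proof -
  have "((\<lambda>t. f (\<gamma> t)) has_derivative (\<lambda>h. f' (h *\<^sub>R \<gamma>'))) (at t within S)"
    using assms(1) unfolding has_vector_derivative_def
    by (rule has_derivative_compose) (use assms(2) in simp)
  moreover have "(\<lambda>h. f' (h *\<^sub>R \<gamma>')) = (*) (f' \<gamma>')"
    using has_derivative_linear[OF assms(2)] by (auto simp: linear_scale)
  ultimately show ?thesis by (simp add: has_field_derivative_def)
qed

lemma DERIV_along:
  fixes f :: "'a::real_normed_vector \<Rightarrow> real"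
  assumes "(f has_derivative f') (at (z + s *\<^sub>R w))"
  shows "((\<lambda>s. f (z + s *\<^sub>R w)) has_real_derivative f' w) (at s)"
proof -
  have "((\<lambda>s. z + s *\<^sub>R w) has_derivative (\<lambda>h. h *\<^sub>R w)) (at s)"
    by (auto intro!: derivative_eq_intros)
  from has_derivative_compose[OF this assms]
  have "((\<lambda>s. f (z + s *\<^sub>R w)) has_derivative (\<lambda>h. f' (h *\<^sub>R w))) (at s)" .
  moreover have "(\<lambda>h. f' (h *\<^sub>R w)) = (*) (f' w)"
    using has_derivative_linear[OF assms] by (auto simp: linear_scale)
  ultimately show ?thesis by (simp add: has_field_derivative_def)
qed

lemma mvt_along:
  fixes f :: "'a::real_normed_vector \<Rightarrow> real"
  assumes "\<And>s. 0 \<le> s \<Longrightarrow> s \<le> r \<Longrightarrow> (f has_derivative f' (z + s *\<^sub>R w)) (at (z + s *\<^sub>R w))" and "0 \<le> r"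
  obtains s where "0 \<le> s" "s \<le> r" "f (z + r *\<^sub>R w) - f z = r * f' (z + s *\<^sub>R w) w"
proof (cases "r = 0")
  case True
  then show ?thesis using that[of 0] by simp
next
  case False
  then have "0 < r" using assms(2) by simp
  from MVT2[OF this DERIV_along[OF assms(1)]]
  obtain s where "0 < s" "s < r" "f (z + r *\<^sub>R w) - f (z + 0 *\<^sub>R w) = (r - 0) * f' (z + s *\<^sub>R w) w"
    by auto
  then show ?thesis using that[of s] by simp
qed

text \<open>Lagrange form of the remainder: it asks for no continuity of \<open>q\<close>, which in
  the later uses is a second derivative controlled only near or at \<open>c 0\<close>.\<close>

lemma second_order_taylor_along:
  fixes f g q :: "'a::real_normed_vector \<Rightarrow> real"
  assumes f: "\<And>s. 0 \<le> s \<Longrightarrow> s \<le> r \<Longrightarrow> ((\<lambda>s. f (z + s *\<^sub>R w)) has_real_derivative g (z + s *\<^sub>R w)) (at s)"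
    and g: "\<And>s. 0 \<le> s \<Longrightarrow> s \<le> r \<Longrightarrow> ((\<lambda>s. g (z + s *\<^sub>R w)) has_real_derivative q (z + s *\<^sub>R w)) (at s)"
    and "0 < r"
  obtains s where "0 < s" "s < r" "f (z + r *\<^sub>R w) - f z - r * g z = r^2 / 2 * q (z + s *\<^sub>R w)"
proof -
  define diff where "diff m = (\<lambda>s. (if m = 0 then f else if m = 1 then g else q) (z + s *\<^sub>R w))" for m :: nat
  have "\<exists>s. 0 < s \<and> s < r \<and> f (z + r *\<^sub>R w) = (\<Sum>m<2. diff m 0 / fact m * r^m) + diff 2 s / fact 2 * r^2"
    using f g \<open>0 < r\<close> by (intro Maclaurin) (auto simp: diff_def less_2_cases_iff)
  then show ?thesis
    using that by (auto simp: diff_def numeral_2_eq_2 algebra_simps)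
qed

lemma has_derivative_bound:
  fixes f :: "'a::real_normed_vector \<Rightarrow> real"
  assumes "(f has_derivative f') (at z)" "0 < \<rho>"
  obtains d where "0 < d" "\<And>w. norm (w - z) < d \<Longrightarrow> \<bar>f w - f z - f' (w - z)\<bar> \<le> \<rho> * norm (w - z)"
  using assms unfolding has_derivative_at_alt by force

text \<open>Both sides are the limit of the second difference quotient of \<open>f\<close>; the second derivative
  is only needed at \<open>z\<close>.\<close>

lemma mixed_derivatives_eq:
  fixes f p g :: "'a::real_normed_vector \<Rightarrow> real"
  assumes "open D" "z \<in> D"
    and f: "\<And>y. y \<in> D \<Longrightarrow> (f has_derivative f' y) (at y)"
    and p: "((\<lambda>y. f' y u) has_derivative p') (at z)"
    and g: "((\<lambda>y. f' y v) has_derivative g') (at z)"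
  shows "p' v = g' u"
proof -
  define Q where "Q t = (f (z + t *\<^sub>R u + t *\<^sub>R v) - f (z + t *\<^sub>R u) - f (z + t *\<^sub>R v) + f z) / t^2" for t :: real
  \<comment> \<open>The quotient is symmetric in \<open>u\<close> and \<open>v\<close>, so its limit
    is proved for arbitrary directions and used twice with their roles exchanged.\<close>
  have *: "((\<lambda>t. (f (z + t *\<^sub>R u + t *\<^sub>R v) - f (z + t *\<^sub>R u) - f (z + t *\<^sub>R v) + f z) / t^2) \<longlongrightarrow> p' v) (at_right 0)"
    if p: "((\<lambda>y. f' y u) has_derivative p') (at z)" for p' u v
  proof (rule tendstoI)
    fix \<epsilon> :: real assume "\<epsilon> > 0"
    interpret p': bounded_linear p' using p by (rule has_derivative_bounded_linear)
    \<comment> \<open>\<open>M * t\<close> bounds all displacements that occur, and the final 1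
      keeps \<open>M\<close> positive. With the tolerance \<open>\<epsilon> / (4 * M)\<close> each
      of the two expansions below costs \<open>\<epsilon> / 4 * t\<close>.\<close>
    define M where "M = 2 * norm u + norm v + 1"
    have "M > 0" by (simp add: M_def add_nonneg_pos)
    obtain d1 where d1: "0 < d1" "\<And>y. norm (y - z) < d1 \<Longrightarrow> y \<in> D"
      using assms(1,2) unfolding open_dist dist_norm by blast
    obtain d2 where d2: "0 < d2" "\<And>w. norm (w - z) < d2 \<Longrightarrow>
        \<bar>f' w u - f' z u - p' (w - z)\<bar> \<le> (\<epsilon> / (4 * M)) * norm (w - z)"
      by (rule has_derivative_bound[OF p, of "\<epsilon> / (4 * M)"]) (use \<open>\<epsilon> > 0\<close> \<open>M > 0\<close> in auto)
    define d where "d = min d1 d2 / M"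
    have "d > 0" using d1 d2 \<open>M > 0\<close> by (simp add: d_def)
    have "\<forall>\<^sub>F t in at_right 0. 0 < t \<and> t < d"
      using \<open>d > 0\<close> by (auto simp: eventually_at_right_field)
    then show "\<forall>\<^sub>F t in at_right 0. dist ((f (z + t *\<^sub>R u + t *\<^sub>R v) - f (z + t *\<^sub>R u) - f (z + t *\<^sub>R v) + f z) / t^2) (p' v) < \<epsilon>"
    proof eventually_elim
      case (elim t)
      have small: "norm (s *\<^sub>R u + r *\<^sub>R v) \<le> M * t" "M * t < d1" "M * t < d2"
        if "0 \<le> s" "s \<le> t" "0 \<le> r" "r \<le> t" for s r
      proof -
        have "norm (s *\<^sub>R u + r *\<^sub>R v) \<le> s * norm u + r * norm v"
          using norm_triangle_ineq[of "s *\<^sub>R u" "r *\<^sub>R v"] that by simp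
        also have "\<dots> \<le> t * norm u + t * norm v" using that by (intro add_mono mult_right_mono) auto
        also have "\<dots> \<le> M * t" using elim by (auto simp: M_def algebra_simps)
        finally show "norm (s *\<^sub>R u + r *\<^sub>R v) \<le> M * t" .
        have "M * t < min d1 d2" using elim \<open>M > 0\<close> by (simp add: d_def field_simps)
        then show "M * t < d1" "M * t < d2" by auto
      qed
      \<comment> \<open>The mean value theorem takes care of the increment in direction
        \<open>u\<close>. The remaining increment of \<open>f' _ u\<close> in direction
        \<open>v\<close> comes from subtracting two first-order expansions at \<open>z\<close>, so
        no second derivative away from \<open>z\<close> enters.\<close>
      define F where "F s = f ((z + t *\<^sub>R v) + s *\<^sub>R u) - f (z + s *\<^sub>R u)" for s
      have "\<exists>s. 0 < s \<and> s < t \<and> F t - F 0 = (t - 0) * (f' ((z + t *\<^sub>R v) + s *\<^sub>R u) u - f' (z + s *\<^sub>R u) u)"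
      proof (rule MVT2)
        fix s assume s: "0 \<le> s" "s \<le> t"
        have "norm (s *\<^sub>R u + t *\<^sub>R v) < d1" "norm (s *\<^sub>R u + 0 *\<^sub>R v) < d1"
          using small[of s t] small[of s 0] s elim by linarith+
        then have D: "z + t *\<^sub>R v + s *\<^sub>R u \<in> D" "z + s *\<^sub>R u \<in> D"
          by (auto intro!: d1(2) simp: algebra_simps)
        show "(F has_real_derivative f' (z + t *\<^sub>R v + s *\<^sub>R u) u - f' (z + s *\<^sub>R u) u) (at s)"
          unfolding F_def by (intro DERIV_diff DERIV_along f D)
      qed (use elim in auto)
      then obtain s where s: "0 < s" "s < t" and Fs: "F t - F 0 = t * (f' (z + t *\<^sub>R v + s *\<^sub>R u) u - f' (z + s *\<^sub>R u) u)"
        by auto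
      have "\<bar>f' (z + t *\<^sub>R v + s *\<^sub>R u) u - f' z u - p' (t *\<^sub>R v + s *\<^sub>R u)\<bar> \<le> (\<epsilon> / (4 * M)) * norm (t *\<^sub>R v + s *\<^sub>R u)"
        using d2(2)[of "z + t *\<^sub>R v + s *\<^sub>R u"] small[of s t] s by (simp add: algebra_simps)
      also have "\<dots> \<le> (\<epsilon> / (4 * M)) * (M * t)"
        using small(1)[of s t] s \<open>\<epsilon> > 0\<close> \<open>M > 0\<close> by (intro mult_left_mono) (auto simp: algebra_simps)
      finally have 1: "\<bar>f' (z + t *\<^sub>R v + s *\<^sub>R u) u - f' z u - p' (t *\<^sub>R v + s *\<^sub>R u)\<bar> \<le> \<epsilon> / 4 * t"
        using \<open>M > 0\<close> by simp
      have "\<bar>f' (z + s *\<^sub>R u) u - f' z u - p' (s *\<^sub>R u)\<bar> \<le> (\<epsilon> / (4 * M)) * norm (s *\<^sub>R u)"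
        using d2(2)[of "z + s *\<^sub>R u"] small[of s 0] s by (simp add: algebra_simps)
      also have "\<dots> \<le> (\<epsilon> / (4 * M)) * (M * t)"
        using small(1)[of s 0] s \<open>\<epsilon> > 0\<close> \<open>M > 0\<close> by (intro mult_left_mono) (auto simp: algebra_simps)
      finally have 2: "\<bar>f' (z + s *\<^sub>R u) u - f' z u - p' (s *\<^sub>R u)\<bar> \<le> \<epsilon> / 4 * t"
        using \<open>M > 0\<close> by simp
      have "\<bar>f' (z + t *\<^sub>R v + s *\<^sub>R u) u - f' (z + s *\<^sub>R u) u - t * p' v\<bar> \<le> \<epsilon> / 2 * t"
        using 1 2 unfolding p'.add p'.scaleR real_scaleR_def by linarith
      have "\<bar>(F t - F 0) / t^2 - p' v\<bar> \<le> \<epsilon> / 2"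
      proof -
        have "t * \<Delta> / t\<^sup>2 - p' v = (\<Delta> - t * p' v) / t" for \<Delta>
          using elim by (simp add: field_simps power2_eq_square)
        then show ?thesis
          unfolding Fs using elim
            \<open>\<bar>f' (z + t *\<^sub>R v + s *\<^sub>R u) u - f' (z + s *\<^sub>R u) u - t * p' v\<bar> \<le> \<epsilon> / 2 * t\<close>
          by (simp add: pos_divide_le_eq)
      qed
      moreover have "F t - F 0 = f (z + t *\<^sub>R u + t *\<^sub>R v) - f (z + t *\<^sub>R u) - f (z + t *\<^sub>R v) + f z"
        by (simp add: F_def algebra_simps)
      ultimately show ?case using \<open>\<epsilon> > 0\<close> by (simp add: dist_real_def)
    qed
  qed
  have 1: "(Q \<longlongrightarrow> p' v) (at_right 0)" unfolding Q_def using *[OF p] .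
  have 2: "(Q \<longlongrightarrow> g' u) (at_right 0)"
    unfolding Q_def using *[OF g, of u] by (simp add: algebra_simps)
  show ?thesis using tendsto_unique[OF _ 1 2] by simp
qed

lemma eventually_at_right_0_less: "0 < d \<Longrightarrow> \<forall>\<^sub>F e in at_right 0. 0 < e \<and> e < (d::real)"
  by (auto simp: eventually_at_right_field)

section \<open>Minimality against hat-shaped perturbations\<close>

text \<open>The base point \<open>x\<close> moves in direction \<open>u\<close> and the velocity in direction \<open>v\<close>, both inside the
  same phase space, so that \<open>u\<close> and \<open>v\<close> carry the same vector \<open>\<eta>\<close> up to the orientation of time.\<close>

definition hat_minimal :: "('z::real_normed_vector \<Rightarrow> real) \<Rightarrow> (real \<Rightarrow> 'z) \<Rightarrow> real \<Rightarrow> 'z \<Rightarrow> 'z \<Rightarrow> bool" where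
  "hat_minimal L c e0 u v \<longleftrightarrow> (\<forall>s e m. \<bar>s\<bar> \<le> 1 \<and> 0 < m \<and> m \<le> e / 2 \<and> e \<le> e0 \<longrightarrow>
     0 \<le> integral {0..m} (\<lambda>t. L (c t + (s * t) *\<^sub>R u + s *\<^sub>R v) - L (c t))
        + integral {m..e} (\<lambda>t. L (c t + (s * (m / (e - m) * (e - t))) *\<^sub>R u - (s * (m / (e - m))) *\<^sub>R v) - L (c t)))"

text \<open>Time is among the coordinates of the phase space, and \<open>D\<close> is closed under
  translation along \<open>u\<close> and \<open>v\<close> because positions and velocities are
  unrestricted. Only the values of the curve on \<open>{0..e0}\<close> enter, so its start may come
  from an endpoint or an angular point and time may run in either direction.\<close>

locale hat_minimal_curve =
  fixes L :: "'z::real_normed_vector \<Rightarrow> real" and L' :: "'z \<Rightarrow> 'z \<Rightarrow>\<^sub>L real"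
    and D :: "'z set" and c :: "real \<Rightarrow> 'z" and e0 :: real and u v :: 'z
  assumes open_D: "open D"
    and D_add: "\<And>z r s. z \<in> D \<Longrightarrow> z + r *\<^sub>R u + s *\<^sub>R v \<in> D"
    and L: "\<And>z. z \<in> D \<Longrightarrow> (L has_derivative L' z) (at z)"
    and L': "continuous_on D L'"
    and e0: "0 < e0"
    and c: "continuous_on {0..e0} c" and c_D: "\<And>t. 0 \<le> t \<Longrightarrow> t \<le> e0 \<Longrightarrow> c t \<in> D"
    and hat: "hat_minimal L c e0 u v"
begin

lemma D_add1: "z \<in> D \<Longrightarrow> z + r *\<^sub>R u \<in> D" "z \<in> D \<Longrightarrow> z + s *\<^sub>R v \<in> D" "z \<in> D \<Longrightarrow> z - s *\<^sub>R v \<in> D"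
  "z \<in> D \<Longrightarrow> z + v \<in> D" "z \<in> D \<Longrightarrow> z + r *\<^sub>R u - s *\<^sub>R v \<in> D" "z \<in> D \<Longrightarrow> z - s *\<^sub>R v + r *\<^sub>R u \<in> D"
  "z \<in> D \<Longrightarrow> z + r *\<^sub>R u + v \<in> D"
  using D_add[of z r 0] D_add[of z 0 s] D_add[of z 0 "-s"] D_add[of z 0 1] D_add[of z r "-s"] D_add[of z r 1]
  by (auto simp: algebra_simps)

lemma continuous_L: "continuous_on D L"
  using L by (meson continuous_at_imp_continuous_on has_derivative_continuous)

text \<open>The tests already come with all factors between -1 and 1, so lower hats inherit the
  structure. This gives \<open>weierstrass\<close> for small multiples of \<open>v\<close>, from
  which the Legendre condition follows.\<close>

lemma scaled: "\<bar>s\<bar> \<le> 1 \<Longrightarrow> hat_minimal_curve L L' D c e0 (s *\<^sub>R u) (s *\<^sub>R v)"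
proof unfold_locales
  assume s: "\<bar>s\<bar> \<le> 1"
  show "hat_minimal L c e0 (s *\<^sub>R u) (s *\<^sub>R v)"
    unfolding hat_minimal_def
  proof (intro allI impI, elim conjE)
    fix s' e m :: real assume *: "\<bar>s'\<bar> \<le> 1" "0 < m" "m \<le> e / 2" "e \<le> e0"
    have "\<bar>s' * s\<bar> \<le> 1" using s *(1) by (simp add: abs_mult mult_le_one)
    with hat * show "0 \<le> integral {0..m} (\<lambda>t. L (c t + (s' * t) *\<^sub>R s *\<^sub>R u + s' *\<^sub>R s *\<^sub>R v) - L (c t))
        + integral {m..e} (\<lambda>t. L (c t + (s' * (m / (e - m) * (e - t))) *\<^sub>R s *\<^sub>R u - (s' * (m / (e - m))) *\<^sub>R s *\<^sub>R v) - L (c t))"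
      unfolding hat_minimal_def by (drule_tac x="s' * s" in spec) (simp add: mult_ac)
  qed
qed (use open_D D_add L L' e0 c c_D in auto)

lemma L_near:
  assumes "0 < \<rho>"
  obtains d where "0 < d" "\<And>t r. 0 \<le> t \<Longrightarrow> t < d \<Longrightarrow> t \<le> e0 \<Longrightarrow> \<bar>r\<bar> < d \<Longrightarrow>
    \<bar>L (c t + r *\<^sub>R u + s *\<^sub>R v) - L (c 0 + s *\<^sub>R v)\<bar> < \<rho>"
proof -
  have "continuous_on ({0..e0} \<times> UNIV) (\<lambda>x. L (c (fst x) + snd x *\<^sub>R u + s *\<^sub>R v))"
    by (rule continuous_on_compose2[OF continuous_L], intro continuous_intros continuous_on_compose2[OF c])
      (auto intro!: D_add c_D)
  moreover have "(0, 0) \<in> {0..e0} \<times> (UNIV :: real set)" using e0 by simp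
  ultimately have "\<exists>d>0. \<forall>x\<in>{0..e0} \<times> UNIV. dist x (0,0) < d \<longrightarrow>
      dist (L (c (fst x) + snd x *\<^sub>R u + s *\<^sub>R v)) (L (c (fst (0::real,0::real)) + snd (0::real,0::real) *\<^sub>R u + s *\<^sub>R v)) < \<rho>"
    unfolding continuous_on_iff using \<open>0 < \<rho>\<close> by blast
  then obtain d where d: "0 < d" "\<And>x. x \<in> {0..e0} \<times> UNIV \<Longrightarrow> dist x (0,0) < d \<Longrightarrow>
      dist (L (c (fst x) + snd x *\<^sub>R u + s *\<^sub>R v)) (L (c 0 + 0 *\<^sub>R u + s *\<^sub>R v)) < \<rho>"
    unfolding fst_conv snd_conv by blast
  show ?thesis
  proof (rule that[of "d/2"])
    fix t r assume tr: "0 \<le> t" "t < d/2" "t \<le> e0" "\<bar>r\<bar> < d/2"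
    have "dist (t, r) (0, 0) \<le> \<bar>t\<bar> + \<bar>r\<bar>"
      using sqrt_sum_squares_le_sum_abs[of t r] by (simp add: dist_prod_def dist_real_def)
    with d(2)[of "(t,r)"] tr
    show "\<bar>L (c t + r *\<^sub>R u + s *\<^sub>R v) - L (c 0 + s *\<^sub>R v)\<bar> < \<rho>"
      by (simp add: dist_real_def)
  qed (use d in auto)
qed

lemma continuous_along:
  assumes "continuous_on S r" "continuous_on S s" "S \<subseteq> {0..e0}"
  shows "continuous_on S (\<lambda>t. L (c t + r t *\<^sub>R u + s t *\<^sub>R v))"
    and "continuous_on S (\<lambda>t. L (c t + r t *\<^sub>R u - s t *\<^sub>R v))"
    and "continuous_on S (\<lambda>t. L (c t))"
    and "continuous_on S (\<lambda>t. L' (c t) w)"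
proof -
  have cS: "continuous_on S c" using c assms(3) by (rule continuous_on_subset)
  have cD: "c t \<in> D" if "t \<in> S" for t using that assms(3) c_D[of t] by auto
  show "continuous_on S (\<lambda>t. L (c t + r t *\<^sub>R u + s t *\<^sub>R v))"
    by (rule continuous_on_compose2[OF continuous_L], intro continuous_intros assms cS) (auto intro: D_add cD)
  show "continuous_on S (\<lambda>t. L (c t + r t *\<^sub>R u - s t *\<^sub>R v))"
    by (rule continuous_on_compose2[OF continuous_L], intro continuous_intros assms cS) (auto intro: D_add1 cD)
  show "continuous_on S (\<lambda>t. L (c t))"
    by (rule continuous_on_compose2[OF continuous_L cS]) (auto intro: cD)
  have "continuous_on S (\<lambda>t. L' (c t))"
    using assms(3) by (intro continuous_on_compose2[OF L'] cS) (auto intro!: c_D)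
  then show "continuous_on S (\<lambda>t. L' (c t) w)" by (intro continuous_intros)
qed

section \<open>Weierstrass condition, first variation and Legendre condition\<close>

text \<open>Keep the ratio \<mu> of the slopes fixed and let e tend to 0: the heights vanish, the
  mean values over the two stretches tend to increments of \<open>L\<close> at \<open>c 0\<close>,
  and the lengths of the stretches are in the ratio \<mu> : 1.\<close>

lemma weierstrass_two_slopes:
  assumes "0 < \<mu>" "\<mu> \<le> 1"
  shows "0 \<le> \<mu> * (L (c 0 + v) - L (c 0)) + (L (c 0 - \<mu> *\<^sub>R v) - L (c 0))"
proof (rule field_le_epsilon)
  fix \<rho> :: real assume "0 < \<rho>"
  then have "0 < \<rho> / 4" by simp
  obtain d1 where d1: "0 < d1" "\<And>t r. 0 \<le> t \<Longrightarrow> t < d1 \<Longrightarrow> t \<le> e0 \<Longrightarrow> \<bar>r\<bar> < d1 \<Longrightarrow>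
    \<bar>L (c t + r *\<^sub>R u + 1 *\<^sub>R v) - L (c 0 + 1 *\<^sub>R v)\<bar> < \<rho> / 4"
    using L_near[OF \<open>0 < \<rho> / 4\<close>] by metis
  obtain d2 where d2: "0 < d2" "\<And>t r. 0 \<le> t \<Longrightarrow> t < d2 \<Longrightarrow> t \<le> e0 \<Longrightarrow> \<bar>r\<bar> < d2 \<Longrightarrow>
    \<bar>L (c t + r *\<^sub>R u + (- \<mu>) *\<^sub>R v) - L (c 0 + (-\<mu>) *\<^sub>R v)\<bar> < \<rho> / 4"
    using L_near[OF \<open>0 < \<rho> / 4\<close>] by metis
  obtain d3 where d3: "0 < d3" "\<And>t r. 0 \<le> t \<Longrightarrow> t < d3 \<Longrightarrow> t \<le> e0 \<Longrightarrow> \<bar>r\<bar> < d3 \<Longrightarrow>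
    \<bar>L (c t + r *\<^sub>R u + 0 *\<^sub>R v) - L (c 0 + 0 *\<^sub>R v)\<bar> < \<rho> / 4"
    using L_near[OF \<open>0 < \<rho> / 4\<close>] by metis
  \<comment> \<open>Each stretch uses two of these estimates and loses \<open>\<rho> / 2\<close>;
    the final error \<open>\<mu> * (\<rho> / 2) + \<rho> / 2\<close> is at most \<rho> because \<mu>
    \<le> 1.\<close>
  define e where "e = min e0 (min d1 (min d2 d3) / 2)"
  have e: "0 < e" "e \<le> e0" "e < d1" "e < d2" "e < d3" using e0 d1 d2 d3 by (auto simp: e_def)
  \<comment> \<open>The solution of m / (e - m) = \<mu>.\<close>
  define m where "m = \<mu> / (1 + \<mu>) * e"
  have m: "0 < m" "m \<le> e / 2" using assms e by (auto simp: m_def field_simps)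
  have em: "e - m = e / (1 + \<mu>)" using assms by (simp add: m_def field_simps)
  have mu: "m / (e - m) = \<mu>" unfolding em using e assms by (simp add: m_def)
  let ?a = "L (c 0 + v) - L (c 0)" and ?b = "L (c 0 - \<mu> *\<^sub>R v) - L (c 0)"
  have "integral {0..m} (\<lambda>t. L (c t + t *\<^sub>R u + v) - L (c t)) \<le> integral {0..m} (\<lambda>t. ?a + \<rho> / 2)"
  proof (rule integral_le)
    show "(\<lambda>t. L (c t + t *\<^sub>R u + v) - L (c t)) integrable_on {0..m}"
      using continuous_along(1)[of "{0..m}" "\<lambda>t. t" "\<lambda>t. 1"] continuous_along(3)[of "{0..m}" "\<lambda>t. t" "\<lambda>t. 1"] m e
      by (intro integrable_continuous_real continuous_intros) auto
    fix t assume "t \<in> {0..m}"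
    then show "L (c t + t *\<^sub>R u + v) - L (c t) \<le> ?a + \<rho> / 2"
      using d1(2)[of t t] d3(2)[of t 0] m e by (auto simp: abs_real_def split: if_splits)
  qed auto
  also have "\<dots> = m * (?a + \<rho> / 2)" using m by simp
  finally have 1: "integral {0..m} (\<lambda>t. L (c t + t *\<^sub>R u + v) - L (c t)) \<le> m * (?a + \<rho> / 2)" .
  have "integral {m..e} (\<lambda>t. L (c t + (\<mu> * (e - t)) *\<^sub>R u - \<mu> *\<^sub>R v) - L (c t)) \<le> integral {m..e} (\<lambda>t. ?b + \<rho> / 2)"
  proof (rule integral_le)
    show "(\<lambda>t. L (c t + (\<mu> * (e - t)) *\<^sub>R u - \<mu> *\<^sub>R v) - L (c t)) integrable_on {m..e}"
      using m e by (intro integrable_continuous_real continuous_intros continuous_along) auto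
    fix t assume t: "t \<in> {m..e}"
    have "\<mu> * (e - t) \<le> 1 * (e - t)" using t assms by (intro mult_right_mono) auto
    then have "\<bar>\<mu> * (e - t)\<bar> < d2" using t e m assms by (simp add: abs_mult)
    then show "L (c t + (\<mu> * (e - t)) *\<^sub>R u - \<mu> *\<^sub>R v) - L (c t) \<le> ?b + \<rho> / 2"
      using d2(2)[of t "\<mu> * (e - t)"] d3(2)[of t 0] m e t by (auto simp: abs_real_def split: if_splits)
  qed auto
  also have "\<dots> = (e - m) * (?b + \<rho> / 2)" using m by simp
  finally have 2: "integral {m..e} (\<lambda>t. L (c t + (\<mu> * (e - t)) *\<^sub>R u - \<mu> *\<^sub>R v) - L (c t)) \<le> (e - m) * (?b + \<rho> / 2)" .
  have "0 \<le> integral {0..m} (\<lambda>t. L (c t + t *\<^sub>R u + v) - L (c t))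
     + integral {m..e} (\<lambda>t. L (c t + (\<mu> * (e - t)) *\<^sub>R u - \<mu> *\<^sub>R v) - L (c t))"
    using hat[unfolded hat_minimal_def, rule_format, of 1 m e] m e mu by simp
  with 1 2 have "0 \<le> m * (?a + \<rho> / 2) + (e - m) * (?b + \<rho> / 2)" by linarith
  also have "\<dots> = e / (1 + \<mu>) * (\<mu> * (?a + \<rho> / 2) + (?b + \<rho> / 2))"
    unfolding em by (simp add: m_def distrib_left mult_ac)
  finally have "0 \<le> \<mu> * (?a + \<rho> / 2) + (?b + \<rho> / 2)"
    using e assms by (subst (asm) zero_le_mult_iff) (auto simp: divide_le_0_iff)
  moreover have "\<mu> * (\<rho> / 2) \<le> \<rho> / 2" using assms \<open>0 < \<rho>\<close> by simp
  ultimately show "0 \<le> \<mu> * ?a + ?b + \<rho>" by (simp add: algebra_simps)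
qed

text \<open>Divide the two-slope inequality by \<mu> and let \<mu> tend to 0: the second term
  becomes the derivative of \<open>L\<close> in direction \<open>-v\<close>.\<close>

lemma weierstrass: "0 \<le> L (c 0 + v) - L (c 0) - L' (c 0) v"
proof -
  have z0: "c 0 \<in> D" using c_D e0 by auto
  have "((\<lambda>s. L (c 0 + s *\<^sub>R (-v))) has_real_derivative L' (c 0) (-v)) (at 0)"
    using L[OF z0] by (intro DERIV_along) simp
  then have "((\<lambda>h. (L (c 0 + (0 + h) *\<^sub>R (-v)) - L (c 0 + 0 *\<^sub>R (-v))) / h) \<longlongrightarrow> L' (c 0) (-v)) (at 0)"
    unfolding DERIV_def .
  then have "((\<lambda>h. (L (c 0 - h *\<^sub>R v) - L (c 0)) / h) \<longlongrightarrow> - L' (c 0) v) (at 0)"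
    by (simp add: blinfun.minus_right)
  then have lim: "((\<lambda>h. (L (c 0 - h *\<^sub>R v) - L (c 0)) / h) \<longlongrightarrow> - L' (c 0) v) (at_right 0)"
    by (rule filterlim_mono) (auto simp: at_le)
  have "0 \<le> (L (c 0 + v) - L (c 0)) + (- L' (c 0) v)"
  proof (rule tendsto_lowerbound[OF tendsto_add[OF tendsto_const lim]])
    have "\<forall>\<^sub>F h in at_right 0. 0 < h \<and> h \<le> (1::real)"
      using eventually_at_right_field less_imp_le zero_less_one by blast
    then show "\<forall>\<^sub>F h in at_right 0. 0 \<le> L (c 0 + v) - L (c 0) + (L (c 0 - h *\<^sub>R v) - L (c 0)) / h"
      by eventually_elim (use weierstrass_two_slopes in \<open>auto simp: field_simps\<close>)
  qed auto
  then show ?thesis by simp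
qed

lemma hat_inequality:
  assumes "0 < m" "m \<le> e / 2" "e \<le> e0" and \<mu>: "\<mu> = m / (e - m)" and "\<bar>s\<bar> \<le> 1"
  shows "0 \<le> integral {0..m} (\<lambda>t. L (c t + (s * t) *\<^sub>R u + s *\<^sub>R v) - L (c t))
        + integral {m..e} (\<lambda>t. L (c t + (s * (\<mu> * (e - t))) *\<^sub>R u - (s * \<mu>) *\<^sub>R v) - L (c t))"
  using hat[unfolded hat_minimal_def] assms by blast

lemma has_derivative_variation:
  assumes r: "continuous_on {a..b} r" and s: "continuous_on {a..b} s" and "{a..b} \<subseteq> {0..e0}"
  shows "((\<lambda>y. integral {a..b} (\<lambda>t. L (c t + (y * r t) *\<^sub>R u + (y * s t) *\<^sub>R v) - L (c t)))
     has_real_derivative integral {a..b} (\<lambda>t. L' (c t) (r t *\<^sub>R u + s t *\<^sub>R v))) (at 0)"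
proof -
  let ?z = "\<lambda>y t. c t + (y * r t) *\<^sub>R u + (y * s t) *\<^sub>R v"
  have cS: "continuous_on {a..b} c" using c assms(3) by (rule continuous_on_subset)
  have cD: "c t \<in> D" if "t \<in> {a..b}" for t using that assms(3) c_D[of t] by auto
  have "((\<lambda>y. integral (cbox a b) (\<lambda>t. L (?z y t) - L (c t)))
     has_real_derivative integral (cbox a b) (\<lambda>t. L' (?z 0 t) (r t *\<^sub>R u + s t *\<^sub>R v))) (at 0 within UNIV)"
  proof (rule leibniz_rule_field_derivative[where fx = "\<lambda>y t. L' (?z y t) (r t *\<^sub>R u + s t *\<^sub>R v)"])
    fix y t assume t: "t \<in> cbox a b"
    have "?z y t \<in> D" using t cD by (auto intro: D_add)
    moreover have z: "?z y t = c t + y *\<^sub>R (r t *\<^sub>R u + s t *\<^sub>R v)" for y by (simp add: algebra_simps)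
    ultimately have "(L has_derivative L' (c t + y *\<^sub>R (r t *\<^sub>R u + s t *\<^sub>R v)))
       (at (c t + y *\<^sub>R (r t *\<^sub>R u + s t *\<^sub>R v)))" using L by simp
    from DERIV_along[OF this]
    have "((\<lambda>y. L (?z y t)) has_real_derivative L' (?z y t) (r t *\<^sub>R u + s t *\<^sub>R v)) (at y)"
      unfolding z .
    then show "((\<lambda>y. L (?z y t) - L (c t)) has_real_derivative L' (?z y t) (r t *\<^sub>R u + s t *\<^sub>R v)) (at y within UNIV)"
      by (auto intro!: derivative_eq_intros)
  next
    fix y :: real
    show "(\<lambda>t. L (?z y t) - L (c t)) integrable_on cbox a b"
      using assms by (auto intro!: integrable_continuous_real continuous_intros continuous_along)
  next
    have "continuous_on (UNIV \<times> {a..b}) (\<lambda>x. L' (c (snd x) + (fst x * r (snd x)) *\<^sub>R u + (fst x * s (snd x)) *\<^sub>R v))"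
      by (rule continuous_on_compose2[OF L'], intro continuous_intros continuous_on_compose2[OF cS]
          continuous_on_compose2[OF r] continuous_on_compose2[OF s]) (auto intro!: D_add cD)
    then show "continuous_on (UNIV \<times> cbox a b) (\<lambda>(y, t). L' (?z y t) (r t *\<^sub>R u + s t *\<^sub>R v))"
      unfolding split_beta cbox_interval
      by (intro continuous_intros continuous_on_compose2[OF r] continuous_on_compose2[OF s]) auto
  qed auto
  then show ?thesis by simp
qed

text \<open>The hat inequality holds for factors \<open>s\<close> of both signs, so
  \<open>s = 0\<close> minimizes a differentiable function of \<open>s\<close>. This identity, one
  for each hat, takes the place of the Euler equation.\<close>

lemma first_variation:
  assumes "0 < m" "m \<le> e / 2" "e \<le> e0" and \<mu>: "\<mu> = m / (e - m)"
  shows "integral {0..m} (\<lambda>t. t * L' (c t) u + L' (c t) v)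
       + integral {m..e} (\<lambda>t. \<mu> * (e - t) * L' (c t) u - \<mu> * L' (c t) v) = 0" (is "?l = 0")
proof (rule DERIV_local_min)
  define \<Phi> where "\<Phi> s = integral {0..m} (\<lambda>t. L (c t + (s * t) *\<^sub>R u + (s * 1) *\<^sub>R v) - L (c t))
        + integral {m..e} (\<lambda>t. L (c t + (s * (\<mu> * (e - t))) *\<^sub>R u + (s * (-\<mu>)) *\<^sub>R v) - L (c t))" for s
  have "(\<Phi> has_real_derivative integral {0..m} (\<lambda>t. L' (c t) (t *\<^sub>R u + 1 *\<^sub>R v))
       + integral {m..e} (\<lambda>t. L' (c t) ((\<mu> * (e - t)) *\<^sub>R u + (-\<mu>) *\<^sub>R v))) (at 0)"
    unfolding \<Phi>_def using assms
    by (intro DERIV_add has_derivative_variation continuous_intros) auto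
  then show "(\<Phi> has_real_derivative ?l) (at 0)"
    by (simp add: blinfun.add_right blinfun.scaleR_right blinfun.diff_right)
  show "\<forall>s. \<bar>0 - s\<bar> < 1 \<longrightarrow> \<Phi> 0 \<le> \<Phi> s"
  proof (intro allI impI)
    fix s :: real assume "\<bar>0 - s\<bar> < 1"
    then show "\<Phi> 0 \<le> \<Phi> s"
      using hat_inequality[OF assms, of s] by (simp add: \<Phi>_def)
  qed
qed simp

text \<open>Subtracting the vanishing first variation leaves remainders of the linearisation of
  \<open>L\<close> at the moving point \<open>c t\<close>. On the first stretch the velocity step
  \<open>v\<close> is not small, so the integrand there is an excess and not a quadratic
  form.\<close>

lemma second_variation_nonneg:
  assumes "0 < m" "m \<le> e / 2" "e \<le> e0" and \<mu>: "\<mu> = m / (e - m)"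
  shows "0 \<le> integral {0..m} (\<lambda>t. L (c t + t *\<^sub>R u + v) - L (c t) - t * L' (c t) u - L' (c t) v)
    + integral {m..e} (\<lambda>t. L (c t + (\<mu> * (e - t)) *\<^sub>R u - \<mu> *\<^sub>R v) - L (c t)
        - \<mu> * (e - t) * L' (c t) u + \<mu> * L' (c t) v)"
proof -
  have em: "{0..m} \<subseteq> {0..e0}" "{m..e} \<subseteq> {0..e0}" using assms by auto
  have int: "(\<lambda>t. L (c t + t *\<^sub>R u + v) - L (c t)) integrable_on {0..m}"
    "(\<lambda>t. t * L' (c t) u + L' (c t) v) integrable_on {0..m}"
    "(\<lambda>t. L (c t + (\<mu> * (e - t)) *\<^sub>R u - \<mu> *\<^sub>R v) - L (c t)) integrable_on {m..e}"
    "(\<lambda>t. \<mu> * (e - t) * L' (c t) u - \<mu> * L' (c t) v) integrable_on {m..e}"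
  proof -
    have 1: "continuous_on S (\<lambda>t. L' (c t) w)" if "S \<subseteq> {0..e0}" for S w
      by (rule continuous_along(4)[OF continuous_on_const continuous_on_const that])
    have 2: "continuous_on {0..m} (\<lambda>t. L (c t + t *\<^sub>R u + v))"
      using continuous_along(1)[of "{0..m}" "\<lambda>t. t" "\<lambda>t. 1"] em by simp
    have 3: "continuous_on {m..e} (\<lambda>t. L (c t + (\<mu> * (e - t)) *\<^sub>R u - \<mu> *\<^sub>R v))"
      using em by (intro continuous_along continuous_intros)
    have 4: "continuous_on S (\<lambda>t. L (c t))" if "S \<subseteq> {0..e0}" for S
      by (rule continuous_along(3)[OF continuous_on_const continuous_on_const that])
    note * = integrable_continuous_real continuous_on_add continuous_on_diff continuous_on_mult
        continuous_on_const continuous_on_id 1 2 3 4 em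
    show "(\<lambda>t. L (c t + t *\<^sub>R u + v) - L (c t)) integrable_on {0..m}"
      "(\<lambda>t. t * L' (c t) u + L' (c t) v) integrable_on {0..m}"
      "(\<lambda>t. L (c t + (\<mu> * (e - t)) *\<^sub>R u - \<mu> *\<^sub>R v) - L (c t)) integrable_on {m..e}"
      "(\<lambda>t. \<mu> * (e - t) * L' (c t) u - \<mu> * L' (c t) v) integrable_on {m..e}"
      by (intro *)+
  qed
  have "0 \<le> integral {0..m} (\<lambda>t. L (c t + t *\<^sub>R u + v) - L (c t))
        + integral {m..e} (\<lambda>t. L (c t + (\<mu> * (e - t)) *\<^sub>R u - \<mu> *\<^sub>R v) - L (c t))"
    using hat_inequality[OF assms, of 1] by simp
  also have "\<dots> = (integral {0..m} (\<lambda>t. L (c t + t *\<^sub>R u + v) - L (c t)) - integral {0..m} (\<lambda>t. t * L' (c t) u + L' (c t) v))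
     + (integral {m..e} (\<lambda>t. L (c t + (\<mu> * (e - t)) *\<^sub>R u - \<mu> *\<^sub>R v) - L (c t))
      - integral {m..e} (\<lambda>t. \<mu> * (e - t) * L' (c t) u - \<mu> * L' (c t) v))"
    using first_variation[OF assms] by linarith
  also have "\<dots> = integral {0..m} (\<lambda>t. (L (c t + t *\<^sub>R u + v) - L (c t)) - (t * L' (c t) u + L' (c t) v))
     + integral {m..e} (\<lambda>t. (L (c t + (\<mu> * (e - t)) *\<^sub>R u - \<mu> *\<^sub>R v) - L (c t))
      - (\<mu> * (e - t) * L' (c t) u - \<mu> * L' (c t) v))"
    by (subst (1 2) integral_diff[symmetric]) (use int in auto)
  finally show ?thesis by (simp add: algebra_simps)
qed

text \<open>\<open>weierstrass\<close> for the directions h v, combined with the Lagrange remainder,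
  yields points arbitrarily close to \<open>c 0\<close> at which the form is nonnegative.\<close>

lemma legendre:
  assumes g: "\<And>z. z \<in> D \<Longrightarrow> ((\<lambda>z. L' z v) has_derivative g' z) (at z)"
    and q: "continuous (at (c 0)) (\<lambda>z. g' z v)"
  shows "0 \<le> g' (c 0) v"
proof -
  have z0: "c 0 \<in> D" using c_D e0 by auto
  have *: "\<exists>s. 0 < s \<and> s < h \<and> 0 \<le> g' (c 0 + s *\<^sub>R v) v" if h: "0 < h" "h \<le> 1" for h
  proof -
    interpret h: hat_minimal_curve L L' D c e0 "h *\<^sub>R u" "h *\<^sub>R v" by (rule scaled) (use h in auto)
    obtain s where s: "0 < s" "s < h" "L (c 0 + h *\<^sub>R v) - L (c 0) - h * L' (c 0) v = h^2 / 2 * g' (c 0 + s *\<^sub>R v) v"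
      by (rule second_order_taylor_along[of h L "c 0" v "\<lambda>z. L' z v" "\<lambda>z. g' z v"])
        (use h in \<open>auto intro: DERIV_along[OF L[OF D_add1(2)[OF z0]]] DERIV_along[OF g[OF D_add1(2)[OF z0]]]\<close>)
    moreover have "0 \<le> h^2 / 2 * g' (c 0 + s *\<^sub>R v) v"
      using h.weierstrass s(3) by (simp add: blinfun.scaleR_right)
    ultimately show ?thesis using \<open>0 < h\<close> by (auto simp: zero_le_mult_iff)
  qed
  show ?thesis
  proof (rule ccontr)
    assume neg: "\<not> ?thesis"
    have "((\<lambda>s. c 0 + s *\<^sub>R v) \<longlongrightarrow> c 0 + 0 *\<^sub>R v) (at_right 0)" by (intro tendsto_intros)
    then have "((\<lambda>s. c 0 + s *\<^sub>R v) \<longlongrightarrow> c 0) (at_right 0)" by simp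
    from isCont_tendsto_compose[OF q this]
    have "((\<lambda>s. g' (c 0 + s *\<^sub>R v) v) \<longlongrightarrow> g' (c 0) v) (at_right 0)" .
    then have "\<forall>\<^sub>F s in at_right 0. g' (c 0 + s *\<^sub>R v) v < 0"
      by (rule order_tendstoD) (use neg in auto)
    then obtain h where h: "0 < h" "\<And>s. 0 < s \<Longrightarrow> s < h \<Longrightarrow> g' (c 0 + s *\<^sub>R v) v < 0"
      unfolding eventually_at_right_field by auto
    then show False using *[of "min h 1"] by force
  qed
qed

section \<open>Estimates on the two slopes and the condition in a degenerate direction\<close>

text \<open>The velocity is changed first, at fixed position (a second order Taylor expansion, controlled
  by \<open>q\<close>), and then the position (controlled by \<open>p\<close>). Since \<open>p\<close> and \<open>q\<close> are only
  differentiable at \<open>c 0\<close>, their errors are \<open>o(e)\<close>, here taken as \<open>\<kappa>\<^sup>2 e\<close>; it matters that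
  \<open>K\<close> does not depend on \<open>\<kappa>\<close>.\<close>

lemma second_slope_bound:
  assumes p: "((\<lambda>z. L' z u) has_derivative p') (at (c 0))"
    and g: "\<And>z. z \<in> D \<Longrightarrow> ((\<lambda>z. L' z v) has_derivative g' z) (at z)"
    and q: "((\<lambda>z. g' z v) has_derivative q') (at (c 0))"
    and c': "(c has_vector_derivative c') (at 0 within {0..e0})"
    and q0: "g' (c 0) v = 0"
  obtains K where "0 \<le> K"
    "\<And>\<kappa>. 0 < \<kappa> \<Longrightarrow> \<kappa> \<le> 1 \<Longrightarrow> \<forall>\<^sub>F e in at_right 0. \<forall>t \<mu> r. 0 \<le> t \<and> t \<le> e \<and> 0 < \<mu> \<and> \<mu> \<le> 2 * \<kappa> * e \<and> 0 \<le> r \<and> r \<le> \<mu> * e \<longrightarrow>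
       L (c t + r *\<^sub>R u - \<mu> *\<^sub>R v) - L (c t) - r * L' (c t) u + \<mu> * L' (c t) v
       \<le> \<mu>\<^sup>2 / 2 * (t * q' c' + K * \<kappa> * e) + r * (- \<mu> * p' v + K * \<kappa> * e\<^sup>2 + K * \<kappa>\<^sup>2 * e)"
proof -
  interpret p': bounded_linear p' using p by (rule has_derivative_bounded_linear)
  interpret q': bounded_linear q' using q by (rule has_derivative_bounded_linear)
  obtain Bp where Bp: "0 < Bp" "\<And>x. \<bar>p' x\<bar> \<le> norm x * Bp" using p'.pos_bounded by auto
  obtain Bq where Bq: "0 < Bq" "\<And>x. \<bar>q' x\<bar> \<le> norm x * Bq" using q'.pos_bounded by auto
  \<comment> \<open>\<open>M * e\<close> bounds the distance from \<open>c 0\<close> of every point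
    used below: the curve moves by at most \<open>(norm c' + 1) * e\<close>, and the velocity and
    position steps are at most \<mu> \<le> 2 e and r \<le> \<mu>.\<close>
  define M where "M = norm c' + 1 + 2 * norm v + 2 * norm u"
  have M: "1 \<le> M" by (simp add: M_def)
  \<comment> \<open>\<open>K1\<close> collects the errors of the second-order term: its remainder,
    the deviation of \<open>c\<close> from its tangent, and the velocity step. The summands added in
    \<open>K\<close> come from \<open>r' * p' u\<close> and from the two remainders of
    \<open>\<lambda>z. L' z u\<close>.\<close>
  define K1 where "K1 = M + Bq + 2 * norm v * Bq"
  define K where "K = K1 + 2 * norm u * Bp + 2 * M"
  have K1: "0 \<le> K1" using M Bq by (simp add: K1_def)
  have K: "K1 \<le> K" "2 * norm u * Bp \<le> K" "2 * M \<le> K" using K1 M Bp by (auto simp: K_def)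
  show ?thesis
  proof
    show "0 \<le> K" using K K1 by linarith
    fix \<kappa> :: real assume \<kappa>: "0 < \<kappa>" "\<kappa> \<le> 1"
    then have "0 < \<kappa>\<^sup>2" by simp
    have k2: "\<kappa>\<^sup>2 \<le> \<kappa>" using \<kappa> by (simp add: power2_eq_square)
    obtain d1 where d1: "0 < d1" "\<And>t. t \<in> {0..e0} \<Longrightarrow> \<bar>t\<bar> < d1 \<Longrightarrow> norm (c t - c 0 - t *\<^sub>R c') \<le> \<kappa>\<^sup>2 * \<bar>t\<bar>"
    proof -
      have "\<exists>d>0. \<forall>y\<in>{0..e0}. norm (y - 0) < d \<longrightarrow> norm (c y - c 0 - (y - 0) *\<^sub>R c') \<le> \<kappa>\<^sup>2 * norm (y - 0)"
        using c'[unfolded has_vector_derivative_def has_derivative_within_alt] \<open>0 < \<kappa>\<^sup>2\<close> by blast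
      then show ?thesis using that by auto
    qed
    obtain d2 where d2: "0 < d2" "\<And>w. norm (w - c 0) < d2 \<Longrightarrow> \<bar>g' w v - g' (c 0) v - q' (w - c 0)\<bar> \<le> \<kappa>\<^sup>2 * norm (w - c 0)"
      using has_derivative_bound[OF q \<open>0 < \<kappa>\<^sup>2\<close>] by blast
    \<comment> \<open>Here the square matters: multiplied by a height whose integral is of order m
      e, this error becomes of order \<kappa>^2 m e^2, which is \<kappa> m^2 for the later choice m
      = \<kappa> e^2.\<close>
    obtain d3 where d3: "0 < d3" "\<And>w. norm (w - c 0) < d3 \<Longrightarrow> \<bar>L' w u - L' (c 0) u - p' (w - c 0)\<bar> \<le> \<kappa>\<^sup>2 * norm (w - c 0)"
      using has_derivative_bound[OF p \<open>0 < \<kappa>\<^sup>2\<close>] by blast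
    define d where "d = min (min 1 e0) (min d1 (min (d2 / M) (d3 / M)))"
    have d: "0 < d" "d \<le> 1" "d \<le> e0" "d \<le> d1" "d \<le> d2 / M" "d \<le> d3 / M"
      using e0 d1(1) d2(1) d3(1) M by (auto simp: d_def)
    have "\<forall>\<^sub>F e in at_right 0. 0 < e \<and> e < d" using d by (intro eventually_at_right_0_less) auto
    then show "\<forall>\<^sub>F e in at_right 0. \<forall>t \<mu> r. 0 \<le> t \<and> t \<le> e \<and> 0 < \<mu> \<and> \<mu> \<le> 2 * \<kappa> * e \<and> 0 \<le> r \<and> r \<le> \<mu> * e \<longrightarrow>
       L (c t + r *\<^sub>R u - \<mu> *\<^sub>R v) - L (c t) - r * L' (c t) u + \<mu> * L' (c t) v
       \<le> \<mu>\<^sup>2 / 2 * (t * q' c' + K * \<kappa> * e) + r * (- \<mu> * p' v + K * \<kappa> * e\<^sup>2 + K * \<kappa>\<^sup>2 * e)"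
    proof (eventually_elim, intro allI impI, elim conjE)
      fix e t \<mu> r assume e: "0 < e" "e < d"
        and t: "0 \<le> t" "t \<le> e" and \<mu>: "0 < \<mu>" "\<mu> \<le> 2 * \<kappa> * e" and r: "0 \<le> r" "r \<le> \<mu> * e"
      have Me: "M * e < d2" "M * e < d3"
      proof -
        have "M * e < M * d" using e M by simp
        moreover have "M * d \<le> d2" "M * d \<le> d3" using d(5,6) M by (auto simp: pos_le_divide_eq mult.commute)
        ultimately show "M * e < d2" "M * e < d3" by linarith+
      qed
      have ct: "c t \<in> D" using t e d by (intro c_D) auto
      have "\<kappa> * e \<le> e" using \<kappa> e by (simp add: mult_left_le_one_le)
      then have \<mu>e: "\<mu> \<le> 2 * e" using \<mu> by linarith
      have "\<mu> * e \<le> \<mu> * 1" using \<mu>(1) e d by (intro mult_left_mono) auto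
      with r(2) have "r \<le> \<mu> * 1" by linarith
      then have r\<mu>: "r \<le> \<mu>" by simp
      have w1: "norm (c t - c 0 - t *\<^sub>R c') \<le> \<kappa>\<^sup>2 * t" using d1(2)[of t] t e d by auto
      have w0: "norm (c t - c 0) \<le> (norm c' + 1) * e"
      proof -
        have "norm (c t - c 0) \<le> norm (c t - c 0 - t *\<^sub>R c') + norm (t *\<^sub>R c')"
          using norm_triangle_ineq[of "c t - c 0 - t *\<^sub>R c'" "t *\<^sub>R c'"] by simp
        also have "\<dots> \<le> 1 * t + t * norm c'"
          using order.trans[OF w1 mult_right_mono[of "\<kappa>\<^sup>2" 1 t]] t k2 \<kappa> by auto
        also have "\<dots> = (norm c' + 1) * t" by (simp add: algebra_simps)
        also have "\<dots> \<le> (norm c' + 1) * e" using t by (intro mult_left_mono) auto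
        finally show ?thesis .
      qed
      have near: "norm (c t - s *\<^sub>R v + r' *\<^sub>R u - c 0) \<le> M * e" if "0 \<le> s" "s \<le> \<mu>" "0 \<le> r'" "r' \<le> r" for s r'
      proof -
        have "norm (c t - s *\<^sub>R v + r' *\<^sub>R u - c 0) \<le> norm (c t - c 0) + norm (s *\<^sub>R v) + norm (r' *\<^sub>R u)"
          using norm_triangle_ineq[of "c t - c 0 - s *\<^sub>R v" "r' *\<^sub>R u"] norm_triangle_ineq4[of "c t - c 0" "s *\<^sub>R v"]
          by (simp add: algebra_simps)
        also have "\<dots> = norm (c t - c 0) + s * norm v + r' * norm u" using that by simp
        also have "s * norm v \<le> (2 * e) * norm v" using that \<mu>e by (intro mult_right_mono) auto
        also have "r' * norm u \<le> (2 * e) * norm u" using that \<mu>e r\<mu> by (intro mult_right_mono) auto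
        finally show ?thesis using w0 by (simp add: M_def algebra_simps)
      qed
      \<comment> \<open>The form vanishes at \<open>c 0\<close>, so its first-order expansion
        decides. The motion along \<open>c\<close> contributes \<open>t * q' c'\<close>, the
        velocity step only O(\<kappa> e) because \<mu> \<le> 2 \<kappa> e.\<close>
      have q_est: "g' (c t - s *\<^sub>R v) v \<le> t * q' c' + K1 * \<kappa> * e" if s: "0 \<le> s" "s \<le> \<mu>" for s
      proof -
        let ?w = "c t - s *\<^sub>R v"
        have n: "norm (?w - c 0) \<le> M * e" using near[of s 0] s r by simp
        have "\<bar>g' ?w v - q' (?w - c 0)\<bar> \<le> \<kappa>\<^sup>2 * norm (?w - c 0)" using d2(2)[of ?w] n Me q0 by simp
        also have "\<dots> \<le> \<kappa> * (M * e)" using n k2 \<kappa> by (intro mult_mono) auto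
        finally have 1: "g' ?w v \<le> q' (?w - c 0) + \<kappa> * (M * e)" by simp
        have "?w - c 0 = (c t - c 0 - t *\<^sub>R c') + t *\<^sub>R c' - s *\<^sub>R v" by simp
        then have 2: "q' (?w - c 0) = q' (c t - c 0 - t *\<^sub>R c') + t * q' c' - s * q' v"
          by (simp only: q'.add q'.diff q'.scaleR real_scaleR_def)
        have "\<bar>q' (c t - c 0 - t *\<^sub>R c')\<bar> \<le> norm (c t - c 0 - t *\<^sub>R c') * Bq" by (rule Bq)
        also have "\<dots> \<le> (\<kappa> * e) * Bq"
          using order.trans[OF w1 mult_mono[of "\<kappa>\<^sup>2" \<kappa> t e]] k2 t \<kappa> Bq by (intro mult_right_mono) auto
        finally have 3: "q' (c t - c 0 - t *\<^sub>R c') \<le> (\<kappa> * e) * Bq" by simp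
        have "- (s * q' v) \<le> \<bar>s * q' v\<bar>" by linarith
        also have "\<dots> = s * \<bar>q' v\<bar>" using s by (simp add: abs_mult)
        also have "\<dots> \<le> (2 * \<kappa> * e) * (norm v * Bq)" using s \<mu> Bq by (intro mult_mono) auto
        finally have 4: "- (s * q' v) \<le> (2 * \<kappa> * e) * (norm v * Bq)" .
        from 1 2 3 4 show ?thesis by (simp add: K1_def algebra_simps)
      qed
      \<comment> \<open>Both values are expanded about \<open>c 0\<close>, the only point where
        differentiability is assumed; the terms \<open>p' (c t - c 0)\<close> cancel and
        \<open>- \<mu> * p' v\<close> remains.\<close>
      have p_est: "L' (c t - \<mu> *\<^sub>R v + r' *\<^sub>R u) u - L' (c t) u \<le> - \<mu> * p' v + 2 * norm u * Bp * \<kappa> * e\<^sup>2 + 2 * M * \<kappa>\<^sup>2 * e"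
        if r': "0 \<le> r'" "r' \<le> r" for r'
      proof -
        let ?w = "c t - \<mu> *\<^sub>R v + r' *\<^sub>R u"
        have n: "norm (?w - c 0) \<le> M * e" "norm (c t - c 0) \<le> M * e"
          using near[of \<mu> r'] near[of 0 0] r' r \<mu> by auto
        have "\<bar>L' ?w u - L' (c 0) u - p' (?w - c 0)\<bar> \<le> \<kappa>\<^sup>2 * norm (?w - c 0)" using d3(2)[of ?w] n Me by simp
        also have "\<dots> \<le> \<kappa>\<^sup>2 * (M * e)" using n by (intro mult_left_mono) auto
        finally have 1: "L' ?w u - L' (c 0) u \<le> p' (?w - c 0) + \<kappa>\<^sup>2 * (M * e)" by simp
        have "\<bar>L' (c t) u - L' (c 0) u - p' (c t - c 0)\<bar> \<le> \<kappa>\<^sup>2 * norm (c t - c 0)" using d3(2)[of "c t"] n Me by simp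
        also have "\<dots> \<le> \<kappa>\<^sup>2 * (M * e)" using n by (intro mult_left_mono) auto
        finally have 2: "L' (c t) u - L' (c 0) u \<ge> p' (c t - c 0) - \<kappa>\<^sup>2 * (M * e)" by simp
        have "?w - c 0 = (c t - c 0) - \<mu> *\<^sub>R v + r' *\<^sub>R u" by simp
        then have 3: "p' (?w - c 0) = p' (c t - c 0) - \<mu> * p' v + r' * p' u"
          by (simp only: p'.add p'.diff p'.scaleR real_scaleR_def)
        have "\<mu> * e \<le> 2 * \<kappa> * e * e" using \<mu> e by (intro mult_right_mono) auto
        then have re: "r \<le> 2 * \<kappa> * e\<^sup>2" using r by (simp add: power2_eq_square)
        have "r' * p' u \<le> \<bar>r' * p' u\<bar>" by linarith
        also have "\<dots> = r' * \<bar>p' u\<bar>" using r' by (simp add: abs_mult)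
        also have "\<dots> \<le> (2 * \<kappa> * e\<^sup>2) * (norm u * Bp)" using r' re Bp by (intro mult_mono) auto
        finally have 4: "r' * p' u \<le> (2 * \<kappa> * e\<^sup>2) * (norm u * Bp)" .
        from 1 2 3 4 show ?thesis by (simp add: algebra_simps)
      qed
      \<comment> \<open>In direction \<open>-v\<close> the first derivative changes its sign and the
        second does not.\<close>
      obtain s where s: "0 < s" "s < \<mu>"
        "L (c t + \<mu> *\<^sub>R (-v)) - L (c t) - \<mu> * (- L' (c t) v) = \<mu>\<^sup>2 / 2 * g' (c t + s *\<^sub>R (-v)) v"
      proof (rule second_order_taylor_along[where r = \<mu> and f = L and z = "c t" and w = "-v"
            and g = "\<lambda>z. - L' z v" and q = "\<lambda>z. g' z v"])
        fix s
        have D: "c t + s *\<^sub>R (-v) \<in> D" using D_add1(3)[OF ct] by simp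
        show "((\<lambda>s. L (c t + s *\<^sub>R (-v))) has_real_derivative - L' (c t + s *\<^sub>R (-v)) v) (at s)"
          using DERIV_along[OF L[OF D]] by (simp add: blinfun.minus_right)
        have "g' (c t + s *\<^sub>R (-v)) (-v) = - g' (c t + s *\<^sub>R (-v)) v"
          using has_derivative_linear[OF g[OF D]] by (rule linear_neg)
        then show "((\<lambda>s. - L' (c t + s *\<^sub>R (-v)) v) has_real_derivative g' (c t + s *\<^sub>R (-v)) v) (at s)"
          using DERIV_minus[OF DERIV_along[OF g[OF D]]] by simp
      qed (use \<mu> in auto)
      then have "L (c t - \<mu> *\<^sub>R v) - L (c t) + \<mu> * L' (c t) v = \<mu>\<^sup>2 / 2 * g' (c t - s *\<^sub>R v) v" by simp
      also have "\<dots> \<le> \<mu>\<^sup>2 / 2 * (t * q' c' + K1 * \<kappa> * e)" using q_est s by (intro mult_left_mono) auto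
      also have "\<dots> \<le> \<mu>\<^sup>2 / 2 * (t * q' c' + K * \<kappa> * e)"
        using K \<kappa> e by (intro mult_left_mono add_left_mono mult_right_mono) auto
      finally have first: "L (c t - \<mu> *\<^sub>R v) - L (c t) + \<mu> * L' (c t) v \<le> \<mu>\<^sup>2 / 2 * (t * q' c' + K * \<kappa> * e)" .
      obtain r' where r': "0 \<le> r'" "r' \<le> r"
        "L (c t - \<mu> *\<^sub>R v + r *\<^sub>R u) - L (c t - \<mu> *\<^sub>R v) = r * L' (c t - \<mu> *\<^sub>R v + r' *\<^sub>R u) u"
        by (rule mvt_along[of r L "\<lambda>z. L' z" "c t - \<mu> *\<^sub>R v" u]) (auto intro: L D_add1 ct r)
      have "L (c t - \<mu> *\<^sub>R v + r *\<^sub>R u) - L (c t - \<mu> *\<^sub>R v) - r * L' (c t) u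
        = r * (L' (c t - \<mu> *\<^sub>R v + r' *\<^sub>R u) u - L' (c t) u)" using r'(3) by (simp add: algebra_simps)
      also have "\<dots> \<le> r * (- \<mu> * p' v + 2 * norm u * Bp * \<kappa> * e\<^sup>2 + 2 * M * \<kappa>\<^sup>2 * e)"
        using p_est[OF r'(1,2)] r by (intro mult_left_mono) auto
      also have "\<dots> \<le> r * (- \<mu> * p' v + K * \<kappa> * e\<^sup>2 + K * \<kappa>\<^sup>2 * e)"
        using K \<kappa> e r by (intro mult_left_mono[OF add_mono[OF add_left_mono]] mult_right_mono) auto
      finally have "L (c t - \<mu> *\<^sub>R v + r *\<^sub>R u) - L (c t - \<mu> *\<^sub>R v) - r * L' (c t) u
        \<le> r * (- \<mu> * p' v + K * \<kappa> * e\<^sup>2 + K * \<kappa>\<^sup>2 * e)" .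
      moreover have "c t - \<mu> *\<^sub>R v + r *\<^sub>R u = c t + r *\<^sub>R u - \<mu> *\<^sub>R v" by simp
      ultimately show "L (c t + r *\<^sub>R u - \<mu> *\<^sub>R v) - L (c t) - r * L' (c t) u + \<mu> * L' (c t) v
       \<le> \<mu>\<^sup>2 / 2 * (t * q' c' + K * \<kappa> * e) + r * (- \<mu> * p' v + K * \<kappa> * e\<^sup>2 + K * \<kappa>\<^sup>2 * e)"
        using first by simp
    qed
  qed
qed

text \<open>As a function of t the left side is differentiable at 0 from the right and vanishes
  there by \<open>E0\<close>. The coefficient without \<rho> is its derivative: \<open>u\<close>
  comes from the moving position and \<open>c'\<close> from the moving base point.\<close>

lemma first_slope_bound:
  assumes p: "((\<lambda>z. L' z u) has_derivative p') (at (c 0))"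
    and g: "((\<lambda>z. L' z v) has_derivative g') (at (c 0))"
    and c': "(c has_vector_derivative c') (at 0 within {0..e0})"
    and E0: "L (c 0 + v) - L (c 0) - L' (c 0) v = 0" and "0 < \<rho>"
  shows "\<forall>\<^sub>F e in at_right 0. \<forall>t. 0 \<le> t \<and> t \<le> e \<longrightarrow>
      L (c t + t *\<^sub>R u + v) - L (c t) - t * L' (c t) u - L' (c t) v
      \<le> (L' (c 0 + v) u - L' (c 0) u + (L' (c 0 + v) c' - L' (c 0) c' - g' c') + \<rho>) * t"
proof -
  let ?A = "L' (c 0 + v) u - L' (c 0) u + (L' (c 0 + v) c' - L' (c 0) c' - g' c')"
  let ?\<phi> = "\<lambda>t. L (c t + t *\<^sub>R u + v) - L (c t) - t * L' (c t) u - L' (c t) v"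
  have z0: "c 0 \<in> D" using c_D e0 by auto
  have "((\<lambda>t. c t + t *\<^sub>R u + v) has_vector_derivative (c' + u)) (at 0 within {0..e0})"
    using c' by (auto intro!: derivative_eq_intros)
  from has_real_derivative_along_curve[OF this, of L "L' (c 0 + v)"]
  have 1: "((\<lambda>t. L (c t + t *\<^sub>R u + v)) has_real_derivative L' (c 0 + v) (c' + u)) (at 0 within {0..e0})"
    using L[OF D_add1(4)[OF z0]] by simp
  \<comment> \<open>The factor t is zero at 0, which removes \<open>p' c'\<close> from the product
    rule.\<close>
  have "(?\<phi> has_real_derivative (L' (c 0 + v) (c' + u) - L' (c 0) c' - (p' c' * 0 + 1 * L' (c 0) u) - g' c')) (at 0 within {0..e0})"
    by (rule derivative_eq_intros 1 has_real_derivative_along_curve[OF c'] L[OF z0] p g refl)+ simp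
  then have "(?\<phi> has_real_derivative ?A) (at 0 within {0..e0})"
    by (simp add: blinfun.add_right algebra_simps)
  then have "\<forall>e>0. \<exists>d>0. \<forall>y\<in>{0..e0}. norm (y - 0) < d \<longrightarrow> norm (?\<phi> y - ?\<phi> 0 - ?A * (y - 0)) \<le> e * norm (y - 0)"
    unfolding has_field_derivative_def has_derivative_within_alt by blast
  with \<open>0 < \<rho>\<close> obtain d where d: "0 < d" "\<And>y. y \<in> {0..e0} \<Longrightarrow> norm (y - 0) < d \<Longrightarrow> norm (?\<phi> y - ?\<phi> 0 - ?A * (y - 0)) \<le> \<rho> * norm (y - 0)"
    by blast
  have "\<forall>\<^sub>F e in at_right 0. 0 < e \<and> e < min d e0" using d e0 by (intro eventually_at_right_0_less) auto
  then show ?thesis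
  proof (eventually_elim, intro allI impI)
    fix e t assume "0 < e \<and> e < min d e0" "0 \<le> t \<and> t \<le> e"
    with d(2)[of t] E0 have "\<bar>?\<phi> t - ?A * t\<bar> \<le> \<rho> * t" by simp
    moreover have "(?A + \<rho>) * t = ?A * t + \<rho> * t" by (rule distrib_right)
    ultimately show "?\<phi> t \<le> (?A + \<rho>) * t" by linarith
  qed
qed

text \<open>In units of m^2 / 2 and in the limit, the short stretch contributes its slope
  coefficient. On the long one \<mu>^2 / 2 times the integral of t gives \<open>q' c' / 2\<close>,
  and the integral of the height times \<open>- \<mu> * p' v\<close> gives
  \<open>- p' v\<close>.\<close>

lemma degenerate_direction_condition:
  assumes p: "((\<lambda>z. L' z u) has_derivative p') (at (c 0))"
    and g: "\<And>z. z \<in> D \<Longrightarrow> ((\<lambda>z. L' z v) has_derivative g' z) (at z)"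
    and q: "((\<lambda>z. g' z v) has_derivative q') (at (c 0))"
    and c': "(c has_vector_derivative c') (at 0 within {0..e0})"
    and E0: "L (c 0 + v) - L (c 0) - L' (c 0) v = 0"
    and q0: "g' (c 0) v = 0"
  shows "0 \<le> L' (c 0 + v) u - L' (c 0) u - p' v + (L' (c 0 + v) c' - L' (c 0) c' - g' (c 0) c') + q' c' / 2"
proof -
  have z0: "c 0 \<in> D" using c_D e0 by auto
  obtain K where K: "0 \<le> K"
    "\<And>\<kappa>. 0 < \<kappa> \<Longrightarrow> \<kappa> \<le> 1 \<Longrightarrow> \<forall>\<^sub>F e in at_right 0. \<forall>t \<mu> r. 0 \<le> t \<and> t \<le> e \<and> 0 < \<mu> \<and> \<mu> \<le> 2 * \<kappa> * e \<and> 0 \<le> r \<and> r \<le> \<mu> * e \<longrightarrow>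
       L (c t + r *\<^sub>R u - \<mu> *\<^sub>R v) - L (c t) - r * L' (c t) u + \<mu> * L' (c t) v
       \<le> \<mu>\<^sup>2 / 2 * (t * q' c' + K * \<kappa> * e) + r * (- \<mu> * p' v + K * \<kappa> * e\<^sup>2 + K * \<kappa>\<^sup>2 * e)"
    using second_slope_bound[OF p g q c' q0] by blast
  define A where "A = L' (c 0 + v) u - L' (c 0) u + (L' (c 0 + v) c' - L' (c 0) c' - g' (c 0) c')"
  \<comment> \<open>The error budget: \<kappa> is the tolerance of the first slope, 2 K \<kappa>
    comes from the second-order term and K \<kappa> from the position term of the second
    slope.\<close>
  have *: "0 \<le> A + q' c' / 2 - p' v + (1 + 3 * K) * \<kappa>" if \<kappa>: "0 < \<kappa>" "\<kappa> \<le> 1" for \<kappa>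
  proof -
    \<comment> \<open>\<open>R e\<close> is the upper bound for the sum of the two integrals,
      divided by m^2 / 2.\<close>
    define R where "R e = A + \<kappa> + q' c' / 2 * ((1 + \<kappa> * e) / (1 - \<kappa> * e)) - p' v + 2 * K * \<kappa> + K * e + K * \<kappa>" for e
    have "\<forall>\<^sub>F e in at_right 0. 0 < e \<and> e < min e0 (1/2)"
      using e0 by (intro eventually_at_right_0_less) auto
    with K(2)[OF \<kappa>] first_slope_bound[OF p g[OF z0] c' E0 \<kappa>(1)]
    have "\<forall>\<^sub>F e in at_right 0. 0 \<le> R e"
    proof eventually_elim
      case (elim e)
      define m where "m = \<kappa> * e\<^sup>2"
      define w where "w = e - m"
      define \<mu> where "\<mu> = m / w"
      have e: "0 < e" "e < 1/2" "e < e0" using elim by auto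
      have \<kappa>e: "\<kappa> * e \<le> 1 / 2" using mult_mono[of \<kappa> 1 e "1/2"] \<kappa> e by simp
      have m: "0 < m" "m \<le> e / 2" using \<kappa> e \<kappa>e by (auto simp: m_def power2_eq_square)
      have w: "0 < w" "e / 2 \<le> w" "w \<le> e" "e = w + m" using m by (auto simp: w_def)
      have \<mu>: "0 < \<mu>" "\<mu> * w = m" using m w by (auto simp: \<mu>_def)
      have \<mu>2: "\<mu> \<le> 2 * \<kappa> * e"
      proof -
        have "\<mu> \<le> m / (e / 2)" unfolding \<mu>_def using m w e by (intro divide_left_mono) auto
        also have "\<dots> = 2 * \<kappa> * e" using e by (simp add: m_def power2_eq_square)
        finally show ?thesis .
      qed
      let ?\<phi> = "\<lambda>t. L (c t + t *\<^sub>R u + v) - L (c t) - t * L' (c t) u - L' (c t) v"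
      let ?P = "\<lambda>t. L (c t + (\<mu> * (e - t)) *\<^sub>R u - \<mu> *\<^sub>R v) - L (c t) - \<mu> * (e - t) * L' (c t) u + \<mu> * L' (c t) v"
      define X where "X = (1 + \<kappa> * e) / (1 - \<kappa> * e)"
      define C1 where "C1 = K * \<kappa> * e"
      define C2 where "C2 = - \<mu> * p' v + K * \<kappa> * e\<^sup>2 + K * \<kappa>\<^sup>2 * e"
      have sub: "{0..m} \<subseteq> {0..e0}" "{m..e} \<subseteq> {0..e0}" using m e by auto
      have c1: "continuous_on S (\<lambda>t. L' (c t) w)" if "S \<subseteq> {0..e0}" for S w
        by (rule continuous_along(4)[OF continuous_on_const continuous_on_const that])
      have c2: "continuous_on {0..m} (\<lambda>t. L (c t + t *\<^sub>R u + v))"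
        using continuous_along(1)[of "{0..m}" "\<lambda>t. t" "\<lambda>t. 1"] sub by simp
      have c3: "continuous_on {m..e} (\<lambda>t. L (c t + (\<mu> * (e - t)) *\<^sub>R u - \<mu> *\<^sub>R v))"
        using sub by (intro continuous_along continuous_intros)
      have c4: "continuous_on S (\<lambda>t. L (c t))" if "S \<subseteq> {0..e0}" for S
        by (rule continuous_along(3)[OF continuous_on_const continuous_on_const that])
      have int: "?\<phi> integrable_on {0..m}" "?P integrable_on {m..e}"
        by (intro integrable_continuous_real continuous_on_add continuous_on_diff continuous_on_mult
            continuous_on_const continuous_on_id c1 c2 c3 c4 sub)+
      have "((\<lambda>t. (A + \<kappa>) * t) has_integral (A + \<kappa>) * m\<^sup>2 / 2 - (A + \<kappa>) * 0\<^sup>2 / 2) {0..m}"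
        using m by (intro fundamental_theorem_of_calculus)
          (auto intro!: derivative_eq_intros simp flip: has_real_derivative_iff_has_vector_derivative)
      then have I1: "integral {0..m} ?\<phi> \<le> (A + \<kappa>) * m\<^sup>2 / 2"
        using elim m e by (intro has_integral_le[OF integrable_integral[OF int(1)], rotated]) (auto simp: A_def)
      \<comment> \<open>A primitive of the bound of \<open>second_slope_bound\<close> for the height
        r = \<mu> (e - t).\<close>
      define F where "F t = \<mu>\<^sup>2 / 2 * (t\<^sup>2 / 2 * q' c' + C1 * t) - \<mu> * (e - t)\<^sup>2 / 2 * C2" for t
      have "((\<lambda>t. \<mu>\<^sup>2 / 2 * (t * q' c' + C1) + \<mu> * (e - t) * C2) has_integral F e - F m) {m..e}"
        unfolding F_def using m
        by (intro fundamental_theorem_of_calculus)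
          (auto intro!: derivative_eq_intros simp flip: has_real_derivative_iff_has_vector_derivative simp: field_simps)
      then have I2: "integral {m..e} ?P \<le> F e - F m"
      proof (rule has_integral_le[OF integrable_integral[OF int(2)]])
        fix t assume "t \<in> {m..e}"
        moreover then have "\<mu> * (e - t) \<le> \<mu> * e" using m \<mu> by (intro mult_left_mono) auto
        ultimately show "?P t \<le> \<mu>\<^sup>2 / 2 * (t * q' c' + C1) + \<mu> * (e - t) * C2"
          unfolding C1_def C2_def using elim(1) m \<mu> \<mu>2 by auto
      qed
      have "0 \<le> integral {0..m} ?\<phi> + integral {m..e} ?P"
        using e by (intro second_variation_nonneg m) (auto simp: \<mu>_def w_def)
      with I1 I2 have sum0: "0 \<le> (A + \<kappa>) * m\<^sup>2 / 2 + (F e - F m)" by linarith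
      have "F e - F m = \<mu>\<^sup>2 / 2 * (w * (e + m) / 2 * q' c' + C1 * w) + \<mu> * w\<^sup>2 / 2 * C2"
        by (simp add: F_def w_def field_simps power2_eq_square)
      also have "\<dots> = m\<^sup>2 / 2 * (q' c' / 2 * ((e + m) / w) + C1 / w) + m * w / 2 * C2"
        unfolding \<mu>_def using w(1) by (simp add: field_simps power2_eq_square)
      also have "(e + m) / w = X"
      proof -
        have "e + m = e * (1 + \<kappa> * e)" "w = e * (1 - \<kappa> * e)"
          by (auto simp: m_def w_def power2_eq_square algebra_simps)
        then show ?thesis using e by (simp add: X_def)
      qed
      also have "m * w / 2 * C2 = m\<^sup>2 / 2 * (- p' v) + m * w / 2 * (K * \<kappa> * e\<^sup>2 + K * \<kappa>\<^sup>2 * e)"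
      proof -
        have "m * w / 2 * C2 = m * (\<mu> * w) / 2 * (- p' v) + m * w / 2 * (K * \<kappa> * e\<^sup>2 + K * \<kappa>\<^sup>2 * e)"
          by (simp add: C2_def algebra_simps add_divide_distrib diff_divide_distrib)
        then show ?thesis unfolding \<mu>(2) by (simp add: power2_eq_square)
      qed
      finally have Fm: "F e - F m = m\<^sup>2 / 2 * (q' c' / 2 * X) + m\<^sup>2 / 2 * (C1 / w) + (m\<^sup>2 / 2 * (- p' v)
          + m * w / 2 * (K * \<kappa> * e\<^sup>2 + K * \<kappa>\<^sup>2 * e))" by (simp only: distrib_left)
      have "m * w / 2 * (K * \<kappa> * e\<^sup>2 + K * \<kappa>\<^sup>2 * e) \<le> m * e / 2 * (K * \<kappa> * e\<^sup>2 + K * \<kappa>\<^sup>2 * e)"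
        using m w e K(1) \<kappa> by (intro mult_right_mono divide_right_mono mult_left_mono) auto
      also have "\<dots> = m\<^sup>2 / 2 * (K * e + K * \<kappa>)"
        by (simp add: m_def power2_eq_square field_simps)
      finally have I3: "m * w / 2 * (K * \<kappa> * e\<^sup>2 + K * \<kappa>\<^sup>2 * e) \<le> m\<^sup>2 / 2 * (K * e + K * \<kappa>)" .
      have "C1 \<le> (K * \<kappa>) * (2 * w)" unfolding C1_def using w K(1) \<kappa> by (intro mult_left_mono) auto
      then have "C1 / w \<le> 2 * K * \<kappa>" using w by (simp add: pos_divide_le_eq mult_ac)
      then have I4: "m\<^sup>2 / 2 * (C1 / w) \<le> m\<^sup>2 / 2 * (2 * K * \<kappa>)" by (intro mult_left_mono) auto
      have "m\<^sup>2 / 2 * R e = (A + \<kappa>) * m\<^sup>2 / 2 + (m\<^sup>2 / 2 * (q' c' / 2 * X) + m\<^sup>2 / 2 * (2 * K * \<kappa>)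
          + (m\<^sup>2 / 2 * (- p' v) + m\<^sup>2 / 2 * (K * e + K * \<kappa>)))"
        unfolding R_def X_def[symmetric] by (simp add: algebra_simps add_divide_distrib)
      with sum0 Fm I3 I4 have "0 \<le> m\<^sup>2 / 2 * R e" by linarith
      then show ?case using m by (simp add: zero_le_mult_iff)
    qed
    moreover have "((\<lambda>e. R e) \<longlongrightarrow> A + \<kappa> + q' c' / 2 * ((1 + \<kappa> * 0) / (1 - \<kappa> * 0)) - p' v + 2 * K * \<kappa> + K * 0 + K * \<kappa>) (at_right 0)"
      unfolding R_def by (intro tendsto_intros) auto
    ultimately have "0 \<le> A + \<kappa> + q' c' / 2 * ((1 + \<kappa> * 0) / (1 - \<kappa> * 0)) - p' v + 2 * K * \<kappa> + K * 0 + K * \<kappa>"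
      by (intro tendsto_lowerbound) auto
    then show ?thesis by (simp add: algebra_simps)
  qed
  have "0 \<le> A + q' c' / 2 - p' v"
  proof (rule ccontr)
    assume neg: "\<not> ?thesis"
    define B where "B = A + q' c' / 2 - p' v"
    have B: "B < 0" using neg by (simp add: B_def)
    \<comment> \<open>Chosen so that the error is at most half of \<open>- B\<close>; this uses that
      \<open>K\<close> does not depend on \<kappa>.\<close>
    define \<kappa> where "\<kappa> = min 1 (- B / (2 * (1 + 3 * K)))"
    have "0 < \<kappa>" "\<kappa> \<le> 1" using B K(1) by (auto simp: \<kappa>_def intro!: divide_neg_pos)
    then have "0 \<le> B + (1 + 3 * K) * \<kappa>" using * by (simp add: B_def)
    also have "(1 + 3 * K) * \<kappa> \<le> (1 + 3 * K) * (- B / (2 * (1 + 3 * K)))"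
      using K(1) by (intro mult_left_mono) (auto simp: \<kappa>_def)
    also have "\<dots> = - B / 2" using K(1) by (simp add: field_simps)
    finally show False using B by simp
  qed
  then show ?thesis by (simp add: A_def)
qed

end

section \<open>Tent functions\<close>

text \<open>Two lines that meet at height q - p above q, cut off at 0. With min and max, continuity
  needs no case distinction.\<close>

definition tent :: "real \<Rightarrow> real \<Rightarrow> real \<Rightarrow> real \<Rightarrow> real" where
  "tent p q r t = max 0 (min (t - p) ((q - p) / (r - q) * (r - t)))"

text \<open>At \<open>p\<close> and \<open>r\<close> this is the derivative inside \<open>{p..r}\<close>, which is the one that counts when
  \<open>p\<close> or \<open>r\<close> is an endpoint of the interval of definition.\<close>

definition tent_slope :: "real \<Rightarrow> real \<Rightarrow> real \<Rightarrow> real \<Rightarrow> real" where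
  "tent_slope p q r t = (if p \<le> t \<and> t < q then 1 else if q \<le> t \<and> t \<le> r then - ((q - p) / (r - q)) else 0)"

lemma tent_left: "p < q \<Longrightarrow> q < r \<Longrightarrow> t \<le> p \<Longrightarrow> tent p q r t = 0"
  by (simp add: tent_def)

lemma tent_right:
  assumes "p < q" "q < r" "r \<le> t" shows "tent p q r t = 0"
proof -
  have "(q - p) / (r - q) * (r - t) \<le> 0" using assms by (intro mult_nonneg_nonpos) auto
  then show ?thesis by (simp add: tent_def)
qed

lemma tent_up:
  assumes "p < q" "q < r" "p \<le> t" "t \<le> q" shows "tent p q r t = t - p"
proof -
  have "(q - p) / (r - q) * (r - q) \<le> (q - p) / (r - q) * (r - t)"
    using assms by (intro mult_left_mono) auto
  then show ?thesis using assms by (simp add: tent_def)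
qed

lemma tent_down:
  assumes "p < q" "q < r" "q \<le> t" "t \<le> r" shows "tent p q r t = (q - p) / (r - q) * (r - t)"
proof -
  have "(q - p) / (r - q) * (r - t) \<le> (q - p) / (r - q) * (r - q)"
    using assms by (intro mult_left_mono) auto
  moreover have "0 \<le> (q - p) / (r - q) * (r - t)" using assms by simp
  ultimately show ?thesis using assms by (simp add: tent_def)
qed

lemma tent_bounds: "0 \<le> tent p q r t" "p \<le> r \<Longrightarrow> p < q \<Longrightarrow> q < r \<Longrightarrow> tent p q r t \<le> r - p"
  using tent_right[of p q r t] by (cases "t \<le> r"; auto simp: tent_def)+

lemma continuous_on_tent: "continuous_on S (tent p q r)"
  unfolding tent_def by (intro continuous_intros)

text \<open>Corners are excluded only in the interior. At \<open>p = t0\<close> or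
  \<open>r = t1\<close> the part of the tent inside the interval is affine near the corner, and this
  is all that a derivative within \<open>{t0..t1}\<close> sees.\<close>

lemma tent_locally_affine:
  assumes pqr: "p < q" "q < r" "t0 \<le> p" "r \<le> t1" and t: "t \<in> {t0..t1} - {p, q, r} \<inter> {t0<..<t1}"
  shows "\<exists>e>0. \<forall>y\<in>{t0..t1}. \<bar>y - t\<bar> < e \<longrightarrow>
     tent p q r y = tent p q r t + tent_slope p q r t * (y - t) \<and> tent_slope p q r y = tent_slope p q r t"
proof -
  consider "t < p" | "p \<le> t" "t < q" "p < t \<or> p = t0" | "q < t" "t \<le> r" "t < r \<or> r = t1" | "r < t"
    using t pqr by force
  then show ?thesis
  proof cases
    case 1
    show ?thesis
      using 1 pqr by (intro exI[of _ "p - t"] conjI) (auto simp: tent_left tent_slope_def)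
  next
    case 2
    define e where "e = (if p = t0 then q - t else min (t - p) (q - t))"
    show ?thesis
    proof (intro exI[of _ e] conjI ballI impI)
      show "0 < e" using 2 by (auto simp: e_def)
      fix y assume "y \<in> {t0..t1}" "\<bar>y - t\<bar> < e"
      then have "p \<le> y" "y < q" using 2 by (auto simp: e_def split: if_splits)
      with 2 pqr show "tent p q r y = tent p q r t + tent_slope p q r t * (y - t)" "tent_slope p q r y = tent_slope p q r t"
        by (simp_all add: tent_up tent_slope_def)
    qed
  next
    case 3
    define e where "e = (if r = t1 then t - q else min (t - q) (r - t))"
    show ?thesis
    proof (intro exI[of _ e] conjI ballI impI)
      show "0 < e" using 3 by (auto simp: e_def)
      fix y assume "y \<in> {t0..t1}" "\<bar>y - t\<bar> < e"
      then have "q < y" "y \<le> r" using 3 by (auto simp: e_def split: if_splits)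
      define g where "g = (q - p) / (r - q)"
      have "tent p q r y = g * (r - y)" "tent p q r t = g * (r - t)" "tent_slope p q r y = - g" "tent_slope p q r t = - g"
        using 3 pqr \<open>q < y\<close> \<open>y \<le> r\<close> by (simp_all add: tent_down tent_slope_def g_def)
      then show "tent p q r y = tent p q r t + tent_slope p q r t * (y - t)" "tent_slope p q r y = tent_slope p q r t"
        by (simp_all add: algebra_simps)
    qed
  next
    case 4
    show ?thesis
      using 4 pqr by (intro exI[of _ "t - r"] conjI) (auto simp: tent_right tent_slope_def)
  qed
qed

lemma has_real_derivative_tent:
  assumes "p < q" "q < r" "t0 \<le> p" "r \<le> t1" and t: "t \<in> {t0..t1} - {p, q, r} \<inter> {t0<..<t1}"
  shows "(tent p q r has_real_derivative tent_slope p q r t) (at t within {t0..t1})"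
proof -
  obtain e where e: "0 < e" "\<And>y. y \<in> {t0..t1} \<Longrightarrow> \<bar>y - t\<bar> < e \<Longrightarrow>
     tent p q r y = tent p q r t + tent_slope p q r t * (y - t)"
    using tent_locally_affine[OF assms] by auto
  have "((\<lambda>y. tent p q r t + tent_slope p q r t * (y - t)) has_real_derivative tent_slope p q r t) (at t within {t0..t1})"
    by (auto intro!: derivative_eq_intros)
  then show ?thesis
    by (rule has_field_derivative_transform_within[OF _ e(1)]) (use t in \<open>auto simp: dist_real_def intro!: e(2)[symmetric]\<close>)
qed

lemma continuous_on_tent_slope:
  assumes "p < q" "q < r" "t0 \<le> p" "r \<le> t1"
  shows "continuous_on ({t0..t1} - {p, q, r} \<inter> {t0<..<t1}) (tent_slope p q r)"
  unfolding continuous_on_eq_continuous_within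
proof
  fix t assume t: "t \<in> {t0..t1} - {p, q, r} \<inter> {t0<..<t1}"
  obtain e where e: "0 < e" "\<And>y. y \<in> {t0..t1} \<Longrightarrow> \<bar>y - t\<bar> < e \<Longrightarrow> tent_slope p q r y = tent_slope p q r t"
    using tent_locally_affine[OF assms t] by auto
  show "continuous (at t within {t0..t1} - {p, q, r} \<inter> {t0<..<t1}) (tent_slope p q r)"
    by (rule continuous_transform_within[OF continuous_const[of _ "tent_slope p q r t"] e(1) t]) (auto simp: dist_real_def intro!: e(2)[symmetric])
qed

lemma tent_slope_limits:
  assumes "p < q" "q < r"
  shows "\<exists>l. (tent_slope p q r \<longlongrightarrow> l) (at_left t)" "\<exists>l. (tent_slope p q r \<longlongrightarrow> l) (at_right t)"
proof -
  have *: "\<exists>l. (tent_slope p q r \<longlongrightarrow> l) F" if "\<forall>\<^sub>F y in F. tent_slope p q r y = k" for F k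
    using tendsto_cong[OF that] tendsto_const by blast
  have gt: "\<forall>\<^sub>F y in at_left t. s < y" if "s < t" for s
    using that by (auto simp: eventually_at_left_field)
  have lt: "\<forall>\<^sub>F y in at_right t. y < s" if "t < s" for s
    using that by (auto simp: eventually_at_right_field)
  have L: "\<forall>\<^sub>F y in at_left t. y < t" and R: "\<forall>\<^sub>F y in at_right t. t < y"
    by (auto simp: eventually_at_filter)
  consider "t \<le> p" | "p < t" "t \<le> q" | "q < t" "t \<le> r" | "r < t" by linarith
  then show "\<exists>l. (tent_slope p q r \<longlongrightarrow> l) (at_left t)"
  proof cases
    case 1
    have "\<forall>\<^sub>F y in at_left t. tent_slope p q r y = 0"
      using L by eventually_elim (use 1 assms in \<open>auto simp: tent_slope_def\<close>)
    then show ?thesis by (rule *)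
  next
    case 2
    have "\<forall>\<^sub>F y in at_left t. tent_slope p q r y = 1"
      using L gt[OF 2(1)] by eventually_elim (use 2 assms in \<open>auto simp: tent_slope_def\<close>)
    then show ?thesis by (rule *)
  next
    case 3
    have "\<forall>\<^sub>F y in at_left t. tent_slope p q r y = - ((q - p) / (r - q))"
      using L gt[OF 3(1)] by eventually_elim (use 3 assms in \<open>auto simp: tent_slope_def\<close>)
    then show ?thesis by (rule *)
  next
    case 4
    have "\<forall>\<^sub>F y in at_left t. tent_slope p q r y = 0"
      using gt[OF 4] by eventually_elim (use 4 assms in \<open>auto simp: tent_slope_def\<close>)
    then show ?thesis by (rule *)
  qed
  consider "t < p" | "p \<le> t" "t < q" | "q \<le> t" "t < r" | "r \<le> t" by linarith
  then show "\<exists>l. (tent_slope p q r \<longlongrightarrow> l) (at_right t)"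
  proof cases
    case 1
    have "\<forall>\<^sub>F y in at_right t. tent_slope p q r y = 0"
      using lt[OF 1] by eventually_elim (use 1 assms in \<open>auto simp: tent_slope_def\<close>)
    then show ?thesis by (rule *)
  next
    case 2
    have "\<forall>\<^sub>F y in at_right t. tent_slope p q r y = 1"
      using R lt[OF 2(2)] by eventually_elim (use 2 assms in \<open>auto simp: tent_slope_def\<close>)
    then show ?thesis by (rule *)
  next
    case 3
    have "\<forall>\<^sub>F y in at_right t. tent_slope p q r y = - ((q - p) / (r - q))"
      using R lt[OF 3(2)] by eventually_elim (use 3 assms in \<open>auto simp: tent_slope_def\<close>)
    then show ?thesis by (rule *)
  next
    case 4
    have "\<forall>\<^sub>F y in at_right t. tent_slope p q r y = 0"
      using R by eventually_elim (use 4 assms in \<open>auto simp: tent_slope_def\<close>)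
    then show ?thesis by (rule *)
  qed
qed

section \<open>Integrability of piecewise continuous functions\<close>

text \<open>Integrability is local, and a short interval around x contains no exceptional point
  other than x. After a split at x, each half carries a function that becomes continuous once its
  value at x is replaced by the one-sided limit.\<close>

lemma integrable_piecewise_continuous:
  fixes f :: "real \<Rightarrow> 'b::euclidean_space"
  assumes "finite S" "S \<subseteq> {a<..<b}" and cont: "continuous_on ({a..b} - S) f"
    and lim: "\<And>s. s \<in> S \<Longrightarrow> (\<exists>l. (f \<longlongrightarrow> l) (at_left s)) \<and> (\<exists>l. (f \<longlongrightarrow> l) (at_right s))"
  shows "f integrable_on {a..b}"
proof -
  have "f integrable_on cbox a b"
  proof (rule integrable_on_little_subintervals, rule ballI)
    fix x assume x: "x \<in> cbox a b"
    obtain d where d: "0 < d" "\<And>y. y \<in> S \<Longrightarrow> y \<noteq> x \<Longrightarrow> d \<le> dist x y"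
      using finite_set_avoid[OF \<open>finite S\<close>, of x] by auto
    have "f integrable_on cbox u v"
      if uv: "x \<in> cbox u v" "cbox u v \<subseteq> ball x d" "cbox u v \<subseteq> cbox a b" for u v
    proof -
      have sub: "{u..v} - {x} \<subseteq> {a..b} - S"
        proof
        fix y assume y: "y \<in> {u..v} - {x}"
        then have "dist x y < d" "y \<in> {a..b}" using uv(2,3) by (auto simp: subset_eq)
        then show "y \<in> {a..b} - S" using d(2)[of y] y by fastforce
      qed
      have cont': "continuous_on ({u..v} - {x}) f" using cont sub by (rule continuous_on_subset)
      have isc: "continuous (at y within {u..v}) f" if "y \<in> {u..v}" "y \<noteq> x" for y
      proof -
        have "continuous (at y within {u..v} - {x}) f"
          using cont' that by (auto simp: continuous_on_eq_continuous_within)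
        moreover have "at y within {u..v} - {x} = at y within {u..v}"
          using that by (intro at_within_nhd[of _ "- {x}"]) auto
        ultimately show ?thesis by (simp add: continuous_within)
      qed
      show ?thesis
      proof (cases "x \<in> S")
        case False
        have "{u..v} \<subseteq> {a..b} - S" using sub False uv by auto
        then show ?thesis
          using continuous_on_subset[OF cont] by (auto intro: integrable_continuous_real)
      next
        case True
        obtain l r where l: "(f \<longlongrightarrow> l) (at_left x)" and r: "(f \<longlongrightarrow> r) (at_right x)" using lim[OF True] by auto
        have spike: "f integrable_on T" if T: "T = {u'..v'}" "x \<in> T" "T \<subseteq> {u..v}" and k: "(f \<longlongrightarrow> k) (at x within T)" for T u' v' k
        proof -
          have "continuous_on T (f(x := k))"
            unfolding continuous_on_def
          proof
            fix y assume y: "y \<in> T"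
            show "(f(x := k) \<longlongrightarrow> (f(x := k)) y) (at y within T)"
            proof (cases "y = x")
              case True
              have "(f(x := k) \<longlongrightarrow> k) (at x within T)"
                using k by (rule Lim_transform_eventually) (auto simp: eventually_at_filter)
              then show ?thesis using True by simp
            next
              case False
              then have "(f \<longlongrightarrow> f y) (at y within {u..v})"
                using isc[of y] y T by (auto simp: continuous_within)
              then have "(f \<longlongrightarrow> f y) (at y within T)"
                by (rule tendsto_within_subset) (rule T(3))
              moreover have "\<forall>\<^sub>F z in at y within T. f z = (f(x := k)) z"
                using tendsto_imp_eventually_ne[OF tendsto_ident_at False] by eventually_elim simp
              ultimately have "(f(x := k) \<longlongrightarrow> f y) (at y within T)" by (rule Lim_transform_eventually)
              then show ?thesis using False by simp
            qed
          qed
          then have "(f(x := k)) integrable_on T" using T by (simp add: integrable_continuous_real)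
          then show ?thesis by (rule integrable_spike_finite[of "{x}", rotated 2]) auto
        qed
        have "at x within {u..x} \<le> at_left x" "at x within {x..v} \<le> at_right x"
          unfolding at_within_def by (intro inf_mono; auto)+
        then have "(f \<longlongrightarrow> l) (at x within {u..x})" "(f \<longlongrightarrow> r) (at x within {x..v})"
          using tendsto_mono[OF _ l] tendsto_mono[OF _ r] by auto
        then have "f integrable_on {u..x}" "f integrable_on {x..v}"
          using uv spike[where T = "{u..x}" and k = l] spike[where T = "{x..v}" and k = r] by auto
        moreover note uv
        ultimately show ?thesis using Henstock_Kurzweil_Integration.integrable_combine[of u x v f] by simp
      qed
    qed
    then show "\<exists>d>0. \<forall>u v. x \<in> cbox u v \<and> cbox u v \<subseteq> ball x d \<and> cbox u v \<subseteq> cbox a b \<longrightarrow> f integrable_on cbox u v"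
      using d(1) by blast
  qed
  then show ?thesis by simp
qed


section \<open>One-sided limits and piecewise smooth functions\<close>

definition one_sided_limits :: "(real \<Rightarrow> 'a::topological_space) \<Rightarrow> real \<Rightarrow> bool" where
  "one_sided_limits f s \<longleftrightarrow> (\<exists>l. (f \<longlongrightarrow> l) (at_left s)) \<and> (\<exists>l. (f \<longlongrightarrow> l) (at_right s))"

lemma one_sided_limits_isCont: "isCont f s \<Longrightarrow> one_sided_limits f s"
  unfolding one_sided_limits_def isCont_def
  by (meson UNIV_I at_le subsetI tendsto_mono)

lemma one_sided_limits_compose:
  assumes "one_sided_limits f s" and g: "\<And>l. ((\<lambda>x. g (fst x) (snd x)) \<longlongrightarrow> g s l) (nhds (s, l))"
  shows "one_sided_limits (\<lambda>t. g t (f t)) s"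
proof -
  have *: "\<exists>k. ((\<lambda>t. g t (f t)) \<longlongrightarrow> k) (at s within A)" if "(f \<longlongrightarrow> l) (at s within A)" for A l
  proof -
    have "((\<lambda>t. (t, f t)) \<longlongrightarrow> (s, l)) (at s within A)"
      using that by (intro tendsto_intros)
    from filterlim_compose[OF g this] show ?thesis by auto
  qed
  show ?thesis using assms(1) * unfolding one_sided_limits_def by blast
qed

lemma one_sided_limits_cong:
  assumes "one_sided_limits f s" "\<forall>\<^sub>F t in at s. f t = g t"
  shows "one_sided_limits g s"
proof -
  have "\<forall>\<^sub>F t in at s within A. f t = g t" for A
    using assms(2) filter_leD[OF at_le[of A UNIV s]] by auto
  then show ?thesis
    using assms(1) unfolding one_sided_limits_def by (blast intro: Lim_transform_eventually)
qed

text \<open>One-sided limits are given at all interior points and not only on \<open>S\<close>,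
  because a perturbed function has the corners of the tent as further exceptional points.\<close>

lemma KC1D:
  assumes "KC1 t0 t1 x"
  obtains S where "finite S" "S \<subseteq> {t0<..<t1}" "continuous_on {t0..t1} x"
    "\<And>t. t \<in> {t0..t1} - S \<Longrightarrow> (x has_vector_derivative vel {t0..t1} x t) (at t within {t0..t1})"
    "continuous_on ({t0..t1} - S) (vel {t0..t1} x)"
    "\<And>s. s \<in> {t0<..<t1} \<Longrightarrow> one_sided_limits (vel {t0..t1} x) s"
proof -
  obtain S where S: "finite S" "S \<subseteq> {t0<..<t1}" "continuous_on {t0..t1} x"
    "\<And>t. t \<in> {t0..t1} - S \<Longrightarrow> x differentiable (at t within {t0..t1})"
    "continuous_on ({t0..t1} - S) (vel {t0..t1} x)"
    "\<And>s. s \<in> S \<Longrightarrow> one_sided_limits (vel {t0..t1} x) s"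
    using assms unfolding KC1_def one_sided_limits_def by blast
  show ?thesis
  proof (rule that[OF S(1-3)])
    show "(x has_vector_derivative vel {t0..t1} x t) (at t within {t0..t1})" if "t \<in> {t0..t1} - S" for t
      using S(4)[OF that] by (simp add: vel_def vector_derivative_works)
    show "one_sided_limits (vel {t0..t1} x) s" if "s \<in> {t0<..<t1}" for s
    proof (cases "s \<in> S")
      case False
      have "open ({t0<..<t1} - S)" using S(1) by (intro open_Diff finite_imp_closed) auto
      moreover have "continuous_on ({t0<..<t1} - S) (vel {t0..t1} x)"
        using S(5) by (rule continuous_on_subset) auto
      ultimately have "isCont (vel {t0..t1} x) s"
        using that False by (auto simp: continuous_on_eq_continuous_at)
      then show ?thesis by (rule one_sided_limits_isCont)
    qed (use S(6) in auto)
  qed (rule S(5))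
qed

text \<open>Passing from the candidate \<open>v\<close> to \<open>vel\<close> at a point of
  \<open>S\<close> is harmless: one-sided limits ignore the point itself, and the other points of
  the finite set stay away from it.\<close>

lemma KC1I:
  assumes "finite S" "S \<subseteq> {t0<..<t1}" "continuous_on {t0..t1} x" "t0 < t1"
    and der: "\<And>t. t \<in> {t0..t1} - S \<Longrightarrow> (x has_vector_derivative v t) (at t within {t0..t1})"
    and cont: "continuous_on ({t0..t1} - S) v"
    and lim: "\<And>s. s \<in> S \<Longrightarrow> one_sided_limits v s"
  shows "KC1 t0 t1 x" "\<And>t. t \<in> {t0..t1} - S \<Longrightarrow> vel {t0..t1} x t = v t"
proof -
  show vel: "vel {t0..t1} x t = v t" if "t \<in> {t0..t1} - S" for t
    unfolding vel_def using der[OF that] that \<open>t0 < t1\<close>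
    by (intro vector_derivative_within_closed_interval) auto
  have "one_sided_limits (vel {t0..t1} x) s" if "s \<in> S" for s
  proof (rule one_sided_limits_cong[OF lim[OF that]])
    have "open ({t0<..<t1} - (S - {s}))" using assms(1) by (intro open_Diff finite_imp_closed) auto
    then have "\<forall>\<^sub>F t in at s. t \<in> {t0<..<t1} - (S - {s}) - {s}"
      using that assms(2) by (intro eventually_at_in_open) auto
    then show "\<forall>\<^sub>F t in at s. v t = vel {t0..t1} x t"
      by eventually_elim (auto simp: vel)
  qed
  moreover have "continuous_on ({t0..t1} - S) (vel {t0..t1} x)"
    using cont vel continuous_on_cong[OF refl, of "{t0..t1} - S" "vel {t0..t1} x" v] by blast
  moreover have "x differentiable (at t within {t0..t1})" if "t \<in> {t0..t1} - S" for t
    using der[OF that] by (rule differentiableI_vector)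
  ultimately show "KC1 t0 t1 x"
    unfolding KC1_def one_sided_limits_def using assms(1-3) by blast
qed

lemma integrable_Lagrangian:
  fixes L :: "real \<times> (real^'n) \<times> (real^'n) \<Rightarrow> real"
  assumes "KC1 t0 t1 x" and L: "\<And>t y v. t \<in> {t0..t1} \<Longrightarrow> isCont L (t, y, v)"
  shows "(\<lambda>t. L (t, x t, vel {t0..t1} x t)) integrable_on {t0..t1}"
proof -
  obtain S where S: "finite S" "S \<subseteq> {t0<..<t1}" "continuous_on {t0..t1} x"
    "continuous_on ({t0..t1} - S) (vel {t0..t1} x)"
    "\<And>s. s \<in> {t0<..<t1} \<Longrightarrow> one_sided_limits (vel {t0..t1} x) s"
    using KC1D[OF assms(1)] by metis
  have L': "continuous_on ({t0..t1} \<times> UNIV) L"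
    by (intro continuous_at_imp_continuous_on) (use L in auto)
  show ?thesis
  proof (rule integrable_piecewise_continuous[OF S(1,2)])
    show "continuous_on ({t0..t1} - S) (\<lambda>t. L (t, x t, vel {t0..t1} x t))"
      by (rule continuous_on_compose2[OF L'], intro continuous_intros S(4) continuous_on_subset[OF S(3)]) auto
    fix s assume "s \<in> S"
    then have s: "s \<in> {t0<..<t1}" using S(2) by auto
    then have x: "isCont x s" using continuous_on_interior[OF S(3), of s] by simp
    have "((\<lambda>y. L (fst y, x (fst y), snd y)) \<longlongrightarrow> L (s, x s, l)) (nhds (s, l))" for l
    proof -
      have "((\<lambda>y. y) \<longlongrightarrow> (s, l)) (nhds (s, l))" by (rule filterlim_ident)
      from tendsto_fst[OF this] tendsto_snd[OF this]
      have "((\<lambda>y. (fst y, x (fst y), snd y)) \<longlongrightarrow> (s, x s, l)) (nhds (s, l))"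
        by (intro tendsto_Pair isCont_tendsto_compose[OF x]) auto
      then show ?thesis using s by (intro isCont_tendsto_compose[OF L]) auto
    qed
    from one_sided_limits_compose[where g = "\<lambda>t v. L (t, x t, v)", OF S(5)[OF s] this]
    show "(\<exists>l. ((\<lambda>t. L (t, x t, vel {t0..t1} x t)) \<longlongrightarrow> l) (at_left s)) \<and>
          (\<exists>l. ((\<lambda>t. L (t, x t, vel {t0..t1} x t)) \<longlongrightarrow> l) (at_right s))"
      unfolding one_sided_limits_def .
  qed
qed

section \<open>Variation of the functional by a tent\<close>

text \<open>\<open>W\<close> is the velocity with its values at \<open>p\<close> and
  \<open>r\<close> taken from inside; at an angular point \<open>vel\<close> need not be that
  one-sided value, and the integrands have to be continuous on closed stretches. The length bound 1
  makes the displacement at most \<open>norm \<eta>\<close>.\<close>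

lemma tent_variation:
  fixes L :: "real \<times> (real^'n) \<times> (real^'n) \<Rightarrow> real"
  assumes L: "\<And>t y v. t \<in> {t0..t1} \<Longrightarrow> isCont L (t, y, v)"
    and adm: "admissible t0 t1 x0 x1 xb"
    and min: "\<And>x. admissible t0 t1 x0 x1 x \<Longrightarrow>
        max (SUP t\<in>{t0..t1}. ereal (norm (x t - xb t)))
            (esssup (lebesgue_on {t0..t1})
               (\<lambda>t. ereal (norm (vel {t0..t1} x t - vel {t0..t1} xb t)))) \<le> ereal d
        \<Longrightarrow> J L t0 t1 xb \<le> J L t0 t1 x"
    and pqr: "p < q" "q < r" "t0 \<le> p" "r \<le> t1" "r - p \<le> 1"
    and \<gamma>: "\<gamma> = (q - p) / (r - q)"
    and \<eta>: "norm \<eta> \<le> d" "\<gamma> * norm \<eta> \<le> d"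
    and W: "continuous_on {p..r} W" "\<And>t. t \<in> {p<..<r} \<Longrightarrow> vel {t0..t1} xb t = W t"
  shows "0 \<le> integral {p..q} (\<lambda>t. L (t, xb t + (t - p) *\<^sub>R \<eta>, W t + \<eta>) - L (t, xb t, W t))
     + integral {q..r} (\<lambda>t. L (t, xb t + (\<gamma> * (r - t)) *\<^sub>R \<eta>, W t - \<gamma> *\<^sub>R \<eta>) - L (t, xb t, W t))"
    (is "0 \<le> integral _ ?G1 + integral _ ?G2")
proof -
  let ?I = "{t0..t1}" and ?T = "tent p q r" and ?K = "tent_slope p q r"
  have t01: "t0 < t1" using pqr by linarith
  have "0 < \<gamma>" using pqr \<gamma> by simp
  have K1: "KC1 t0 t1 xb" using adm by (simp add: admissible_def)
  obtain S where S: "finite S" "S \<subseteq> {t0<..<t1}" "continuous_on ?I xb"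
    "\<And>t. t \<in> ?I - S \<Longrightarrow> (xb has_vector_derivative vel ?I xb t) (at t within ?I)"
    "continuous_on (?I - S) (vel ?I xb)"
    "\<And>s. s \<in> {t0<..<t1} \<Longrightarrow> one_sided_limits (vel ?I xb) s"
    using KC1D[OF K1] by metis
  define P where "P = {p, q, r} \<inter> {t0<..<t1}"
  define x where "x t = xb t + ?T t *\<^sub>R \<eta>" for t
  define v where "v t = vel ?I xb t + ?K t *\<^sub>R \<eta>" for t
  have SP: "finite (S \<union> P)" "S \<union> P \<subseteq> {t0<..<t1}" using S by (auto simp: P_def)
  have contx: "continuous_on ?I x"
    unfolding x_def by (intro continuous_intros S(3) continuous_on_tent)
  have der: "(x has_vector_derivative v t) (at t within ?I)" if t: "t \<in> ?I - (S \<union> P)" for t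
  proof -
    have "(?T has_real_derivative ?K t) (at t within ?I)"
      using has_real_derivative_tent[OF pqr(1-4)] t by (auto simp: P_def)
    then show ?thesis
      using S(4)[of t] t unfolding x_def v_def by (auto intro!: derivative_eq_intros)
  qed
  have contv: "continuous_on (?I - (S \<union> P)) v"
    unfolding v_def
    by (intro continuous_intros continuous_on_subset[OF S(5)]
        continuous_on_subset[OF continuous_on_tent_slope[OF pqr(1-4)]]) (auto simp: P_def)
  have lim: "one_sided_limits v s" if "s \<in> S \<union> P" for s
  proof -
    have "one_sided_limits (vel ?I xb) s" using SP S(6) that by auto
    moreover have "(v \<longlongrightarrow> l + k *\<^sub>R \<eta>) F" if "(vel ?I xb \<longlongrightarrow> l) F" "(?K \<longlongrightarrow> k) F" for l k F
      using that unfolding v_def by (intro tendsto_intros)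
    ultimately show ?thesis
      using tent_slope_limits[OF pqr(1,2), of s] unfolding one_sided_limits_def by blast
  qed
  note KC = KC1I(1)[OF SP contx t01 der contv lim] and velx = KC1I(2)[OF SP contx t01 der contv lim]
  have "admissible t0 t1 x0 x1 x"
    using KC adm tent_left[OF pqr(1,2), of t0] tent_right[OF pqr(1,2), of t1] pqr
    by (auto simp: admissible_def x_def)
  moreover have "(SUP t\<in>?I. ereal (norm (x t - xb t))) \<le> ereal d"
  proof (rule SUP_least)
    fix t
    have "norm (x t - xb t) = ?T t * norm \<eta>" using tent_bounds(1)[of p q r t] by (simp add: x_def)
    also have "\<dots> \<le> 1 * norm \<eta>"
      using tent_bounds(2)[of p r q t] pqr by (intro mult_right_mono) auto
    finally show "ereal (norm (x t - xb t)) \<le> ereal d" using \<eta> by simp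
  qed
  moreover have "esssup (lebesgue_on ?I) (\<lambda>t. ereal (norm (vel ?I x t - vel ?I xb t))) \<le> ereal d"
  proof (rule esssup_I)
    \<comment> \<open>Off a finite set the difference of the velocities is the explicit step
      function \<open>?K t *\<^sub>R \<eta>\<close>; at the remaining points \<open>vel\<close> may
      be arbitrary.\<close>
    show "(\<lambda>t. ereal (norm (vel ?I x t - vel ?I xb t))) \<in> borel_measurable (lebesgue_on ?I)"
    proof (rule measurable_discrete_difference)
      have "(\<lambda>t. ereal (norm (?K t *\<^sub>R \<eta>))) \<in> borel_measurable borel"
        unfolding tent_slope_def by measurable
      then show "(\<lambda>t. ereal (norm (?K t *\<^sub>R \<eta>))) \<in> borel_measurable (lebesgue_on ?I)"
        by (intro measurable_restrict_space1 measurable_completion) simp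
      show "countable (S \<union> P)" using SP by (intro countable_finite)
      show "{t} \<in> sets (lebesgue_on ?I)" if "t \<in> S \<union> P" for t
        using that SP(2) by (auto simp: sets_restrict_space_iff)
      show "ereal (norm (?K t *\<^sub>R \<eta>)) = ereal (norm (vel ?I x t - vel ?I xb t))"
        if "t \<in> space (lebesgue_on ?I)" "t \<notin> S \<union> P" for t
        using velx[of t] that by (simp add: v_def)
    qed auto
    have "S \<union> P \<in> null_sets lborel" using SP by (intro finite_imp_null_set_lborel)
    then have "S \<union> P \<in> null_sets (lebesgue_on ?I)"
      using SP(2) by (subst null_sets_restrict_space) (auto intro: null_sets_completionI)
    then have "AE t in lebesgue_on ?I. t \<notin> S \<union> P" by (rule AE_not_in)
    moreover have "AE t in lebesgue_on ?I. t \<in> ?I" using AE_space[of "lebesgue_on ?I"] by simp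
    ultimately show "AE t in lebesgue_on ?I. ereal (norm (vel ?I x t - vel ?I xb t)) \<le> ereal d"
    proof eventually_elim
      case (elim t)
      have "\<bar>?K t\<bar> * norm \<eta> \<le> d"
        using \<eta> \<open>0 < \<gamma>\<close> order.trans[OF norm_ge_zero \<eta>(1)] unfolding tent_slope_def \<gamma>[symmetric] by auto
      with velx[of t] elim show ?case by (simp add: v_def)
    qed
  qed
  ultimately have Jle: "J L t0 t1 xb \<le> J L t0 t1 x" by (intro min) auto

  have L': "continuous_on (?I \<times> UNIV) L"
    by (intro continuous_at_imp_continuous_on) (use L in auto)
  have sub: "{p..q} \<subseteq> ?I" "{q..r} \<subseteq> ?I" "{p..q} \<subseteq> {p..r}" "{q..r} \<subseteq> {p..r}" using pqr by auto
  have cont: "continuous_on {p..q} ?G1" "continuous_on {q..r} ?G2"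
    using sub by (auto intro!: continuous_intros continuous_on_compose2[OF L'] continuous_on_subset[OF S(3)] continuous_on_subset[OF W(1)])
  have G: "(?G1 has_integral integral {p..q} ?G1) {p..q}" "(?G2 has_integral integral {q..r} ?G2) {q..r}"
    using cont by (auto intro!: integrable_integral integrable_continuous_real)
  \<comment> \<open>The difference of the integrands vanishes outside \<open>{p..r}\<close> up to
    finitely many points, so its integral is put together from the four intervals cut out by p, q
    and r.\<close>
  define \<Delta> where "\<Delta> t = L (t, x t, vel ?I x t) - L (t, xb t, vel ?I xb t)" for t
  have \<Delta>0: "\<Delta> t = 0" if "t \<in> ?I - (S \<union> P)" "t < p \<or> r < t" for t
    using that velx[of t] pqr by (auto simp: \<Delta>_def v_def x_def tent_left tent_right tent_slope_def)
  have "(\<Delta> has_integral integral {p..q} ?G1) {p..q}"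
  proof (rule has_integral_spike_finite[OF _ _ G(1)])
    show "finite (S \<union> P \<union> {p, q, r})" using SP by simp
    fix t assume "t \<in> {p..q} - (S \<union> P \<union> {p, q, r})"
    then show "\<Delta> t = ?G1 t" using velx[of t] W(2)[of t] pqr
      by (simp add: \<Delta>_def v_def x_def tent_up tent_slope_def)
  qed
  moreover have "(\<Delta> has_integral integral {q..r} ?G2) {q..r}"
  proof (rule has_integral_spike_finite[OF _ _ G(2)])
    show "finite (S \<union> P \<union> {p, q, r})" using SP by simp
    fix t assume "t \<in> {q..r} - (S \<union> P \<union> {p, q, r})"
    then show "\<Delta> t = ?G2 t" using velx[of t] W(2)[of t] pqr
      by (simp add: \<Delta>_def v_def x_def tent_down tent_slope_def \<gamma>)
  qed
  ultimately have "(\<Delta> has_integral (integral {p..q} ?G1 + integral {q..r} ?G2)) {p..r}"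
    using pqr by (intro has_integral_combine[of p q r]) auto
  moreover have zero: "(\<Delta> has_integral 0) {t0..p}" "(\<Delta> has_integral 0) {r..t1}"
    by (rule has_integral_spike_finite[of "S \<union> P \<union> {p, q, r}" _ _ "\<lambda>_. 0"]; use SP \<Delta>0 pqr in auto)+
  ultimately have "(\<Delta> has_integral (0 + (integral {p..q} ?G1 + integral {q..r} ?G2))) {t0..r}"
    using pqr by (intro has_integral_combine[of t0 p r]) auto
  from has_integral_combine[OF _ pqr(4) this zero(2)]
  have \<Delta>: "(\<Delta> has_integral (integral {p..q} ?G1 + integral {q..r} ?G2)) ?I" using pqr by simp
  \<comment> \<open>Adding the integral of \<Delta> to that of the minimizer gives integrability and
    value for the perturbed function at once.\<close>
  have "((\<lambda>t. L (t, xb t, vel ?I xb t) + \<Delta> t) has_integral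
      (J L t0 t1 xb + (integral {p..q} ?G1 + integral {q..r} ?G2))) ?I"
    unfolding J_def by (intro has_integral_add \<Delta> integrable_integral integrable_Lagrangian K1 L)
  then have "((\<lambda>t. L (t, x t, vel ?I x t)) has_integral
      (J L t0 t1 xb + (integral {p..q} ?G1 + integral {q..r} ?G2))) ?I"
    by (simp add: \<Delta>_def)
  then have "J L t0 t1 x = J L t0 t1 xb + (integral {p..q} ?G1 + integral {q..r} ?G2)"
    unfolding J_def by (rule integral_unique)
  with Jle show ?thesis by simp
qed

section \<open>Weak minimizers\<close>

lemma integral_reflect_about:
  fixes f :: "real \<Rightarrow> real"
  shows "integral {\<theta> - b..\<theta> - a} f = integral {a..b} (\<lambda>t. f (\<theta> - t))"
  using integral_shift_real_ivl[of "\<theta> - b" \<theta> "\<theta> - a" f]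
    Henstock_Kurzweil_Integration.integral_reflect_real[of b a "\<lambda>t. f (\<theta> - t)"]
  by (simp add: add.commute)

abbreviation phase_domain :: "ereal \<Rightarrow> ereal \<Rightarrow> (real \<times> (real^'n) \<times> (real^'n)) set" where
  "phase_domain a b \<equiv> einterval a b \<times> UNIV \<times> UNIV"

lemma open_phase_domain: "open (phase_domain a b)"
  by (intro open_Times open_einterval open_UNIV)

text \<open>\<open>d\<close> is the radius from the definition of a weak minimum; it stays fixed and
  later bounds all directions \<eta>.\<close>

locale C1_weak_minimizer =
  fixes L :: "real \<times> (real^'n) \<times> (real^'n) \<Rightarrow> real"
    and L' :: "real \<times> (real^'n) \<times> (real^'n) \<Rightarrow> (real \<times> (real^'n) \<times> (real^'n)) \<Rightarrow>\<^sub>L real"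
    and a b :: ereal and t0 t1 :: real and x0 x1 :: "real^'n" and xb :: "real \<Rightarrow> real^'n" and d :: real
  assumes L: "\<And>z. z \<in> phase_domain a b \<Longrightarrow> (L has_derivative L' z) (at z)"
    and L': "continuous_on (phase_domain a b) L'"
    and I: "{t0..t1} \<subseteq> einterval a b"
    and adm: "admissible t0 t1 x0 x1 xb"
    and min: "\<And>x. admissible t0 t1 x0 x1 x \<Longrightarrow>
        max (SUP t\<in>{t0..t1}. ereal (norm (x t - xb t)))
            (esssup (lebesgue_on {t0..t1})
               (\<lambda>t. ereal (norm (vel {t0..t1} x t - vel {t0..t1} xb t)))) \<le> ereal d
        \<Longrightarrow> J L t0 t1 xb \<le> J L t0 t1 x"
begin

lemma isCont_L: "t \<in> {t0..t1} \<Longrightarrow> isCont L (t, y, v)"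
  using has_derivative_continuous[OF L[of "(t, y, v)"]] I by auto

lemma continuous_xb: "continuous_on {t0..t1} xb"
  using adm by (simp add: admissible_def KC1_def)

text \<open>For the left-hand variation the tent is traversed backwards: its first slope is
  \<open>- s \<mu> \<eta>\<close> and its second slope is \<open>s \<eta>\<close>.\<close>

lemma hat_minimal_along:
  assumes \<sigma>: "\<sigma> = 1 \<or> \<sigma> = - 1" and e0: "0 < e0" "e0 \<le> 1"
    and sub: "(\<lambda>\<tau>. \<theta> + \<sigma> * \<tau>) ` {0..e0} \<subseteq> {t0..t1}"
    and W: "continuous_on ((\<lambda>\<tau>. \<theta> + \<sigma> * \<tau>) ` {0..e0}) W"
    and vel: "\<And>\<tau>. 0 < \<tau> \<Longrightarrow> \<tau> < e0 \<Longrightarrow> vel {t0..t1} xb (\<theta> + \<sigma> * \<tau>) = W (\<theta> + \<sigma> * \<tau>)"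
    and \<eta>: "norm \<eta> \<le> d"
  shows "hat_minimal_curve L L' (phase_domain a b) (\<lambda>\<tau>. (\<theta> + \<sigma> * \<tau>, xb (\<theta> + \<sigma> * \<tau>), W (\<theta> + \<sigma> * \<tau>))) e0
     (0, \<sigma> *\<^sub>R \<eta>, 0) (0, 0, \<eta>)"
proof unfold_locales
  let ?c = "\<lambda>\<tau>. (\<theta> + \<sigma> * \<tau>, xb (\<theta> + \<sigma> * \<tau>), W (\<theta> + \<sigma> * \<tau>))"
  show "open (phase_domain a b)" by (rule open_phase_domain)
  show "\<And>z r s. z \<in> phase_domain a b \<Longrightarrow> z + r *\<^sub>R (0, \<sigma> *\<^sub>R \<eta>, 0) + s *\<^sub>R (0, 0, \<eta>) \<in> phase_domain a b"
    by auto
  show "continuous_on {0..e0} ?c"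
    by (intro continuous_intros continuous_on_compose2[OF W] continuous_on_compose2[OF continuous_xb] sub) auto
  show "?c \<tau> \<in> phase_domain a b" if "0 \<le> \<tau>" "\<tau> \<le> e0" for \<tau>
    using that sub I by (auto simp: image_subset_iff subset_eq)
  show "hat_minimal L ?c e0 (0, \<sigma> *\<^sub>R \<eta>, 0) (0, 0, \<eta>)"
    unfolding hat_minimal_def
  proof (intro allI impI, elim conjE)
    fix s e m :: real assume s: "\<bar>s\<bar> \<le> 1" and m: "0 < m" "m \<le> e / 2" and e: "e \<le> e0"
    define \<mu> where "\<mu> = m / (e - m)"
    \<comment> \<open>Since \<open>m \<le> e / 2\<close>, the return slope is no steeper than the
      first one, so a single bound on \<eta> keeps both within \<open>d\<close>.\<close>
    have \<mu>: "0 < \<mu>" "\<mu> \<le> 1" "\<mu> * (e - m) = m" using m by (auto simp: \<mu>_def)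
    have s\<eta>: "norm (s *\<^sub>R \<eta>) \<le> d" using mult_mono[OF s \<eta>] by simp
    have \<mu>s\<eta>: "\<mu> * norm (s *\<^sub>R \<eta>) \<le> d" using mult_mono[OF \<mu>(2) s\<eta>] by simp
    from \<sigma> show "0 \<le> integral {0..m} (\<lambda>t. L (?c t + (s * t) *\<^sub>R (0, \<sigma> *\<^sub>R \<eta>, 0) + s *\<^sub>R (0, 0, \<eta>)) - L (?c t))
      + integral {m..e} (\<lambda>t. L (?c t + (s * (m / (e - m) * (e - t))) *\<^sub>R (0, \<sigma> *\<^sub>R \<eta>, 0)
           - (s * (m / (e - m))) *\<^sub>R (0, 0, \<eta>)) - L (?c t))"
    proof
      assume \<sigma>: "\<sigma> = 1"
      have img: "(\<lambda>\<tau>. \<theta> + \<sigma> * \<tau>) ` {0..e0} = {\<theta>..\<theta> + e0}" using \<sigma> by simp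
      let ?G1 = "\<lambda>t. L (t, xb t + (t - \<theta>) *\<^sub>R s *\<^sub>R \<eta>, W t + s *\<^sub>R \<eta>) - L (t, xb t, W t)"
      let ?G2 = "\<lambda>t. L (t, xb t + (\<mu> * (\<theta> + e - t)) *\<^sub>R s *\<^sub>R \<eta>, W t - \<mu> *\<^sub>R s *\<^sub>R \<eta>) - L (t, xb t, W t)"
      have "0 \<le> integral {\<theta>..\<theta> + m} ?G1 + integral {\<theta> + m..\<theta> + e} ?G2"
      proof (rule tent_variation[OF isCont_L adm min])
        show "continuous_on {\<theta>..\<theta> + e} W" using W e unfolding img by (auto elim: continuous_on_subset)
        show "vel {t0..t1} xb t = W t" if "t \<in> {\<theta><..<\<theta> + e}" for t
          using vel[of "t - \<theta>"] that e \<sigma> by simp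
      qed (use sub[unfolded img] e0 e m s\<eta> \<mu>s\<eta> in \<open>auto simp: \<mu>_def\<close>)
      also have "integral {\<theta>..\<theta> + m} ?G1 = integral {0..m} (\<lambda>t. ?G1 (t + \<theta>))"
        using integral_shift_real_ivl[of \<theta> \<theta> "\<theta> + m" ?G1] by simp
      also have "integral {\<theta> + m..\<theta> + e} ?G2 = integral {m..e} (\<lambda>t. ?G2 (t + \<theta>))"
        using integral_shift_real_ivl[of "\<theta> + m" \<theta> "\<theta> + e" ?G2] by simp
      finally show ?thesis using \<sigma> by (simp add: mult_ac add_ac flip: \<mu>_def)
    next
      assume \<sigma>: "\<sigma> = - 1"
      have img: "(\<lambda>\<tau>. \<theta> + \<sigma> * \<tau>) ` {0..e0} = {\<theta> - e0..\<theta>}" using \<sigma> by simp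
      let ?\<eta> = "(- \<mu> * s) *\<^sub>R \<eta>"
      let ?G1 = "\<lambda>t. L (t, xb t + (t - (\<theta> - e)) *\<^sub>R ?\<eta>, W t + ?\<eta>) - L (t, xb t, W t)"
      let ?G2 = "\<lambda>t. L (t, xb t + (1 / \<mu> * (\<theta> - t)) *\<^sub>R ?\<eta>, W t - (1 / \<mu>) *\<^sub>R ?\<eta>) - L (t, xb t, W t)"
      have "norm ?\<eta> = \<mu> * norm (s *\<^sub>R \<eta>)" using \<mu> by (simp add: abs_mult)
      then have n: "norm ?\<eta> \<le> d" "1 / \<mu> * norm ?\<eta> \<le> d" using s\<eta> \<mu>s\<eta> \<mu> by auto
      \<comment> \<open>In the direction of time the first stretch has length e - m and the second
        has length m, so the ratio of the slopes is the reciprocal of \<mu>.\<close>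
      have g: "1 / \<mu> = (\<theta> - m - (\<theta> - e)) / (\<theta> - (\<theta> - m))" by (simp add: \<mu>_def)
      have "0 \<le> integral {\<theta> - e..\<theta> - m} ?G1 + integral {\<theta> - m..\<theta>} ?G2"
      proof (rule tent_variation[OF isCont_L adm min])
        show "continuous_on {\<theta> - e..\<theta>} W" using W e unfolding img by (auto elim: continuous_on_subset)
        show "vel {t0..t1} xb t = W t" if "t \<in> {\<theta> - e<..<\<theta>}" for t
          using vel[of "\<theta> - t"] that e \<sigma> by simp
      qed (use sub[unfolded img] e0 e m n g in auto)
      also have "integral {\<theta> - e..\<theta> - m} ?G1 = integral {m..e} (\<lambda>t. ?G1 (\<theta> - t))"
        by (rule integral_reflect_about)
      also have "integral {\<theta> - m..\<theta>} ?G2 = integral {0..m} (\<lambda>t. ?G2 (\<theta> - t))"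
        using integral_reflect_about[of \<theta> m 0 ?G2] by simp
      finally show ?thesis using \<sigma> \<mu>(1) by (simp add: mult_ac add_ac flip: \<mu>_def)
    qed
  qed
qed (use L L' e0 in auto)

end

section \<open>Twice differentiable Lagrangians\<close>

text \<open>\<open>grad\<close> is a definite description: the adjoint of the derivative applied to
  1 is the witness, and uniqueness of derivatives makes it the only one.\<close>

lemma inner_grad:
  fixes f :: "'a::euclidean_space \<Rightarrow> real"
  assumes "(f has_derivative f') (at y)"
  shows "grad f y \<bullet> h = f' h"
proof -
  have lin: "linear f'" using assms by (rule has_derivative_linear)
  have *: "h \<bullet> adjoint f' 1 = f' h" for h using adjoint_works[OF lin, of h 1] by simp
  then have G: "GDERIV f y :> adjoint f' 1" using assms by (simp add: gderiv_def)
  have "grad f y = adjoint f' 1"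
    unfolding grad_def
  proof (rule the_equality[where P = "\<lambda>D. GDERIV f y :> D", OF G])
    fix D assume "GDERIV f y :> D"
    then have "(\<lambda>h. h \<bullet> D) = (\<lambda>h. h \<bullet> adjoint f' 1)"
      using G unfolding gderiv_def by (rule has_derivative_unique)
    then have "\<forall>h. h \<bullet> D = h \<bullet> adjoint f' 1" by (simp add: fun_eq_iff)
    then show "D = adjoint f' 1" by (simp only: vector_eq_ldot)
  qed
  then show ?thesis using * by (simp add: inner_commute)
qed

lemma jacobian_mult_vec:
  fixes f :: "real^'n \<Rightarrow> real^'m"
  assumes "(f has_derivative f') (at v)"
  shows "jacobian f (at v) *v h = f' h"
  using fun_cong[OF matrix_vector_mul(2)[OF has_derivative_linear[OF assms]], of h]
  by (simp add: jacobian_def flip: frechet_derivative_at[OF assms])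

lemma matrix_component: "(A :: real^'n^'m) $ i $ j = axis i 1 \<bullet> (A *v axis j 1)"
  by (simp add: matrix_vector_mult_basis column_def inner_axis')

lemma has_derivative_Pair_const:
  "((\<lambda>w. (t, x, w)) has_derivative (\<lambda>h. (0, 0, h))) (at v)"
  "((\<lambda>y. (t, y, v)) has_derivative (\<lambda>h. (0, h, 0))) (at x)"
  by (auto intro!: derivative_eq_intros)

text \<open>\<open>L''\<close> and \<open>M''\<close> are pointwise derivatives without continuity.
  \<open>M'\<close> is carried besides \<open>L''\<close> because, being differentiable, it is
  continuous and gives the Legendre form a derivative.\<close>

locale smooth_weak_minimizer = C1_weak_minimizer L L' a b t0 t1 x0 x1 xb d
  for L :: "real \<times> (real^'n) \<times> (real^'n) \<Rightarrow> real" and L' a b t0 t1 x0 x1 xb d +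
  fixes L'' :: "real \<times> (real^'n) \<times> (real^'n) \<Rightarrow> real \<times> (real^'n) \<times> (real^'n) \<Rightarrow> (real \<times> (real^'n) \<times> (real^'n)) \<Rightarrow>\<^sub>L real"
    and M' :: "real \<times> (real^'n) \<times> (real^'n) \<Rightarrow> (real \<times> (real^'n) \<times> (real^'n)) \<Rightarrow>\<^sub>L (real^'n)"
    and M'' :: "real \<times> (real^'n) \<times> (real^'n) \<Rightarrow> real \<times> (real^'n) \<times> (real^'n) \<Rightarrow> (real \<times> (real^'n) \<times> (real^'n)) \<Rightarrow>\<^sub>L (real^'n)"
  assumes L'': "\<And>z. z \<in> phase_domain a b \<Longrightarrow> (L' has_derivative L'' z) (at z)"
    and M': "\<And>z. z \<in> phase_domain a b \<Longrightarrow> (grad_v L has_derivative M' z) (at z)"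
    and M'': "\<And>z. z \<in> phase_domain a b \<Longrightarrow> (M' has_derivative M'' z) (at z)"
begin

abbreviation "D \<equiv> (phase_domain a b :: (real \<times> (real^'n) \<times> (real^'n)) set)"

lemma inner_grad_v: "z \<in> D \<Longrightarrow> grad_v L z \<bullet> w = L' z (0, 0, w)"
  using inner_grad[OF has_derivative_compose[OF has_derivative_Pair_const(1) L]]
  by (cases z) (simp add: grad_v_def)

lemma inner_grad_x: "z \<in> D \<Longrightarrow> grad_x L z \<bullet> y = L' z (0, y, 0)"
  using inner_grad[OF has_derivative_compose[OF has_derivative_Pair_const(2) L]]
  by (cases z) (simp add: grad_x_def)

lemma has_derivative_Lx: "z \<in> D \<Longrightarrow> ((\<lambda>z. L' z u) has_derivative (\<lambda>h. L'' z h u)) (at z)"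
  using blinfun.FDERIV[OF L'' has_derivative_const[of u]] by simp

lemma has_derivative_Lv:
  assumes "z \<in> D" shows "((\<lambda>z. L' z (0, 0, w)) has_derivative (\<lambda>h. M' z h \<bullet> w)) (at z)"
  by (rule has_derivative_transform_within_open[OF has_derivative_inner_left[OF M'[OF assms]] open_phase_domain assms])
    (rule inner_grad_v)

lemma hess_vv_mult_vec: "z \<in> D \<Longrightarrow> hess_vv L z *v w = M' z (0, 0, w)"
  using jacobian_mult_vec[OF has_derivative_compose[OF has_derivative_Pair_const(1) M']]
  by (cases z) (simp add: hess_vv_def)

lemma has_derivative_grad_x:
  assumes z: "z \<in> D"
  shows "(grad_x L has_derivative (\<lambda>h. \<Sum>i\<in>Basis. L'' z h (0, i, 0) *\<^sub>R i)) (at z)"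
proof (subst has_derivative_componentwise_within, rule ballI)
  fix i :: "real^'n" assume i: "i \<in> Basis"
  have "((\<lambda>z. grad_x L z \<bullet> i) has_derivative (\<lambda>h. L'' z h (0, i, 0))) (at z)"
    by (rule has_derivative_transform_within_open[OF has_derivative_Lx[OF z] open_phase_domain z])
      (rule inner_grad_x[symmetric])
  then show "((\<lambda>z. grad_x L z \<bullet> i) has_derivative (\<lambda>h. (\<Sum>i\<in>Basis. L'' z h (0, i, 0) *\<^sub>R i) \<bullet> i)) (at z)"
    using i by simp
qed

text \<open>The first formula is the term that the variational argument produces as a derivative of
  \<open>L' z (0, y, 0)\<close>. The second is the same mixed derivative in the other order,
  expressed by the better behaved \<open>M'\<close>.\<close>

lemma inner_hess_xv:
  assumes z: "z \<in> D"
  shows "y \<bullet> (hess_xv L z *v w) = L'' z (0, 0, w) (0, y, 0)"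
    and "y \<bullet> (hess_xv L z *v w) = M' z (0, y, 0) \<bullet> w"
proof -
  obtain t x v where txv: "z = (t, x, v)" by (cases z)
  let ?G = "\<lambda>h. \<Sum>i\<in>Basis. L'' z (0, 0, h) (0, i, 0) *\<^sub>R i"
  have G: "((\<lambda>w. grad_x L (t, x, w)) has_derivative ?G) (at v)"
    using has_derivative_compose[OF has_derivative_Pair_const(1) has_derivative_grad_x[OF z[unfolded txv]]]
    by (simp add: txv)
  have "hess_xv L z *v w = ?G w" using jacobian_mult_vec[OF G] by (simp add: hess_xv_def txv)
  moreover have "?G w \<bullet> y = L'' z (0, 0, w) (0, y, 0)"
  proof -
    have "((\<lambda>w. grad_x L (t, x, w) \<bullet> y) has_derivative (\<lambda>h. ?G h \<bullet> y)) (at v)"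
      using G by (rule has_derivative_inner_left)
    moreover have "((\<lambda>w. L' (t, x, w) (0, y, 0)) has_derivative (\<lambda>h. L'' z (0, 0, h) (0, y, 0))) (at v)"
      using has_derivative_compose[OF has_derivative_Pair_const(1) has_derivative_Lx[OF z[unfolded txv]]]
      by (simp add: txv)
    moreover have "grad_x L (t, x, w) \<bullet> y = L' (t, x, w) (0, y, 0)" for w
      using z txv by (intro inner_grad_x) auto
    ultimately have "(\<lambda>h. ?G h \<bullet> y) = (\<lambda>h. L'' z (0, 0, h) (0, y, 0))"
      using has_derivative_unique by auto
    then show ?thesis by (rule fun_cong)
  qed
  ultimately show 1: "y \<bullet> (hess_xv L z *v w) = L'' z (0, 0, w) (0, y, 0)" by (simp add: inner_commute)
  show "y \<bullet> (hess_xv L z *v w) = M' z (0, y, 0) \<bullet> w"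
    unfolding 1 by (rule mixed_derivatives_eq[OF open_phase_domain z L has_derivative_Lx[OF z] has_derivative_Lv[OF z]])
qed

lemma isCont_M': "z \<in> D \<Longrightarrow> isCont (\<lambda>z. M' z h) z"
  using has_derivative_continuous[OF M''] by (intro continuous_intros) auto

lemma isCont_matrix:
  fixes A :: "real \<times> (real^'n) \<times> (real^'n) \<Rightarrow> real^'n^'n"
  assumes z: "z \<in> D" and A: "\<And>i j z. z \<in> D \<Longrightarrow> axis i 1 \<bullet> (A z *v axis j 1) = f i j z"
    and f: "\<And>i j. isCont (f i j) z"
  shows "isCont A z"
  unfolding isCont_def
proof (intro vec_tendstoI)
  fix i j
  have "\<forall>\<^sub>F y in at z. y \<in> D" using z open_phase_domain by (intro eventually_at_in_open') auto
  then have "\<forall>\<^sub>F y in at z. f i j y = A y $ i $ j"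
    by eventually_elim (simp only: matrix_component A)
  moreover have "(f i j \<longlongrightarrow> A z $ i $ j) (at z)"
    using f[of i j] by (simp only: isCont_def matrix_component A[OF z])
  ultimately show "((\<lambda>y. A y $ i $ j) \<longlongrightarrow> A z $ i $ j) (at z)"
    by (rule Lim_transform_eventually[rotated])
qed

text \<open>The derivative of \<open>grad_x L\<close> need not be continuous, but by symmetry its velocity block is the
  transpose of a block of the derivative of \<open>grad_v L\<close>, which is.\<close>

lemma isCont_hess:
  assumes z: "z \<in> D"
  shows "isCont (hess_xv L) z" "isCont (hess_vv L) z"
proof -
  show "isCont (hess_xv L) z"
    by (rule isCont_matrix[OF z inner_hess_xv(2)], assumption, intro continuous_intros isCont_M' z)
  show "isCont (hess_vv L) z"
  proof (rule isCont_matrix[OF z])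
    show "axis i 1 \<bullet> (hess_vv L z *v axis j 1) = axis i 1 \<bullet> M' z (0, 0, axis j 1)" if "z \<in> D" for i j z
      by (simp only: hess_vv_mult_vec[OF that])
  qed (intro continuous_intros isCont_M' z)
qed

section \<open>Excess, Legendre form and the conditions along one-sided curves\<close>

definition excess :: "real^'n \<Rightarrow> real \<times> (real^'n) \<times> (real^'n) \<Rightarrow> real" where
  "excess \<eta> z = L (z + (0, 0, \<eta>)) - L z - grad_v L z \<bullet> \<eta>"

definition excess' :: "real^'n \<Rightarrow> real \<times> (real^'n) \<times> (real^'n) \<Rightarrow> real \<times> (real^'n) \<times> (real^'n) \<Rightarrow> real" where
  "excess' \<eta> z h = L' (z + (0, 0, \<eta>)) h - L' z h - M' z h \<bullet> \<eta>"

definition legendre_form :: "real^'n \<Rightarrow> real \<times> (real^'n) \<times> (real^'n) \<Rightarrow> real" where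
  "legendre_form \<eta> z = \<eta> \<bullet> (hess_vv L z *v \<eta>)"

definition legendre_form' :: "real^'n \<Rightarrow> real \<times> (real^'n) \<times> (real^'n) \<Rightarrow> real \<times> (real^'n) \<times> (real^'n) \<Rightarrow> real" where
  "legendre_form' \<eta> z h = M'' z h (0, 0, \<eta>) \<bullet> \<eta>"

lemma shift_D: "z \<in> D \<Longrightarrow> z + (0, 0, \<eta>) \<in> D" by (cases z) auto

lemma has_derivative_excess:
  assumes z: "z \<in> D" shows "(excess \<eta> has_derivative excess' \<eta> z) (at z)"
proof -
  have "((\<lambda>z. z + (0, 0, \<eta>)) has_derivative (\<lambda>h. h)) (at z)"
    by (auto intro!: derivative_eq_intros)
  from has_derivative_compose[OF this L[OF shift_D[OF z]]]
  show ?thesis unfolding excess_def[abs_def] excess'_def[abs_def]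
    by (intro has_derivative_diff L z has_derivative_inner_left M') simp
qed

lemma has_derivative_legendre_form_aux:
  assumes z: "z \<in> D" shows "((\<lambda>z. M' z (0, 0, \<eta>) \<bullet> \<eta>) has_derivative legendre_form' \<eta> z) (at z)"
  using has_derivative_inner_left[OF blinfun.FDERIV[OF M''[OF z] has_derivative_const[of "(0, 0, \<eta>)"]], of \<eta>]
  by (simp add: legendre_form'_def[abs_def])

lemma has_derivative_legendre_form:
  assumes z: "z \<in> D" shows "(legendre_form \<eta> has_derivative legendre_form' \<eta> z) (at z)"
  by (rule has_derivative_transform_within_open[OF has_derivative_legendre_form_aux[OF z] open_phase_domain z])
    (simp add: legendre_form_def hess_vv_mult_vec inner_commute)


text \<open>The remainder of the linearisation of \<open>grad_x L\<close> in the velocity, paired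
  with \<eta>: the part of the condition without a derivative along the curve.\<close>

definition degeneracy_form :: "real^'n \<Rightarrow> real \<times> (real^'n) \<times> (real^'n) \<Rightarrow> real" where
  "degeneracy_form \<eta> z = \<eta> \<bullet> (grad_x L (z + (0, 0, \<eta>)) - grad_x L z - hess_xv L z *v \<eta>)"

text \<open>No degeneracy is assumed at \<theta>: the two-sided case needs these signs at every
  point of a neighbourhood.\<close>

lemma excess_nonneg:
  assumes \<sigma>: "\<sigma> = 1 \<or> \<sigma> = - 1" and e1: "0 < e1"
    and sub: "(\<lambda>\<tau>. \<theta> + \<sigma> * \<tau>) ` {0..e1} \<subseteq> {t0..t1}"
    and W: "continuous_on ((\<lambda>\<tau>. \<theta> + \<sigma> * \<tau>) ` {0..e1}) W"
    and vel: "\<And>\<tau>. 0 < \<tau> \<Longrightarrow> \<tau> < e1 \<Longrightarrow> vel {t0..t1} xb (\<theta> + \<sigma> * \<tau>) = W (\<theta> + \<sigma> * \<tau>)"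
    and \<eta>: "norm \<eta> \<le> d"
  shows "0 \<le> excess \<eta> (\<theta>, xb \<theta>, W \<theta>)" "0 \<le> legendre_form \<eta> (\<theta>, xb \<theta>, W \<theta>)"
proof -
  define e0 where "e0 = min e1 1"
  have e0_props: "0 < e0" "e0 \<le> 1" "(\<lambda>\<tau>. \<theta> + \<sigma> * \<tau>) ` {0..e0} \<subseteq> (\<lambda>\<tau>. \<theta> + \<sigma> * \<tau>) ` {0..e1}" "e0 \<le> e1"
    using e1 by (auto simp: e0_def)
  let ?z = "(\<theta>, xb \<theta>, W \<theta>)"
  interpret hat_minimal_curve L L' D "\<lambda>\<tau>. (\<theta> + \<sigma> * \<tau>, xb (\<theta> + \<sigma> * \<tau>), W (\<theta> + \<sigma> * \<tau>))" e0
      "(0, \<sigma> *\<^sub>R \<eta>, 0)" "(0, 0, \<eta>)"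
    using e0_props by (intro hat_minimal_along[OF \<sigma>] order.trans[OF e0_props(3) sub] continuous_on_subset[OF W] vel \<eta>) auto
  have z: "?z \<in> D" using c_D[of 0] e0_props by simp
  show "0 \<le> excess \<eta> ?z"
    using weierstrass by (simp add: excess_def inner_grad_v[OF z])
  have "continuous (at ?z) (\<lambda>z. M' z (0, 0, \<eta>) \<bullet> \<eta>)"
    by (intro continuous_inner isCont_M' z continuous_const)
  with legendre[of "\<lambda>z h. M' z h \<bullet> \<eta>"] has_derivative_Lv
  show "0 \<le> legendre_form \<eta> ?z"
    by (simp add: legendre_form_def hess_vv_mult_vec[OF z] inner_commute)
qed

text \<open>In the parameter of the test the curve has derivative \<sigma> c' and the position
  direction is \<sigma> \<eta>, while the velocity direction is always \<eta>. Each term of the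
  condition is linear in one of the first two, so \<sigma> factors out and reverses the inequality
  on the left.\<close>

lemma one_sided_condition:
  assumes \<sigma>: "\<sigma> = 1 \<or> \<sigma> = - 1" and e1: "0 < e1"
    and sub: "(\<lambda>\<tau>. \<theta> + \<sigma> * \<tau>) ` {0..e1} \<subseteq> {t0..t1}"
    and W: "continuous_on ((\<lambda>\<tau>. \<theta> + \<sigma> * \<tau>) ` {0..e1}) W"
    and vel: "\<And>\<tau>. 0 < \<tau> \<Longrightarrow> \<tau> < e1 \<Longrightarrow> vel {t0..t1} xb (\<theta> + \<sigma> * \<tau>) = W (\<theta> + \<sigma> * \<tau>)"
    and c': "((\<lambda>t. (t, xb t, W t)) has_vector_derivative c') (at \<theta> within (\<lambda>\<tau>. \<theta> + \<sigma> * \<tau>) ` {0..e1})"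
    and \<eta>: "norm \<eta> \<le> d"
    and E0: "excess \<eta> (\<theta>, xb \<theta>, W \<theta>) = 0" and q0: "legendre_form \<eta> (\<theta>, xb \<theta>, W \<theta>) = 0"
  shows "0 \<le> \<sigma> * (degeneracy_form \<eta> (\<theta>, xb \<theta>, W \<theta>) + excess' \<eta> (\<theta>, xb \<theta>, W \<theta>) c'
           + 1/2 * legendre_form' \<eta> (\<theta>, xb \<theta>, W \<theta>) c')"
proof -
  define e0 where "e0 = min e1 1"
  have e0_props: "0 < e0" "e0 \<le> 1" "(\<lambda>\<tau>. \<theta> + \<sigma> * \<tau>) ` {0..e0} \<subseteq> (\<lambda>\<tau>. \<theta> + \<sigma> * \<tau>) ` {0..e1}" "e0 \<le> e1"
    using e1 by (auto simp: e0_def)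
  let ?z = "(\<theta>, xb \<theta>, W \<theta>)"
  let ?c = "\<lambda>\<tau>. (\<theta> + \<sigma> * \<tau>, xb (\<theta> + \<sigma> * \<tau>), W (\<theta> + \<sigma> * \<tau>))"
  interpret hat_minimal_curve L L' D ?c e0 "(0, \<sigma> *\<^sub>R \<eta>, 0)" "(0, 0, \<eta>)"
    using e0_props by (intro hat_minimal_along[OF \<sigma>] order.trans[OF e0_props(3) sub] continuous_on_subset[OF W] vel \<eta>) auto
  have z: "?z \<in> D" using c_D[of 0] e0_props by simp
  have "((\<lambda>\<tau>. \<theta> + \<sigma> * \<tau>) has_vector_derivative \<sigma>) (at 0 within {0..e0})"
    by (auto intro!: derivative_eq_intros)
  moreover have "((\<lambda>t. (t, xb t, W t)) has_vector_derivative c') (at (\<theta> + \<sigma> * 0) within (\<lambda>\<tau>. \<theta> + \<sigma> * \<tau>) ` {0..e0})"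
    using has_vector_derivative_within_subset[OF c' e0_props(3)] by simp
  ultimately have c: "(?c has_vector_derivative \<sigma> *\<^sub>R c') (at 0 within {0..e0})"
    using vector_diff_chain_within[of "\<lambda>\<tau>. \<theta> + \<sigma> * \<tau>" \<sigma> 0 "{0..e0}" "\<lambda>t. (t, xb t, W t)" c'] by (simp add: o_def)
  have L: "linear (legendre_form' \<eta> ?z)"
    using has_derivative_legendre_form[OF z] by (rule has_derivative_linear)
  have "(0, \<sigma> *\<^sub>R \<eta>, 0) = \<sigma> *\<^sub>R (0 :: real, \<eta>, 0 :: real^'n)" by simp
  then have s: "blinfun_apply B (0, \<sigma> *\<^sub>R \<eta>, 0) = \<sigma> * B (0, \<eta>, 0)" for B :: "(real \<times> (real^'n) \<times> (real^'n)) \<Rightarrow>\<^sub>L real"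
    by (simp only: blinfun.scaleR_right real_scaleR_def)
  have "0 \<le> L' (?c 0 + (0, 0, \<eta>)) (0, \<sigma> *\<^sub>R \<eta>, 0) - L' (?c 0) (0, \<sigma> *\<^sub>R \<eta>, 0) - L'' ?z (0, 0, \<eta>) (0, \<sigma> *\<^sub>R \<eta>, 0)
     + (L' (?c 0 + (0, 0, \<eta>)) (\<sigma> *\<^sub>R c') - L' (?c 0) (\<sigma> *\<^sub>R c') - M' (?c 0) (\<sigma> *\<^sub>R c') \<bullet> \<eta>)
     + legendre_form' \<eta> ?z (\<sigma> *\<^sub>R c') / 2"
  proof (rule degenerate_direction_condition[where g' = "\<lambda>z h. M' z h \<bullet> \<eta>", OF _ _ _ c])
    show "((\<lambda>z. L' z (0, \<sigma> *\<^sub>R \<eta>, 0)) has_derivative (\<lambda>h. L'' ?z h (0, \<sigma> *\<^sub>R \<eta>, 0))) (at (?c 0))"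
      using has_derivative_Lx[OF z] by simp
    show "((\<lambda>z. M' z (0, 0, \<eta>) \<bullet> \<eta>) has_derivative legendre_form' \<eta> ?z) (at (?c 0))"
      using has_derivative_legendre_form_aux[OF z] by simp
    show "L (?c 0 + (0, 0, \<eta>)) - L (?c 0) - L' (?c 0) (0, 0, \<eta>) = 0"
      using E0 by (simp add: excess_def inner_grad_v[OF z])
    show "M' (?c 0) (0, 0, \<eta>) \<bullet> \<eta> = 0"
      using q0 by (simp add: legendre_form_def hess_vv_mult_vec[OF z] inner_commute)
  qed (rule has_derivative_Lv)
  also have "L' (?c 0 + (0, 0, \<eta>)) (\<sigma> *\<^sub>R c') - L' (?c 0) (\<sigma> *\<^sub>R c') - M' (?c 0) (\<sigma> *\<^sub>R c') \<bullet> \<eta> = \<sigma> * excess' \<eta> ?z c'"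
    by (simp add: excess'_def blinfun.scaleR_right algebra_simps)
  also have "legendre_form' \<eta> ?z (\<sigma> *\<^sub>R c') = \<sigma> * legendre_form' \<eta> ?z c'"
    using linear_scale[OF L] by simp
  also have "L' (?c 0 + (0, 0, \<eta>)) (0, \<sigma> *\<^sub>R \<eta>, 0) - L' (?c 0) (0, \<sigma> *\<^sub>R \<eta>, 0) - L'' ?z (0, 0, \<eta>) (0, \<sigma> *\<^sub>R \<eta>, 0)
     = \<sigma> * degeneracy_form \<eta> ?z"
    unfolding s degeneracy_form_def inner_diff_right inner_hess_xv(1)[OF z]
    using inner_grad_x[OF z, of \<eta>] inner_grad_x[OF shift_D[OF z, of \<eta>], of \<eta>]
    by (simp add: inner_commute algebra_simps)
  finally show ?thesis by (simp add: algebra_simps)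
qed

section \<open>From curves to one-sided values and derivatives\<close>

lemma Lim_along:
  fixes G :: "real \<times> (real^'n) \<times> (real^'n) \<Rightarrow> 'b::t2_space"
  assumes "\<forall>\<^sub>F t in F. vel {t0..t1} xb t = W t" "((\<lambda>t. (t, xb t, W t)) \<longlongrightarrow> z) F" "F \<noteq> bot" "isCont G z"
  shows "Lim F (\<lambda>t. G (t, xb t, vel {t0..t1} xb t)) = G z"
proof (rule tendsto_Lim[OF assms(3)])
  have "((\<lambda>t. G (t, xb t, W t)) \<longlongrightarrow> G z) F" by (rule isCont_tendsto_compose[OF assms(4,2)])
  moreover have "\<forall>\<^sub>F t in F. G (t, xb t, W t) = G (t, xb t, vel {t0..t1} xb t)"
    using assms(1) by eventually_elim simp
  ultimately show "((\<lambda>t. G (t, xb t, vel {t0..t1} xb t)) \<longlongrightarrow> G z) F"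
    by (rule Lim_transform_eventually)
qed

text \<open>The value inserted at \<theta> is \<open>G\<close> at the one-sided velocity
  \<open>W \<theta>\<close>, so the updated function is locally \<open>G\<close> along a curve that
  is differentiable at \<theta>.\<close>

lemma vector_derivative_along:
  fixes G :: "real \<times> (real^'n) \<times> (real^'n) \<Rightarrow> real"
  assumes "\<forall>\<^sub>F t in at \<theta> within A. vel {t0..t1} xb t = W t"
    and c: "((\<lambda>t. (t, xb t, W t)) has_vector_derivative c') (at \<theta> within A)"
    and "at \<theta> within A \<noteq> bot" and G: "(G has_derivative G') (at (\<theta>, xb \<theta>, W \<theta>))"
  shows "vector_derivative ((\<lambda>t. G (t, xb t, vel {t0..t1} xb t))(\<theta> := G (\<theta>, xb \<theta>, W \<theta>))) (at \<theta> within A) = G' c'"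
proof (rule vector_derivative_within[OF assms(3)])
  \<comment> \<open>The filter ignores \<theta>, but the transfer of the derivative asks for
    \<theta> in the set.\<close>
  have ins: "at \<theta> within A = at \<theta> within (insert \<theta> A)" by (simp add: at_within_def)
  have "((\<lambda>t. G (t, xb t, W t)) has_real_derivative G' c') (at \<theta> within A)"
    using has_real_derivative_along_curve[OF c G] .
  then have "((\<lambda>t. G (t, xb t, W t)) has_derivative (\<lambda>h. h *\<^sub>R G' c')) (at \<theta> within (insert \<theta> A))"
    by (simp add: has_real_derivative_iff_has_vector_derivative has_vector_derivative_def flip: ins)
  then have "((\<lambda>t. G (t, xb t, vel {t0..t1} xb t))(\<theta> := G (\<theta>, xb \<theta>, W \<theta>)) has_derivative (\<lambda>h. h *\<^sub>R G' c')) (at \<theta> within (insert \<theta> A))"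
  proof (rule has_derivative_transform_eventually)
    show "\<forall>\<^sub>F t in at \<theta> within insert \<theta> A. G (t, xb t, W t) = ((\<lambda>t. G (t, xb t, vel {t0..t1} xb t))(\<theta> := G (\<theta>, xb \<theta>, W \<theta>))) t"
      using assms(1) unfolding ins[symmetric] by eventually_elim simp
  qed auto
  then show "((\<lambda>t. G (t, xb t, vel {t0..t1} xb t))(\<theta> := G (\<theta>, xb \<theta>, W \<theta>)) has_vector_derivative G' c') (at \<theta> within A)"
    by (simp add: has_vector_derivative_def ins)
qed

text \<open>\<open>\<sigma> = 1\<close> is the right-hand and \<open>\<sigma> = -1\<close> the left-hand version.\<close>

lemma one_sided_limit_condition:
  assumes \<sigma>: "\<sigma> = 1 \<or> \<sigma> = - 1" and "0 < \<alpha>"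
    and T: "T = {t. 0 \<le> \<sigma> * (t - \<theta>) \<and> \<sigma> * (t - \<theta>) < \<alpha>}" "T \<subseteq> {t0..t1}"
    and xb: "twice_differentiable_on xb T"
    and F: "F = at \<theta> within {t. 0 < \<sigma> * (t - \<theta>)}"
    and \<eta>: "norm \<eta> \<le> d"
    and E0: "Lim F (\<lambda>t. E_bar L {t0..t1} xb t \<eta>) = 0"
    and q0: "\<eta> \<bullet> (Lim F (Lvv_bar L {t0..t1} xb) *v \<eta>) = 0"
  shows "0 \<le> \<sigma> * (\<eta> \<bullet> (Lim F (\<lambda>t. Lx_bar L {t0..t1} xb t \<eta>) - Lim F (\<lambda>t. Lx_bar L {t0..t1} xb t 0)
            - Lim F (Lxv_bar L {t0..t1} xb) *v \<eta>)
     + vector_derivative ((\<lambda>t. E_bar L {t0..t1} xb t \<eta>)(\<theta> := Lim F (\<lambda>t. E_bar L {t0..t1} xb t \<eta>))) F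
     + 1/2 * vector_derivative ((\<lambda>t. \<eta> \<bullet> (Lvv_bar L {t0..t1} xb t *v \<eta>))
         (\<theta> := Lim F (\<lambda>t. \<eta> \<bullet> (Lvv_bar L {t0..t1} xb t *v \<eta>)))) F)"
proof -
  have \<sigma>2: "\<sigma> * (\<sigma> * x) = x" for x using \<sigma> by auto
  have \<theta>: "\<theta> \<in> T" using T \<open>0 < \<alpha>\<close> by simp
  obtain f' :: "real \<Rightarrow> real \<Rightarrow>\<^sub>L (real^'n)" where
    f: "\<And>t. t \<in> T \<Longrightarrow> (xb has_derivative f' t) (at t within T)" and f': "f' differentiable_on T"
    using xb unfolding twice_differentiable_on_def by blast
  \<comment> \<open>The velocity taken from inside \<open>T\<close>; at \<theta> it is the one-sided
    velocity, which \<open>vel\<close> need not be at an angular point.\<close>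
  define W where "W t = f' t 1" for t
  have xbW: "(xb has_vector_derivative W t) (at t within T)" if "t \<in> T" for t
  proof -
    have "f' t h = h *\<^sub>R W t" for h using blinfun.scaleR_right[of "f' t" h 1] by (simp add: W_def)
    then have "blinfun_apply (f' t) = (\<lambda>h. h *\<^sub>R W t)" by (rule ext)
    then show ?thesis using f[OF that] by (simp only: has_vector_derivative_def)
  qed
  have contW: "continuous_on T W"
    unfolding W_def[abs_def] by (intro continuous_intros differentiable_imp_continuous_on f')
  obtain f'' where "(f' has_derivative f'') (at \<theta> within T)"
    using f' \<theta> unfolding differentiable_on_def differentiable_def by blast
  from blinfun.FDERIV[OF this has_derivative_const[of 1]]
  have "W differentiable (at \<theta> within T)" unfolding W_def[abs_def] differentiable_def by blast
  then obtain w' where w': "(W has_vector_derivative w') (at \<theta> within T)"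
    using vector_derivative_works by blast
  define c' where "c' = (1 :: real, W \<theta>, w')"
  have c': "((\<lambda>t. (t, xb t, W t)) has_vector_derivative c') (at \<theta> within T)"
    unfolding c'_def by (intro has_vector_derivative_Pair xbW \<theta> w' has_vector_derivative_id)
  define O' where "O' = {t. 0 < \<sigma> * (t - \<theta>) \<and> \<sigma> * (t - \<theta>) < \<alpha>}"
  have O': "open O'" "O' \<subseteq> T" unfolding O'_def T
    by (auto intro!: open_Collect_conj open_Collect_less continuous_intros)
  have vel: "vel {t0..t1} xb t = W t" if "t \<in> O'" for t
  proof -
    have "at t within T = at t" "at t within {t0..t1} = at t"
      using that O' T(2) at_within_open_subset[of t O'] by blast+
    then show ?thesis
      using xbW[of t] that O' unfolding vel_def by (auto intro: vector_derivative_at)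
  qed
  have near: "open {t. \<sigma> * (t - \<theta>) < \<alpha>}" "\<theta> \<in> {t. \<sigma> * (t - \<theta>) < \<alpha>}"
    using \<open>0 < \<alpha>\<close> by (auto intro!: open_Collect_less continuous_intros)
  have FT: "F = at \<theta> within T"
    unfolding F by (rule at_within_nhd[OF near(2,1)]) (use \<sigma> in \<open>auto simp: T\<close>)
  have bot: "F \<noteq> bot"
  proof -
    have "{t. 0 < \<sigma> * (t - \<theta>)} = (if \<sigma> = 1 then {\<theta><..} else {..<\<theta>})" using \<sigma> by auto
    then show ?thesis unfolding F by auto
  qed
  have ev: "\<forall>\<^sub>F t in F. vel {t0..t1} xb t = W t"
  proof -
    have "\<forall>\<^sub>F t in F. t \<in> T - {\<theta>}" unfolding FT by (auto simp: eventually_at_filter)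
    then show ?thesis by eventually_elim (use \<sigma> in \<open>auto intro!: vel simp: T O'_def\<close>)
  qed
  let ?z = "(\<theta>, xb \<theta>, W \<theta>)"
  have z: "?z \<in> D" using subsetD[OF I subsetD[OF T(2) \<theta>]] by simp
  have lim: "((\<lambda>t. (t, xb t, W t)) \<longlongrightarrow> ?z) F"
    using has_vector_derivative_continuous[OF c'] by (simp add: continuous_within FT)
  have shift: "isCont (\<lambda>z. grad_x L (z + (0, 0, \<xi>))) ?z" for \<xi>
    using has_derivative_continuous[OF has_derivative_grad_x[OF shift_D[OF z]]]
    by (intro isCont_o2[where f = "\<lambda>z. z + (0, 0, \<xi>)" and g = "grad_x L"]) (auto intro!: continuous_intros)
  have E: "(\<lambda>t. E_bar L {t0..t1} xb t \<eta>) = (\<lambda>t. excess \<eta> (t, xb t, vel {t0..t1} xb t))"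
    by (simp add: E_bar_def excess_def)
  have Q: "(\<lambda>t. \<eta> \<bullet> (Lvv_bar L {t0..t1} xb t *v \<eta>)) = (\<lambda>t. legendre_form \<eta> (t, xb t, vel {t0..t1} xb t))"
    by (simp add: Lvv_bar_def legendre_form_def)
  have LE: "Lim F (\<lambda>t. E_bar L {t0..t1} xb t \<eta>) = excess \<eta> ?z"
    unfolding E by (rule Lim_along[OF ev lim bot has_derivative_continuous[OF has_derivative_excess[OF z]]])
  have LQ: "Lim F (\<lambda>t. \<eta> \<bullet> (Lvv_bar L {t0..t1} xb t *v \<eta>)) = legendre_form \<eta> ?z"
    unfolding Q by (rule Lim_along[OF ev lim bot has_derivative_continuous[OF has_derivative_legendre_form[OF z]]])
  have LX: "Lim F (\<lambda>t. Lx_bar L {t0..t1} xb t \<xi>) = grad_x L (?z + (0, 0, \<xi>))" for \<xi>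
    using Lim_along[OF ev lim bot shift[of \<xi>]] by (simp add: Lx_bar_def)
  have "Lim F (Lxv_bar L {t0..t1} xb) = hess_xv L ?z" "Lim F (Lvv_bar L {t0..t1} xb) = hess_vv L ?z"
    using Lim_along[OF ev lim bot isCont_hess(1)[OF z]] Lim_along[OF ev lim bot isCont_hess(2)[OF z]]
    by (simp_all add: Lxv_bar_def[abs_def] Lvv_bar_def[abs_def])
  note LH = this
  \<comment> \<open>Half of \<alpha>, because \<open>T\<close> is half-open and the test needs a
    closed segment.\<close>
  have seg: "(\<lambda>\<tau>. \<theta> + \<sigma> * \<tau>) ` {0..\<alpha>/2} \<subseteq> T" using \<open>0 < \<alpha>\<close> by (auto simp: T(1) \<sigma>2)
  have "0 \<le> \<sigma> * (degeneracy_form \<eta> ?z + excess' \<eta> ?z c' + 1/2 * legendre_form' \<eta> ?z c')"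
  proof (rule one_sided_condition[OF \<sigma>, of "\<alpha>/2"])
    show "vel {t0..t1} xb (\<theta> + \<sigma> * \<tau>) = W (\<theta> + \<sigma> * \<tau>)" if "0 < \<tau>" "\<tau> < \<alpha>/2" for \<tau>
      using that by (intro vel) (simp add: O'_def \<sigma>2)
    show "legendre_form \<eta> ?z = 0" using q0 by (simp add: LH legendre_form_def)
    show "excess \<eta> ?z = 0" using E0 LE by simp
  qed (use \<open>0 < \<alpha>\<close> seg T(2) \<eta> in \<open>auto intro: continuous_on_subset[OF contW] has_vector_derivative_within_subset[OF c']\<close>)
  moreover have "vector_derivative ((\<lambda>t. E_bar L {t0..t1} xb t \<eta>)(\<theta> := excess \<eta> ?z)) F = excess' \<eta> ?z c'"
    unfolding E FT
    by (rule vector_derivative_along) (use ev c' bot has_derivative_excess[OF z] in \<open>simp_all add: FT\<close>)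
  moreover have "vector_derivative ((\<lambda>t. \<eta> \<bullet> (Lvv_bar L {t0..t1} xb t *v \<eta>))(\<theta> := legendre_form \<eta> ?z)) F
      = legendre_form' \<eta> ?z c'"
    unfolding Q FT
    by (rule vector_derivative_along) (use ev c' bot has_derivative_legendre_form[OF z] in \<open>simp_all add: FT\<close>)
  ultimately show ?thesis
    unfolding LE LQ LX LH degeneracy_form_def by (simp flip: zero_prod_def)
qed

text \<open>Along the extremal the excess and the Legendre form are nonnegative near \<open>\<theta>\<close> and vanish at
  \<open>\<theta>\<close>, so their derivatives drop out of the two one-sided inequalities.\<close>

lemma two_sided_condition:
  assumes \<theta>: "\<theta> \<in> {t0<..<t1}" and xb: "twice_differentiable_at xb \<theta>" and \<eta>: "norm \<eta> \<le> d"
    and E0: "excess \<eta> (\<theta>, xb \<theta>, vel {t0..t1} xb \<theta>) = 0"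
    and q0: "legendre_form \<eta> (\<theta>, xb \<theta>, vel {t0..t1} xb \<theta>) = 0"
  shows "degeneracy_form \<eta> (\<theta>, xb \<theta>, vel {t0..t1} xb \<theta>) = 0"
proof -
  obtain f' :: "real \<Rightarrow> real \<Rightarrow>\<^sub>L (real^'n)" where
    f: "\<forall>\<^sub>F y in nhds \<theta>. (xb has_derivative f' y) (at y)" and f': "f' differentiable (at \<theta>)"
    using xb unfolding twice_differentiable_at_def by blast
  define W where "W t = f' t 1" for t
  have K1: "KC1 t0 t1 xb" using adm by (simp add: admissible_def)
  obtain S where S: "finite S" "continuous_on ({t0..t1} - S) (vel {t0..t1} xb)"
    using KC1D[OF K1] by metis
  \<comment> \<open>The neighbourhood avoids every point of \<open>S\<close> except possibly
    \<theta>, where the assumed differentiability takes over.\<close>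
  have "\<forall>\<^sub>F t in nhds \<theta>. t \<in> {t0<..<t1} - (S - {\<theta>})"
    using \<theta> S(1) by (intro eventually_nhds_in_open open_Diff finite_imp_closed) auto
  with f have "\<forall>\<^sub>F t in nhds \<theta>. (xb has_derivative f' t) (at t) \<and> t \<in> {t0<..<t1} - (S - {\<theta>})"
    by (rule eventually_conj)
  then obtain r where "0 < r" and r: "\<And>t. dist t \<theta> < r \<Longrightarrow> (xb has_derivative f' t) (at t) \<and> t \<in> {t0<..<t1} - (S - {\<theta>})"
    unfolding eventually_nhds_metric by blast
  define B where "B = {\<theta> - r<..<\<theta> + r}"
  have B: "t \<in> {t0<..<t1}" "t \<noteq> \<theta> \<Longrightarrow> t \<notin> S" "(xb has_derivative f' t) (at t)" if "t \<in> B" for t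
    using r[of t] that by (auto simp: B_def dist_real_def abs_less_iff)
  have "open B" by (simp add: B_def)
  have xbW: "(xb has_vector_derivative W t) (at t)" if "t \<in> B" for t
  proof -
    have "f' t h = h *\<^sub>R W t" for h using blinfun.scaleR_right[of "f' t" h 1] by (simp add: W_def)
    then have "blinfun_apply (f' t) = (\<lambda>h. h *\<^sub>R W t)" by (rule ext)
    then show ?thesis using B(3)[OF that] by (simp only: has_vector_derivative_def)
  qed
  have vel: "vel {t0..t1} xb t = W t" if "t \<in> B" for t
  proof -
    have "at t within {t0..t1} = at t"
      using B(1)[OF that] by (intro at_within_open_subset[of t "{t0<..<t1}"]) auto
    then show ?thesis using xbW[OF that] by (simp add: vel_def vector_derivative_at)
  qed
  obtain f'' where "(f' has_derivative f'') (at \<theta>)" using f' unfolding differentiable_def by blast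
  from blinfun.FDERIV[OF this has_derivative_const[of 1]]
  have "W differentiable (at \<theta>)" unfolding W_def[abs_def] differentiable_def by blast
  then obtain w' where w': "(W has_vector_derivative w') (at \<theta>)"
    using vector_derivative_works by blast
  \<comment> \<open>Twice differentiability at \<theta> gives continuity of \<open>W\<close> at
    \<theta> alone; at nearby points it comes from the piecewise smoothness of
    \<open>xb\<close>.\<close>
  have "isCont W t" if "t \<in> B" for t
  proof (cases "t = \<theta>")
    case True
    then show ?thesis using has_vector_derivative_continuous[OF w'] by simp
  next
    case False
    have "continuous_on (B - {\<theta>}) (vel {t0..t1} xb)"
      using B(1,2) by (intro continuous_on_subset[OF S(2)]) force
    then have "continuous_on (B - {\<theta>}) W"
      using vel continuous_on_cong[OF refl, of "B - {\<theta>}" "vel {t0..t1} xb" W] by blast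
    moreover have "open (B - {\<theta>})" using \<open>open B\<close> by auto
    ultimately show ?thesis using False that by (auto simp: continuous_on_eq_continuous_at)
  qed
  then have contW: "continuous_on B W" by (simp add: continuous_at_imp_continuous_on)
  let ?z = "(\<theta>, xb \<theta>, W \<theta>)"
  have \<theta>B: "\<theta> \<in> B" using \<open>0 < r\<close> by (simp add: B_def)
  have z: "?z \<in> D" using subsetD[OF I, of \<theta>] \<theta> by simp
  have BI: "B \<subseteq> {t0..t1}" using B(1) by force
  define c' where "c' = (1 :: real, W \<theta>, w')"
  have c': "((\<lambda>t. (t, xb t, W t)) has_vector_derivative c') (at \<theta>)"
    unfolding c'_def by (intro has_vector_derivative_Pair xbW \<theta>B w' has_vector_derivative_id)
  have nonneg: "0 \<le> excess \<eta> (t, xb t, W t)" "0 \<le> legendre_form \<eta> (t, xb t, W t)" if t: "t \<in> B" for t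
  proof -
    \<comment> \<open>A forward segment from t that stays inside \<open>B\<close>; one side suffices
      for the two signs at t.\<close>
    define e1 where "e1 = (\<theta> + r - t) / 2"
    have e1: "0 < e1" using t by (simp add: e1_def B_def)
    have seg: "(\<lambda>\<tau>. t + 1 * \<tau>) ` {0..e1} \<subseteq> B" using t by (auto simp: B_def e1_def field_simps)
    have vel': "vel {t0..t1} xb (t + 1 * \<tau>) = W (t + 1 * \<tau>)" if "0 < \<tau>" "\<tau> < e1" for \<tau>
      using that by (intro vel subsetD[OF seg]) auto
    show "0 \<le> excess \<eta> (t, xb t, W t)" "0 \<le> legendre_form \<eta> (t, xb t, W t)"
      using excess_nonneg[OF disjI1[OF refl] e1 order.trans[OF seg BI] continuous_on_subset[OF contW seg] vel' \<eta>] by auto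
  qed
  have zero: "G' c' = 0"
    if G: "(G has_derivative G') (at ?z)" "G ?z = 0" "\<And>t. t \<in> B \<Longrightarrow> 0 \<le> G (t, xb t, W t)"
    for G G' :: "real \<times> (real^'n) \<times> (real^'n) \<Rightarrow> real"
  proof (rule DERIV_local_min[OF has_real_derivative_along_curve[OF c' G(1)] \<open>0 < r\<close>])
    show "\<forall>y. \<bar>\<theta> - y\<bar> < r \<longrightarrow> G ?z \<le> G (y, xb y, W y)"
      unfolding G(2) by (intro allI impI G(3)) (auto simp: B_def abs_less_iff)
  qed
  have E0': "excess \<eta> ?z = 0" and q0': "legendre_form \<eta> ?z = 0" using E0 q0 vel[OF \<theta>B] by auto
  have E: "excess' \<eta> ?z c' = 0" by (rule zero[OF has_derivative_excess[OF z] E0' nonneg(1)])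
  have Q: "legendre_form' \<eta> ?z c' = 0" by (rule zero[OF has_derivative_legendre_form[OF z] q0' nonneg(2)])
  \<comment> \<open>With both derivatives zero, only \<sigma> times a fixed number remains, and it
    is nonnegative for both signs.\<close>
  have one_sided: "0 \<le> \<sigma> * degeneracy_form \<eta> ?z" if \<sigma>: "\<sigma> = 1 \<or> \<sigma> = - 1" for \<sigma>
  proof -
    have seg: "(\<lambda>\<tau>. \<theta> + \<sigma> * \<tau>) ` {0..r/2} \<subseteq> B" using \<sigma> \<open>0 < r\<close> by (auto simp: B_def)
    have vel': "vel {t0..t1} xb (\<theta> + \<sigma> * \<tau>) = W (\<theta> + \<sigma> * \<tau>)" if "0 < \<tau>" "\<tau> < r/2" for \<tau>
      using that by (intro vel subsetD[OF seg]) auto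
    show ?thesis
      using one_sided_condition[OF \<sigma> half_gt_zero[OF \<open>0 < r\<close>] order.trans[OF seg BI] continuous_on_subset[OF contW seg]
          vel' has_vector_derivative_at_within[OF c'] \<eta> E0' q0'] E Q by simp
  qed
  show ?thesis using one_sided[of 1] one_sided[of "-1"] vel[OF \<theta>B] by simp
qed

end

section \<open>From the smoothness classes to the one-sided and two-sided conditions\<close>

lemma twice_differentiable_onD:
  assumes "twice_differentiable_on f S" "open S"
  obtains f' f'' where "\<And>z. z \<in> S \<Longrightarrow> (f has_derivative blinfun_apply (f' z)) (at z)"
    "\<And>z. z \<in> S \<Longrightarrow> (f' has_derivative f'' z) (at z)"
proof -
  obtain f' where f': "\<And>z. z \<in> S \<Longrightarrow> (f has_derivative blinfun_apply (f' z)) (at z within S)"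
    "f' differentiable_on S"
    using assms(1) unfolding twice_differentiable_on_def by blast
  then obtain f'' where "\<And>z. z \<in> S \<Longrightarrow> (f' has_derivative f'' z) (at z within S)"
    unfolding differentiable_on_def differentiable_def by metis
  with f' show ?thesis
    using that[of f' f''] at_within_open[OF _ assms(2)] by metis
qed

lemma C2_on_imp_twice_differentiable_on: "C2_on f S \<Longrightarrow> twice_differentiable_on f S"
  unfolding C2_on_def twice_differentiable_on_def differentiable_on_def differentiable_def by blast

theorem theorem3p7:
  fixes L :: "real \<times> (real^'n) \<times> (real^'n) \<Rightarrow> real"
    and a b :: ereal and t0 t1 :: real and x0 x1 :: "real^'n" and xb :: "real \<Rightarrow> real^'n"
  defines "D \<equiv> einterval a b \<times> (UNIV :: (real^'n) set) \<times> (UNIV :: (real^'n) set)"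
    and "I \<equiv> {t0..t1}"
  assumes "t0 < t1" and "I \<subseteq> einterval a b"
    and "C1_on L D"
    and "weak_local_min L t0 t1 x0 x1 xb"
  shows "\<exists>\<delta>>0.
    (twice_differentiable_on L D \<and> twice_differentiable_on (grad_v L) D \<longrightarrow>
      (\<forall>\<theta>\<in>{t0..<t1}. \<forall>\<alpha>>0. {\<theta>..<\<theta>+\<alpha>} \<subseteq> I \<and> twice_differentiable_on xb {\<theta>..<\<theta>+\<alpha>} \<longrightarrow>
        (\<forall>\<eta>\<in>cball 0 \<delta>.
          right_val (\<lambda>t. E_bar L I xb t \<eta>) \<theta> = 0 \<and>
          \<eta> \<bullet> (right_val (Lvv_bar L I xb) \<theta> *v \<eta>) = 0 \<longrightarrow>
          \<eta> \<bullet> (right_val (\<lambda>t. Lx_bar L I xb t \<eta>) \<theta> - right_val (\<lambda>t. Lx_bar L I xb t 0) \<theta>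
                - right_val (Lxv_bar L I xb) \<theta> *v \<eta>)
          + right_deriv (\<lambda>t. E_bar L I xb t \<eta>) \<theta>
          + 1/2 * right_deriv (\<lambda>t. \<eta> \<bullet> (Lvv_bar L I xb t *v \<eta>)) \<theta> \<ge> 0)) \<and>
      (\<forall>\<theta>\<in>{t0<..t1}. \<forall>\<alpha>>0. {\<theta>-\<alpha><..\<theta>} \<subseteq> I \<and> twice_differentiable_on xb {\<theta>-\<alpha><..\<theta>} \<longrightarrow>
        (\<forall>\<eta>\<in>cball 0 \<delta>.
          left_val (\<lambda>t. E_bar L I xb t \<eta>) \<theta> = 0 \<and>
          \<eta> \<bullet> (left_val (Lvv_bar L I xb) \<theta> *v \<eta>) = 0 \<longrightarrow>
          \<eta> \<bullet> (left_val (\<lambda>t. Lx_bar L I xb t \<eta>) \<theta> - left_val (\<lambda>t. Lx_bar L I xb t 0) \<theta>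
                - left_val (Lxv_bar L I xb) \<theta> *v \<eta>)
          + left_deriv (\<lambda>t. E_bar L I xb t \<eta>) \<theta>
          + 1/2 * left_deriv (\<lambda>t. \<eta> \<bullet> (Lvv_bar L I xb t *v \<eta>)) \<theta> \<le> 0))) \<and>
    (C2_on L D \<and> C2_on (grad_v L) D \<longrightarrow>
      (\<forall>\<theta>\<in>{t0<..<t1}. twice_differentiable_at xb \<theta> \<longrightarrow>
        (\<forall>\<eta>\<in>cball 0 \<delta>.
          E_bar L I xb \<theta> \<eta> = 0 \<and> \<eta> \<bullet> (Lvv_bar L I xb \<theta> *v \<eta>) = 0 \<longrightarrow>
          \<eta> \<bullet> (grad_x L (\<theta>, xb \<theta>, vel I xb \<theta> + \<eta>) - grad_x L (\<theta>, xb \<theta>, vel I xb \<theta>)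
                - Lxv_bar L I xb \<theta> *v \<eta>) = 0)))"
proof -
  obtain d where adm: "admissible t0 t1 x0 x1 xb" and "0 < d" and min: "\<And>x. admissible t0 t1 x0 x1 x \<Longrightarrow>
        max (SUP t\<in>{t0..t1}. ereal (norm (x t - xb t)))
            (esssup (lebesgue_on {t0..t1})
               (\<lambda>t. ereal (norm (vel {t0..t1} x t - vel {t0..t1} xb t)))) \<le> ereal d
        \<Longrightarrow> J L t0 t1 xb \<le> J L t0 t1 x"
    using assms(6) unfolding weak_local_min_def by blast
  have smooth: "\<exists>L' L'' M' M''. smooth_weak_minimizer L L' a b t0 t1 x0 x1 xb d L'' M' M''"
    if L: "twice_differentiable_on L D" and Lv: "twice_differentiable_on (grad_v L) D"
  proof -
    have "open D" unfolding D_def by (rule open_phase_domain)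
    obtain L' L'' where L': "\<And>z. z \<in> D \<Longrightarrow> (L has_derivative blinfun_apply (L' z)) (at z)"
      "\<And>z. z \<in> D \<Longrightarrow> (L' has_derivative L'' z) (at z)"
      using twice_differentiable_onD[OF L \<open>open D\<close>] by blast
    obtain M' M'' where M': "\<And>z. z \<in> D \<Longrightarrow> (grad_v L has_derivative blinfun_apply (M' z)) (at z)"
      "\<And>z. z \<in> D \<Longrightarrow> (M' has_derivative M'' z) (at z)"
      using twice_differentiable_onD[OF Lv \<open>open D\<close>] by blast
    have "continuous_on D L'"
      using L'(2) by (meson continuous_at_imp_continuous_on has_derivative_continuous)
    then have "smooth_weak_minimizer L L' a b t0 t1 x0 x1 xb d L'' M' M''"
      using L' M' assms(4) adm min unfolding D_def I_def by unfold_locales auto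
    then show ?thesis by blast
  qed
  have R: "{t. 0 < (1::real) * (t - \<theta>)} = {\<theta><..}" and Lf: "{t. 0 < (-1::real) * (t - \<theta>)} = {..<\<theta>}" for \<theta> :: real
    by auto
  show ?thesis
  \<comment> \<open>The radius of the weak minimum itself serves as \<delta>, because the tents with
    \<open>norm \<eta> \<le> d\<close> stay within it.\<close>
  proof (intro exI[of _ d] conjI impI ballI allI \<open>0 < d\<close>)
    fix \<theta> \<alpha> :: real and \<eta> :: "real^'n"
    assume "twice_differentiable_on L D \<and> twice_differentiable_on (grad_v L) D"
    then obtain L' L'' M' M'' where "smooth_weak_minimizer L L' a b t0 t1 x0 x1 xb d L'' M' M''"
      using smooth by blast
    then interpret smooth_weak_minimizer L L' a b t0 t1 x0 x1 xb d L'' M' M'' .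
    assume "\<alpha> > 0" and T: "{\<theta>..<\<theta>+\<alpha>} \<subseteq> I \<and> twice_differentiable_on xb {\<theta>..<\<theta>+\<alpha>}" and \<eta>: "\<eta> \<in> cball 0 d"
      and H: "right_val (\<lambda>t. E_bar L I xb t \<eta>) \<theta> = 0 \<and> \<eta> \<bullet> (right_val (Lvv_bar L I xb) \<theta> *v \<eta>) = 0"
    have eq: "{\<theta>..<\<theta>+\<alpha>} = {t. 0 \<le> 1 * (t - \<theta>) \<and> 1 * (t - \<theta>) < \<alpha>}" by auto
    show "\<eta> \<bullet> (right_val (\<lambda>t. Lx_bar L I xb t \<eta>) \<theta> - right_val (\<lambda>t. Lx_bar L I xb t 0) \<theta>
                - right_val (Lxv_bar L I xb) \<theta> *v \<eta>)
          + right_deriv (\<lambda>t. E_bar L I xb t \<eta>) \<theta>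
          + 1/2 * right_deriv (\<lambda>t. \<eta> \<bullet> (Lvv_bar L I xb t *v \<eta>)) \<theta> \<ge> 0"
      using one_sided_limit_condition[OF disjI1[OF refl] \<open>\<alpha> > 0\<close> eq _ _ refl, of \<eta>] T H \<eta>
      unfolding R right_val_def right_deriv_def I_def by simp
  next
    fix \<theta> \<alpha> :: real and \<eta> :: "real^'n"
    assume "twice_differentiable_on L D \<and> twice_differentiable_on (grad_v L) D"
    then obtain L' L'' M' M'' where "smooth_weak_minimizer L L' a b t0 t1 x0 x1 xb d L'' M' M''"
      using smooth by blast
    then interpret smooth_weak_minimizer L L' a b t0 t1 x0 x1 xb d L'' M' M'' .
    assume "\<alpha> > 0" and T: "{\<theta>-\<alpha><..\<theta>} \<subseteq> I \<and> twice_differentiable_on xb {\<theta>-\<alpha><..\<theta>}" and \<eta>: "\<eta> \<in> cball 0 d"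
      and H: "left_val (\<lambda>t. E_bar L I xb t \<eta>) \<theta> = 0 \<and> \<eta> \<bullet> (left_val (Lvv_bar L I xb) \<theta> *v \<eta>) = 0"
    have eq: "{\<theta>-\<alpha><..\<theta>} = {t. 0 \<le> -1 * (t - \<theta>) \<and> -1 * (t - \<theta>) < \<alpha>}" by auto
    show "\<eta> \<bullet> (left_val (\<lambda>t. Lx_bar L I xb t \<eta>) \<theta> - left_val (\<lambda>t. Lx_bar L I xb t 0) \<theta>
                - left_val (Lxv_bar L I xb) \<theta> *v \<eta>)
          + left_deriv (\<lambda>t. E_bar L I xb t \<eta>) \<theta>
          + 1/2 * left_deriv (\<lambda>t. \<eta> \<bullet> (Lvv_bar L I xb t *v \<eta>)) \<theta> \<le> 0"
      using one_sided_limit_condition[OF disjI2[OF refl] \<open>\<alpha> > 0\<close> eq _ _ refl, of \<eta>] T H \<eta>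
      unfolding Lf left_val_def left_deriv_def I_def by simp
  next
    fix \<theta> :: real and \<eta> :: "real^'n"
    assume "C2_on L D \<and> C2_on (grad_v L) D"
    then have "twice_differentiable_on L D" "twice_differentiable_on (grad_v L) D"
      by (auto intro: C2_on_imp_twice_differentiable_on)
    then obtain L' L'' M' M'' where "smooth_weak_minimizer L L' a b t0 t1 x0 x1 xb d L'' M' M''"
      using smooth by blast
    then interpret smooth_weak_minimizer L L' a b t0 t1 x0 x1 xb d L'' M' M'' .
    assume \<theta>: "\<theta> \<in> {t0<..<t1}" and xb: "twice_differentiable_at xb \<theta>" and \<eta>: "\<eta> \<in> cball 0 d"
      and H: "E_bar L I xb \<theta> \<eta> = 0 \<and> \<eta> \<bullet> (Lvv_bar L I xb \<theta> *v \<eta>) = 0"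
    show "\<eta> \<bullet> (grad_x L (\<theta>, xb \<theta>, vel I xb \<theta> + \<eta>) - grad_x L (\<theta>, xb \<theta>, vel I xb \<theta>)
                - Lxv_bar L I xb \<theta> *v \<eta>) = 0"
      using two_sided_condition[OF \<theta> xb, of \<eta>] \<eta> H
      unfolding I_def by (simp add: E_bar_def Lvv_bar_def Lxv_bar_def excess_def legendre_form_def degeneracy_form_def)
  qed
qed

end
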